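(* Let $I_0\subsetneq R=K[x,y]$ be a monomial lex-segment ideal with $\dim_K(R/I_0)<\infty$, and let $h_i=\dim_K\big((R/I_0)_i\big)$ for $i\ge 0$ (with $h_{-1}=0$). Then $$\dim(V(I_0))=\dim_K(R/I_0)+1+\sum_{i\ge1}h_i(h_{i-1}-h_{i-2}).$$
   Context: $K$ is a field of any characteristic, $R=K[x,y]$. Initial ideals $\operatorname{in}(\cdot)$ are taken with respect to the degree reverse lexicographic term order induced by $x>y$ (compare total degree first; among monomials of the same degree, the one with the higher power of $x$ is larger). A monomial ideal $I_0\subset R$ is a lex-segment ideal if for every monomial $u\in I_0$ of degree $d$, all monomials $v$ of degree $d$ with $v>_{\mathrm{Lex}}u$ (where $x>y$) also lie in $I_0$. $V(I_0)=\{I\subset R\text{ ideal}: \operatorname{in}(I)=I_0\}$ (all ideals, homogeneous or not), regarded as an affine variety with coordinates the coefficients of the non-leading terms in the reduced Gröbner basis of $I$; $\dim(V(I_0))$ is its dimension as an affine variety. $(R/I_0)_i$ is the degree $i$ component of the graded ring $R/I_0$. *)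

theory Defs
  imports
    "HOL-Analysis.Analysis"
    "HOL-Library.Poly_Mapping"
    "HOL-Algebra.Algebraic_Closure_Type"
begin

section \<open>The ring $K[x,y]$, its ideals and its initial ideals\<close>

text \<open>The exponent pair (a, b) stands for the monomial $x^a y^b$. Multiplication of
  \<^typ>\<open>'a \<Rightarrow>\<^sub>0 'b\<close> is convolution.\<close>

type_synonym mon = "nat \<times> nat"
type_synonym 'k poly2 = "mon \<Rightarrow>\<^sub>0 'k"

abbreviation monomial :: "mon \<Rightarrow> 'k::field poly2" where
  "monomial m \<equiv> Poly_Mapping.single m 1"

text \<open>Ideals are the submodules of the ring as a module over itself.\<close>

lemma module_times: "Modules.module ((*) :: 'a::comm_ring_1 \<Rightarrow> 'a \<Rightarrow> 'a)"
  by unfold_locales (simp_all add: algebra_simps)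

definition is_ideal :: "'k::field poly2 set \<Rightarrow> bool" where
  "is_ideal I \<longleftrightarrow> Modules.module.subspace (*) I"

definition ideal_gen :: "'k::field poly2 set \<Rightarrow> 'k poly2 set" where
  "ideal_gen S = Modules.module.span (*) S"

fun mon_deg :: "mon \<Rightarrow> nat" where
  "mon_deg (a, b) = a + b"

fun mon_dvd :: "mon \<Rightarrow> mon \<Rightarrow> bool" where
  "mon_dvd (a, b) (c, d) \<longleftrightarrow> a \<le> c \<and> b \<le> d"

fun drl_less :: "mon \<Rightarrow> mon \<Rightarrow> bool" where
  "drl_less (a, b) (c, d) \<longleftrightarrow> a + b < c + d \<or> (a + b = c + d \<and> a < c)"

fun lex_less :: "mon \<Rightarrow> mon \<Rightarrow> bool" where
  "lex_less (a, b) (c, d) \<longleftrightarrow> a < c \<or> (a = c \<and> b < d)"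

text \<open>Only meaningful for nonzero polynomials.\<close>

definition lead_mon :: "'k::field poly2 \<Rightarrow> mon" where
  "lead_mon f = (THE m. m \<in> Poly_Mapping.keys f \<and>
     (\<forall>t \<in> Poly_Mapping.keys f. t \<noteq> m \<longrightarrow> drl_less t m))"

definition initial_ideal :: "'k::field poly2 set \<Rightarrow> 'k poly2 set" where
  "initial_ideal I = ideal_gen {monomial (lead_mon f) | f. f \<in> I \<and> f \<noteq> 0}"

definition monomial_ideal :: "'k::field poly2 set \<Rightarrow> bool" where
  "monomial_ideal I \<longleftrightarrow> (\<exists>M. I = ideal_gen (monomial ` M))"

definition lex_segment :: "'k::field poly2 set \<Rightarrow> bool" where
  "lex_segment I \<longleftrightarrow>
     (\<forall>u v. monomial u \<in> I \<and> mon_deg v = mon_deg u \<and> lex_less u v \<longrightarrow> monomial v \<in> I)"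


section \<open>Dimensions of quotient spaces and the Hilbert function\<close>

definition poly_scale :: "'k::field \<Rightarrow> 'k poly2 \<Rightarrow> 'k poly2" where
  "poly_scale c f = Poly_Mapping.single (0, 0) c * f"

lemma vector_space_poly_scale:
  "vector_space (poly_scale :: 'k::field \<Rightarrow> 'k poly2 \<Rightarrow> 'k poly2)"
proof
  fix a b :: 'k and f g :: "'k poly2"
  show "poly_scale a (f + g) = poly_scale a f + poly_scale a g"
    by (simp add: poly_scale_def algebra_simps)
  show "poly_scale (a + b) f = poly_scale a f + poly_scale b f"
    by (simp add: poly_scale_def single_add algebra_simps)
  show "poly_scale a (poly_scale b f) = poly_scale (a * b) f"
    by (simp add: poly_scale_def mult_single mult.assoc [symmetric])
  show "poly_scale 1 f = f"
    by (metis poly_scale_def zero_prod_def single_one mult_1)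
qed

text \<open>For subspaces U of W: the residue classes of the elements of B are pairwise distinct and
  form a basis of W/U.\<close>

definition quot_basis :: "'k::field poly2 set \<Rightarrow> 'k poly2 set \<Rightarrow> 'k poly2 set \<Rightarrow> bool" where
  "quot_basis W U B \<longleftrightarrow> B \<subseteq> W \<and>
     \<not> Modules.module.dependent poly_scale B \<and>
     Modules.module.span poly_scale B \<inter> U = {0} \<and>
     W \<subseteq> Modules.module.span poly_scale (B \<union> U)"

definition finite_quot_dim :: "'k::field poly2 set \<Rightarrow> 'k poly2 set \<Rightarrow> bool" where
  "finite_quot_dim W U \<longleftrightarrow> (\<exists>B. finite B \<and> quot_basis W U B)"

definition quot_dim :: "'k::field poly2 set \<Rightarrow> 'k poly2 set \<Rightarrow> nat" where
  "quot_dim W U = card (SOME B. quot_basis W U B)"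

text \<open>The homogeneous component $R_i$, and $(R/I)_i = R_i/(I \cap R_i)$ for homogeneous I. The index
  is an integer so that the value at -1 makes sense: it is the dimension of a zero space.\<close>

definition hom_comp :: "int \<Rightarrow> 'k::field poly2 set" where
  "hom_comp i = {f. \<forall>m \<in> Poly_Mapping.keys f. int (mon_deg m) = i}"

definition hilbert :: "'k::field poly2 set \<Rightarrow> int \<Rightarrow> nat" where
  "hilbert I i = quot_dim (hom_comp i) (hom_comp i \<inter> I)"


section \<open>The set $V(I_0)$ and its Groebner basis coordinates\<close>

definition V :: "'k::field poly2 set \<Rightarrow> 'k poly2 set set" where
  "V I\<^sub>0 = {I. is_ideal I \<and> initial_ideal I = I\<^sub>0}"

definition is_reduced_gb :: "'k::field poly2 set \<Rightarrow> 'k poly2 set \<Rightarrow> bool" where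
  "is_reduced_gb I G \<longleftrightarrow> finite G \<and> G \<subseteq> I \<and> 0 \<notin> G \<and>
     ideal_gen ((\<lambda>g. monomial (lead_mon g)) ` G) = initial_ideal I \<and>
     (\<forall>g \<in> G. Poly_Mapping.lookup g (lead_mon g) = 1) \<and>
     (\<forall>g \<in> G. \<forall>g' \<in> G. g' \<noteq> g \<longrightarrow>
        (\<forall>t \<in> Poly_Mapping.keys g. \<not> mon_dvd (lead_mon g') t))"

definition reduced_gb :: "'k::field poly2 set \<Rightarrow> 'k poly2 set" where
  "reduced_gb I = (THE G. is_reduced_gb I G)"

text \<open>The coordinate with index (m, t) is the coefficient of the non-leading term t in the element
  of the reduced Groebner basis with leading monomial m; it is 0 at all other indices. For ideals in
  one \<^term>\<open>V I\<^sub>0\<close> the leading monomials m are the minimal generators of $I_0$, and only t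
  smaller than m occur, so all these points lie in a common finite-dimensional coordinate
  subspace.\<close>

definition gb_coords :: "'k::field poly2 set \<Rightarrow> mon \<times> mon \<Rightarrow> 'k" where
  "gb_coords I = (\<lambda>(m, t).
     if t \<noteq> m \<and> (\<exists>g \<in> reduced_gb I. lead_mon g = m)
     then Poly_Mapping.lookup (THE g. g \<in> reduced_gb I \<and> lead_mon g = m) t else 0)"


section \<open>Zariski topology and dimension\<close>

text \<open>Polynomials in variables indexed by \<open>'i\<close>. Each involves only finitely many variables,
  so on a coordinate subspace given by a finite set of indices the topology below induces the usual
  Zariski topology.\<close>

definition mpoly_eval :: "(('i \<Rightarrow>\<^sub>0 nat) \<Rightarrow>\<^sub>0 'k::field) \<Rightarrow> ('i \<Rightarrow> 'k) \<Rightarrow> 'k" where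
  "mpoly_eval f p = (\<Sum>m \<in> Poly_Mapping.keys f. Poly_Mapping.lookup f m *
     (\<Prod>i \<in> Poly_Mapping.keys m. p i ^ Poly_Mapping.lookup m i))"

definition zariski :: "('i \<Rightarrow> 'k::field) topology" where
  "zariski = topology_generated_by (range (\<lambda>f. {p. mpoly_eval f p \<noteq> 0}))"

definition irreducible_in :: "'a topology \<Rightarrow> 'a set \<Rightarrow> bool" where
  "irreducible_in T Z \<longleftrightarrow> Z \<subseteq> topspace T \<and> Z \<noteq> {} \<and>
     (\<forall>A B. closedin T A \<and> closedin T B \<and> Z \<subseteq> A \<union> B \<longrightarrow> Z \<subseteq> A \<or> Z \<subseteq> B)"

text \<open>Supremum of the lengths n of chains $Z_0 \subset \dots \subset Z_n$ of irreducible closed sets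
  (minus infinity for the empty space).\<close>

definition krull_dim :: "'a topology \<Rightarrow> ereal" where
  "krull_dim T = Sup {ereal (real n) | n. \<exists>Z :: nat \<Rightarrow> 'a set.
     (\<forall>i\<le>n. closedin T (Z i) \<and> irreducible_in T (Z i)) \<and> (\<forall>i<n. Z i \<subset> Z (Suc i))}"

definition dim_points :: "'k::field poly2 set \<Rightarrow> ereal" where
  "dim_points I\<^sub>0 = krull_dim (subtopology zariski (gb_coords ` V I\<^sub>0))"

text \<open>Over a finite field the set of rational points of any affine variety is a finite discrete
  space, so the dimension of the variety has to be computed from its points over the algebraic
  closure, i.e. from the ideals of $\overline{K}[x,y]$ with initial ideal $I_0 \overline{K}[x,y]$.\<close>

definition extend_ac :: "'k::field poly2 set \<Rightarrow> 'k alg_closure poly2 set" where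
  "extend_ac I = ideal_gen (Poly_Mapping.map to_ac ` I)"

definition dim_variety :: "'k::field poly2 set \<Rightarrow> ereal" where
  "dim_variety I\<^sub>0 = dim_points (extend_ac I\<^sub>0)"

end

theory Submission
  imports Defs "HOL-Library.Function_Algebras" "Jordan_Normal_Form.Determinant"
begin

text \<open>
The idea is to write V(I0) as an affine space with explicit coordinates and to count them.

A lex-segment ideal of finite colength is given by a staircase: its minimal generators are
L i = x^(t-i) y^(m i) for i = 0, ..., t with 0 = m 0 < m 1 < ... < m t, and the steps
d i = m i - m (i-1) are at least 1 exactly because of the lex-segment condition. Let I be an
ideal with initial ideal I0 and let f 0, ..., f t be elements of I with leading monomials L i, where f 0
has x-degree t and the others have smaller x-degree (the reduced Groebner basis is an example). They
are a K[y]-basis of the elements of I of x-degree at most t, so there are unique relations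
x f i = y^(d i) f (i-1) + (sum over j of c i j f j) for 1 \<le> i \<le> t with c i j in K[y], and the term order
bounds the degrees of the c i j (expansion_bound, expansion_ex). Conversely, for each matrix c within these
bounds the signed maximal minors of the t \<times> (t+1) matrix of relations (a Hilbert-Burch matrix) have
the leading monomials L i and satisfy the relations (minor_lead, minor_relation), and therefore
generate an ideal with initial ideal I0 (family_ideal). Hence every matrix within the bounds occurs.

The matrix is not unique because the basis f is not: f may be replaced by (1 + a) f for unipotent
matrices a, and then c changes by the conjugation rule conjugates. Every orbit contains exactly one
canonical matrix, one whose entries satisfy deg (c i j) < d (j+1) for j < i and deg (c i j) < d i for
j \<ge> i (canonical_form_exists, canonical_form_unique). The reason is a grading: every
coefficient of a, of c and of the given matrix has a positive weight, the conjugation equations are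
homogeneous, and in each weight their linear part is triangular, so they can be solved recursively
and the solution is polynomial in the given matrix. Canonical matrices form an affine space, and
the map to V(I0) by minors and normal forms is a bijection that is polynomial in both directions
with respect to the coefficients of the reduced Groebner basis (polyfun_on_gb_coords_minor_ideal,
polyfun_on_canonical_coords, canonical_coords_minor_ideal, cell_is_minor_ideal).

It remains to see that a set with such a parametrization by K^n, K infinite, has Krull dimension n
(krull_dim_parametrized). Coordinate subspaces give a chain of length n. For the other direction, a
chain of n+1 irreducible closed sets yields n algebraically independent polynomial functions, and
counting monomials of bounded degree shows that there cannot be more of these than coordinates.

Finally, the number of coefficients of a canonical matrix is computed row by row (card_S) and
compared with the sum over the Hilbert function (sum_hilbert). Both are expressed by the degrees
D i of the generators L i, since for j \<ge> t the value h j is the number of i \<ge> 1 with D i > j. The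
count does not involve the field, so it applies to K as well as to its algebraic closure.
\<close>

section \<open>Polynomial functions and the Zariski topology\<close>

text \<open>Functions on U that are polynomial in the functions \<open>\<gamma> i\<close>. The congruence rule makes the
notion depend only on the values on U, so that it can be used for functions on subvarieties and on
sets of ideals alike; the rules are what structural inductions over polynomial functions need.\<close>

inductive polyfun_on :: "'x set \<Rightarrow> ('i \<Rightarrow> 'x \<Rightarrow> 'k::field) \<Rightarrow> ('x \<Rightarrow> 'k) \<Rightarrow> bool"
  for U :: "'x set" and \<gamma> :: "'i \<Rightarrow> 'x \<Rightarrow> 'k" where
  const: "polyfun_on U \<gamma> (\<lambda>_. c)"
| var: "polyfun_on U \<gamma> (\<gamma> i)"
| add: "polyfun_on U \<gamma> F \<Longrightarrow> polyfun_on U \<gamma> G \<Longrightarrow> polyfun_on U \<gamma> (\<lambda>x. F x + G x)"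
| mult: "polyfun_on U \<gamma> F \<Longrightarrow> polyfun_on U \<gamma> G \<Longrightarrow> polyfun_on U \<gamma> (\<lambda>x. F x * G x)"
| cong: "polyfun_on U \<gamma> F \<Longrightarrow> (\<And>x. x \<in> U \<Longrightarrow> F x = G x) \<Longrightarrow> polyfun_on U \<gamma> G"

lemma polyfun_on_uminus:
  assumes "polyfun_on U \<gamma> F" shows "polyfun_on U \<gamma> (\<lambda>x. - F x)"
  using polyfun_on.mult[OF polyfun_on.const[of U \<gamma> "-1"] assms] by simp

lemma polyfun_on_diff:
  assumes "polyfun_on U \<gamma> F" "polyfun_on U \<gamma> G" shows "polyfun_on U \<gamma> (\<lambda>x. F x - G x)"
  using polyfun_on.add[OF assms(1) polyfun_on_uminus[OF assms(2)]] by simp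

lemma polyfun_on_sum:
  assumes "\<And>j. j \<in> J \<Longrightarrow> polyfun_on U \<gamma> (F j)"
  shows "polyfun_on U \<gamma> (\<lambda>x. \<Sum>j\<in>J. F j x)"
  using assms
proof (induction J rule: infinite_finite_induct)
  case (insert j J)
  then have "polyfun_on U \<gamma> (\<lambda>x. F j x + (\<Sum>j\<in>J. F j x))"
    by (intro polyfun_on.add) simp_all
  then show ?case using insert.hyps by simp
qed (simp_all add: polyfun_on.const)

lemma polyfun_on_prod:
  assumes "\<And>j. j \<in> J \<Longrightarrow> polyfun_on U \<gamma> (F j)"
  shows "polyfun_on U \<gamma> (\<lambda>x. \<Prod>j\<in>J. F j x)"
  using assms
proof (induction J rule: infinite_finite_induct)
  case (insert j J)
  then have "polyfun_on U \<gamma> (\<lambda>x. F j x * (\<Prod>j\<in>J. F j x))"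
    by (intro polyfun_on.mult) simp_all
  then show ?case using insert.hyps by simp
qed (simp_all add: polyfun_on.const)

lemma polyfun_on_power:
  assumes "polyfun_on U \<gamma> F" shows "polyfun_on U \<gamma> (\<lambda>x. F x ^ n)"
proof (induction n)
  case (Suc n)
  show ?case using polyfun_on.mult[OF assms Suc] by simp
qed (simp add: polyfun_on.const)

text \<open>Composition with a polynomial map: what makes pulling back along a parametrization possible.\<close>

lemma polyfun_on_compose:
  assumes "polyfun_on Y \<delta> F" "\<And>x. x \<in> U \<Longrightarrow> \<Phi> x \<in> Y"
    and "\<And>j. polyfun_on U \<gamma> (\<lambda>x. \<delta> j (\<Phi> x))"
  shows "polyfun_on U \<gamma> (\<lambda>x. F (\<Phi> x))"
  using assms(1)
proof induction
  case (cong F G)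
  show ?case by (rule polyfun_on.cong[OF cong.IH]) (use cong assms(2) in auto)
next
  case (const c)
  show ?case by (rule polyfun_on.const)
next
  case (var j)
  show ?case by (rule assms(3))
next
  case (add F G)
  show ?case by (rule polyfun_on.add[OF add.IH])
next
  case (mult F G)
  show ?case by (rule polyfun_on.mult[OF mult.IH])
qed

lemma poly_mapping_eq_sum_single:
  "f = (\<Sum>m\<in>Poly_Mapping.keys f. Poly_Mapping.single m (Poly_Mapping.lookup f m))"
  by (rule poly_mapping_eqI)
    (auto simp: lookup_sum lookup_single when_def in_keys_iff sum.delta)

definition mon_eval :: "('i \<Rightarrow>\<^sub>0 nat) \<Rightarrow> ('i \<Rightarrow> 'k::field) \<Rightarrow> 'k" where
  "mon_eval m p = (\<Prod>i \<in> Poly_Mapping.keys m. p i ^ Poly_Mapping.lookup m i)"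

lemma mon_eval_superset:
  assumes "finite A" "Poly_Mapping.keys m \<subseteq> A"
  shows "mon_eval m p = (\<Prod>i \<in> A. p i ^ Poly_Mapping.lookup m i)"
  unfolding mon_eval_def by (rule prod.mono_neutral_left) (use assms in \<open>auto simp: in_keys_iff\<close>)

lemma mon_eval_add: "mon_eval (m + n) p = mon_eval m p * mon_eval n p"
proof -
  let ?A = "Poly_Mapping.keys m \<union> Poly_Mapping.keys n"
  have "Poly_Mapping.keys (m + n) \<subseteq> ?A" by (rule keys_add)
  then show ?thesis
    by (simp add: mon_eval_superset[of ?A] lookup_add power_add prod.distrib)
qed

lemma mpoly_eval_superset:
  assumes "finite A" "Poly_Mapping.keys f \<subseteq> A"
  shows "mpoly_eval f p = (\<Sum>m\<in>A. Poly_Mapping.lookup f m * mon_eval m p)"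
  unfolding mpoly_eval_def mon_eval_def[symmetric]
  by (rule sum.mono_neutral_left) (use assms in \<open>auto simp: in_keys_iff\<close>)

lemma mpoly_eval_add: "mpoly_eval (f + g) p = mpoly_eval f p + mpoly_eval g p"
proof -
  let ?A = "Poly_Mapping.keys f \<union> Poly_Mapping.keys g"
  have "Poly_Mapping.keys (f + g) \<subseteq> ?A" by (rule keys_add)
  then show ?thesis
    by (simp add: mpoly_eval_superset[of ?A] lookup_add distrib_right sum.distrib)
qed

lemma mpoly_eval_zero [simp]: "mpoly_eval 0 p = 0"
  by (simp add: mpoly_eval_def)

lemma mpoly_eval_sum: "mpoly_eval (\<Sum>a\<in>A. f a) p = (\<Sum>a\<in>A. mpoly_eval (f a) p)"
  by (induction A rule: infinite_finite_induct) (auto simp: mpoly_eval_add)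

lemma mpoly_eval_single: "mpoly_eval (Poly_Mapping.single m c) p = c * mon_eval m p"
  by (subst mpoly_eval_superset[of "{m}"]) auto

lemma mpoly_eval_mult: "mpoly_eval (f * g) p = mpoly_eval f p * mpoly_eval g p"
proof -
  let ?f = "Poly_Mapping.lookup f" and ?g = "Poly_Mapping.lookup g"
  have "f * g = (\<Sum>m\<in>Poly_Mapping.keys f. \<Sum>n\<in>Poly_Mapping.keys g.
      Poly_Mapping.single (m + n) (?f m * ?g n))"
    by (subst (1) poly_mapping_eq_sum_single[of f], subst (1) poly_mapping_eq_sum_single[of g])
      (simp add: sum_product mult_single)
  then have "mpoly_eval (f * g) p = (\<Sum>m\<in>Poly_Mapping.keys f. \<Sum>n\<in>Poly_Mapping.keys g.
      (?f m * mon_eval m p) * (?g n * mon_eval n p))"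
    by (simp add: mpoly_eval_sum mpoly_eval_single mon_eval_add algebra_simps)
  then show ?thesis
    by (simp add: sum_product[symmetric] mpoly_eval_superset[OF finite_keys order_refl])
qed

text \<open>The link to polynomials as syntactic objects: evaluation is a ring homomorphism.\<close>

lemma polyfun_on_iff_mpoly:
  "polyfun_on U \<gamma> F \<longleftrightarrow> (\<exists>f. \<forall>x\<in>U. F x = mpoly_eval f (\<lambda>i. \<gamma> i x))"
proof
  assume "polyfun_on U \<gamma> F"
  then show "\<exists>f. \<forall>x\<in>U. F x = mpoly_eval f (\<lambda>i. \<gamma> i x)"
  proof induction
    case (const c)
    have "\<forall>x\<in>U. c = mpoly_eval (Poly_Mapping.single 0 c) (\<lambda>i. \<gamma> i x)"
      by (simp add: mpoly_eval_single mon_eval_def)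
    then show ?case by blast
  next
    case (var i)
    have "\<forall>x\<in>U. \<gamma> i x = mpoly_eval (Poly_Mapping.single (Poly_Mapping.single i 1) 1) (\<lambda>i. \<gamma> i x)"
      by (simp add: mpoly_eval_single mon_eval_def)
    then show ?case by blast
  next
    case (add F G)
    then obtain f g where "\<forall>x\<in>U. F x = mpoly_eval f (\<lambda>i. \<gamma> i x)" "\<forall>x\<in>U. G x = mpoly_eval g (\<lambda>i. \<gamma> i x)"
      by blast
    then show ?case by (intro exI[of _ "f + g"]) (simp add: mpoly_eval_add)
  next
    case (mult F G)
    then obtain f g where "\<forall>x\<in>U. F x = mpoly_eval f (\<lambda>i. \<gamma> i x)" "\<forall>x\<in>U. G x = mpoly_eval g (\<lambda>i. \<gamma> i x)"
      by blast
    then show ?case by (intro exI[of _ "f * g"]) (simp add: mpoly_eval_mult)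
  next
    case (cong F G)
    then show ?case by simp
  qed
next
  assume "\<exists>f. \<forall>x\<in>U. F x = mpoly_eval f (\<lambda>i. \<gamma> i x)"
  then obtain f where f: "\<And>x. x \<in> U \<Longrightarrow> F x = mpoly_eval f (\<lambda>i. \<gamma> i x)" by blast
  have "polyfun_on U \<gamma> (\<lambda>x. mpoly_eval f (\<lambda>i. \<gamma> i x))"
    unfolding mpoly_eval_def
    by (intro polyfun_on_sum polyfun_on.mult polyfun_on.const polyfun_on_prod polyfun_on_power
        polyfun_on.var)
  then show "polyfun_on U \<gamma> F" by (rule polyfun_on.cong) (simp add: f)
qed

abbreviation (input) coord :: "'i \<Rightarrow> ('i \<Rightarrow> 'k) \<Rightarrow> 'k" where "coord i p \<equiv> p i"

lemma topspace_zariski [simp]: "topspace zariski = UNIV"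
proof -
  have "p \<in> {p. mpoly_eval 1 p \<noteq> 0}" for p :: "'i \<Rightarrow> 'k::field"
    using mpoly_eval_single[of 0 1 p] by (simp add: mon_eval_def)
  then show ?thesis by (auto simp: zariski_def topology_generated_by_topspace)
qed

text \<open>The sets \<open>f \<noteq> 0\<close> generate the topology and are closed under finite intersections, by taking
products; so they are a basis and not only a subbasis.\<close>

lemma zariski_basic_nbhd:
  assumes "openin zariski U" "p \<in> U"
  shows "\<exists>f. mpoly_eval f p \<noteq> 0 \<and> {q. mpoly_eval f q \<noteq> 0} \<subseteq> U"
proof -
  have "generate_topology_on (range (\<lambda>f. {p. mpoly_eval f p \<noteq> 0})) U"
    using assms(1) by (simp add: zariski_def openin_topology_generated_by_iff)
  then show ?thesis using assms(2)
  proof induction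
    case (Int a b)
    then obtain f g where "mpoly_eval f p \<noteq> 0" "{q. mpoly_eval f q \<noteq> 0} \<subseteq> a"
      "mpoly_eval g p \<noteq> 0" "{q. mpoly_eval g q \<noteq> 0} \<subseteq> b" by blast
    then show ?case by (intro exI[of _ "f * g"]) (auto simp: mpoly_eval_mult)
  qed blast+
qed

lemma closedin_zariski_zeros:
  assumes "\<And>F. F \<in> \<F> \<Longrightarrow> polyfun_on T coord F" "\<F> \<noteq> {}"
  shows "closedin (subtopology zariski T) {p\<in>T. \<forall>F\<in>\<F>. F p = 0}"
proof -
  have "closedin (subtopology zariski T) {p\<in>T. F p = 0}" if F: "F \<in> \<F>" for F
  proof -
    obtain f where f: "\<And>p. p \<in> T \<Longrightarrow> F p = mpoly_eval f p"
      using assms(1)[OF F] by (auto simp: polyfun_on_iff_mpoly)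
    have "openin zariski {q. mpoly_eval f q \<noteq> 0}"
      unfolding zariski_def by (rule topology_generated_by_Basis) blast
    then have "closedin zariski {q. mpoly_eval f q = 0}"
      by (simp add: closedin_def Collect_neg_eq Compl_eq_Diff_UNIV)
    moreover have "{p\<in>T. F p = 0} = T \<inter> {q. mpoly_eval f q = 0}" using f by auto
    ultimately show ?thesis by (metis closedin_subtopology Int_commute)
  qed
  then have "closedin (subtopology zariski T) (\<Inter>F\<in>\<F>. {p\<in>T. F p = 0})"
    using assms(2) by (intro closedin_Inter) auto
  moreover have "(\<Inter>F\<in>\<F>. {p\<in>T. F p = 0}) = {p\<in>T. \<forall>F\<in>\<F>. F p = 0}" using assms(2) by auto
  ultimately show ?thesis by simp
qed

lemma closedin_zariski_separate:
  assumes "closedin (subtopology zariski T) C" "p \<in> T" "p \<notin> C"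
  shows "\<exists>F. polyfun_on T coord F \<and> (\<forall>q\<in>C. F q = 0) \<and> F p \<noteq> 0"
proof -
  obtain D where D: "closedin zariski D" "C = D \<inter> T"
    using assms(1) by (auto simp: closedin_subtopology)
  have "openin zariski (- D)" using D(1) by (simp add: closedin_def Compl_eq_Diff_UNIV)
  then obtain f where "mpoly_eval f p \<noteq> 0" "{q. mpoly_eval f q \<noteq> 0} \<subseteq> - D"
    using zariski_basic_nbhd[of "- D" p] assms D by blast
  moreover have "polyfun_on T coord (mpoly_eval f)"
    by (auto simp: polyfun_on_iff_mpoly)
  ultimately show ?thesis using D by blast
qed

text \<open>The ring of polynomial functions on an irreducible set is a domain, because Z is covered by the
zero sets of the two factors.\<close>

lemma irreducible_mult_nonzero:
  assumes Z: "irreducible_in (subtopology zariski T) Z"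
    and F: "polyfun_on T coord F" and G: "polyfun_on T coord G"
    and FG: "\<And>p. p \<in> Z \<Longrightarrow> F p * G p = 0"
  shows "(\<forall>p\<in>Z. F p = 0) \<or> (\<forall>p\<in>Z. G p = 0)"
proof -
  have ZT: "Z \<subseteq> T" using Z by (auto simp: irreducible_in_def)
  have "closedin (subtopology zariski T) {p\<in>T. \<forall>F\<in>{F}. F p = 0}"
    "closedin (subtopology zariski T) {p\<in>T. \<forall>F\<in>{G}. F p = 0}"
    by (intro closedin_zariski_zeros; use F G in auto)+
  moreover have "Z \<subseteq> {p\<in>T. \<forall>F\<in>{F}. F p = 0} \<union> {p\<in>T. \<forall>F\<in>{G}. F p = 0}"
    using FG ZT by auto
  ultimately have "Z \<subseteq> {p\<in>T. \<forall>F\<in>{F}. F p = 0} \<or> Z \<subseteq> {p\<in>T. \<forall>F\<in>{G}. F p = 0}"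
    using Z unfolding irreducible_in_def by meson
  then show ?thesis by auto
qed

section \<open>Chains of irreducible closed sets\<close>

text \<open>Exponents of monomials in n variables with every exponent at most N. Boxes are easier to
count and to split off one variable from than monomials of bounded total degree.\<close>

definition exponent_box :: "nat \<Rightarrow> nat \<Rightarrow> (nat \<Rightarrow> nat) set" where
  "exponent_box n N = PiE {..<n} (\<lambda>_. {..N})"

lemma finite_exponent_box [simp]: "finite (exponent_box n N)"
  by (auto simp: exponent_box_def intro: finite_PiE)

lemma card_exponent_box: "card (exponent_box n N) = (N + 1) ^ n"
  by (simp add: exponent_box_def card_PiE)

definition alg_indep_on :: "'x set \<Rightarrow> nat \<Rightarrow> (nat \<Rightarrow> 'x \<Rightarrow> 'k::field) \<Rightarrow> bool" where
  "alg_indep_on Z n F \<longleftrightarrow> (\<forall>N q. (\<forall>x\<in>Z. (\<Sum>\<alpha>\<in>exponent_box n N. q \<alpha> * (\<Prod>i<n. F i x ^ \<alpha> i)) = 0) \<longrightarrow>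
     (\<forall>\<alpha>\<in>exponent_box n N. q \<alpha> = 0))"

lemma sum_exponent_box_Suc:
  "(\<Sum>\<alpha>\<in>exponent_box (Suc n) N. q \<alpha> * (\<Prod>i<Suc n. F i ^ \<alpha> i)) =
   (\<Sum>j\<le>N. F n ^ j * (\<Sum>\<beta>\<in>exponent_box n N. q (\<beta>(n := j)) * (\<Prod>i<n. F i ^ \<beta> i)))"
  for F :: "nat \<Rightarrow> 'k::field"
proof -
  let ?h = "\<lambda>(j, \<beta>::nat \<Rightarrow> nat). \<beta>(n := j)"
  have exponent_box: "exponent_box (Suc n) N = ?h ` ({..N} \<times> exponent_box n N)"
    by (simp add: exponent_box_def lessThan_Suc PiE_insert_eq)
  have inj: "inj_on ?h ({..N} \<times> exponent_box n N)"
    unfolding exponent_box_def by (rule inj_combinator) auto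
  have "(\<Sum>\<alpha>\<in>exponent_box (Suc n) N. q \<alpha> * (\<Prod>i<Suc n. F i ^ \<alpha> i)) =
    (\<Sum>(j, \<beta>)\<in>{..N} \<times> exponent_box n N. q (\<beta>(n := j)) * (\<Prod>i<Suc n. F i ^ (\<beta>(n := j)) i))"
    unfolding exponent_box by (subst sum.reindex[OF inj]) (simp add: case_prod_unfold)
  also have "\<dots> = (\<Sum>j\<le>N. \<Sum>\<beta>\<in>exponent_box n N. q (\<beta>(n := j)) * (\<Prod>i<Suc n. F i ^ (\<beta>(n := j)) i))"
    by (simp add: sum.cartesian_product)
  also have "\<dots> = (\<Sum>j\<le>N. \<Sum>\<beta>\<in>exponent_box n N. F n ^ j * (q (\<beta>(n := j)) * (\<Prod>i<n. F i ^ \<beta> i)))"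
    by (intro sum.cong refl) (simp add: mult_ac)
  finally show ?thesis by (simp add: sum_distrib_left)
qed

text \<open>If f vanishes on \<open>Z'\<close> but not on the larger irreducible set Z, then f is algebraically
independent of functions that are independent on \<open>Z'\<close>: order a relation on Z by powers of f, divide by the
lowest power of f (the functions on Z form a domain), and restrict to \<open>Z'\<close>, where only the lowest
coefficient survives. This coefficient is a relation between the old functions.\<close>

lemma alg_indep_extend:
  assumes Z: "irreducible_in (subtopology zariski T) Z"
    and F: "\<And>i. i < n \<Longrightarrow> polyfun_on T coord (F i)" and f: "polyfun_on T coord f"
    and Z': "Z' \<subseteq> Z" "\<And>p. p \<in> Z' \<Longrightarrow> f p = 0" and p: "p \<in> Z" "f p \<noteq> 0"
    and indep: "alg_indep_on Z' n F"
  shows "alg_indep_on Z (Suc n) (F(n := f))"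
  unfolding alg_indep_on_def
proof (intro allI impI)
  fix N and q :: "(nat \<Rightarrow> nat) \<Rightarrow> 'b"
  define Q where "Q j x = (\<Sum>\<beta>\<in>exponent_box n N. q (\<beta>(n := j)) * (\<Prod>i<n. F i x ^ \<beta> i))" for j x
  assume "\<forall>x\<in>Z. (\<Sum>\<alpha>\<in>exponent_box (Suc n) N. q \<alpha> * (\<Prod>i<Suc n. (F(n := f)) i x ^ \<alpha> i)) = 0"
  then have van: "(\<Sum>j\<le>N. f x ^ j * Q j x) = 0" if "x \<in> Z" for x
    using sum_exponent_box_Suc[of q "\<lambda>i. (F(n := f)) i x" n N] that by (simp add: Q_def)
  have Qpoly: "polyfun_on T coord (Q j)" for j
    unfolding Q_def
    by (intro polyfun_on_sum polyfun_on.mult polyfun_on.const polyfun_on_prod polyfun_on_power F) auto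
  have zero: "\<forall>\<beta>\<in>exponent_box n N. q (\<beta>(n := j)) = 0" if "j \<le> N" for j
    using that
  proof (induction j rule: less_induct)
    case (less j)
    \<comment> \<open>R is what is left of the relation after division by the j-th power of f.\<close>
    define R where "R x = (\<Sum>l\<in>{j..N}. f x ^ (l - j) * Q l x)" for x
    have Rpoly: "polyfun_on T coord R"
      unfolding R_def by (intro polyfun_on_sum polyfun_on.mult polyfun_on_power f Qpoly)
    have "f x ^ j * R x = 0" if "x \<in> Z" for x
    proof -
      have "Q l x = 0" if "l < j" for l
        unfolding Q_def
      proof (rule sum.neutral, rule ballI)
        fix \<beta> assume "\<beta> \<in> exponent_box n N"
        moreover have "l \<le> N" using that less.prems by simp
        ultimately have "q (\<beta>(n := l)) = 0" by (intro bspec[OF less.IH[OF that]])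
        then show "q (\<beta>(n := l)) * (\<Prod>i<n. F i x ^ \<beta> i) = 0" by simp
      qed
      then have "(\<Sum>l\<le>N. f x ^ l * Q l x) = (\<Sum>l\<in>{j..N}. f x ^ l * Q l x)"
        by (intro sum.mono_neutral_right) auto
      also have "\<dots> = f x ^ j * R x"
        unfolding R_def sum_distrib_left
        by (intro sum.cong refl) (simp add: mult.assoc[symmetric] power_add[symmetric])
      finally show ?thesis using van[OF that] by simp
    qed
    then have "(\<forall>x\<in>Z. f x ^ j = 0) \<or> (\<forall>x\<in>Z. R x = 0)"
      by (intro irreducible_mult_nonzero[OF Z] polyfun_on_power f Rpoly) auto
    then have R0: "\<forall>x\<in>Z. R x = 0" using p by auto
    have "Q j x = 0" if "x \<in> Z'" for x
    proof -
      have "R x = (\<Sum>l\<in>{j..N}. if l = j then Q l x else 0)"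
        unfolding R_def by (intro sum.cong refl) (auto simp: Z'(2)[OF that])
      also have "\<dots> = Q j x" using less.prems by (simp add: sum.delta)
      finally show ?thesis using R0 that Z' by auto
    qed
    then have "\<forall>x\<in>Z'. (\<Sum>\<beta>\<in>exponent_box n N. q (\<beta>(n := j)) * (\<Prod>i<n. F i x ^ \<beta> i)) = 0"
      by (simp add: Q_def)
    then show ?case
      by (rule indep[unfolded alg_indep_on_def, THEN spec[of _ N],
            THEN spec[of _ "\<lambda>\<beta>. q (\<beta>(n := j))"], THEN mp])
  qed
  show "\<forall>\<alpha>\<in>exponent_box (Suc n) N. q \<alpha> = 0"
  proof
    fix \<alpha> assume "\<alpha> \<in> exponent_box (Suc n) N"
    then obtain j \<beta> where "j \<le> N" "\<beta> \<in> exponent_box n N" "\<alpha> = \<beta>(n := j)"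
      by (auto simp: exponent_box_def lessThan_Suc PiE_insert_eq)
    then show "q \<alpha> = 0" using zero by blast
  qed
qed

text \<open>Each step of the chain contributes one more function, by alg_indep_extend.\<close>

lemma chain_alg_indep:
  fixes T :: "('i \<Rightarrow> 'k::field) set"
  assumes "\<And>i. i \<le> n \<Longrightarrow> closedin (subtopology zariski T) (Z i) \<and> irreducible_in (subtopology zariski T) (Z i)"
    and "\<And>i. i < n \<Longrightarrow> Z i \<subset> Z (Suc i)"
  shows "\<exists>F. (\<forall>i<n. polyfun_on T coord (F i)) \<and> alg_indep_on (Z n) n F"
  using assms
proof (induction n)
  case 0
  have "Z 0 \<noteq> {}" using 0 by (auto simp: irreducible_in_def)
  then show ?case by (auto simp: alg_indep_on_def exponent_box_def)
next
  case (Suc n)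
  have "\<exists>F. (\<forall>i<n. polyfun_on T coord (F i)) \<and> alg_indep_on (Z n) n F"
    by (rule Suc.IH) (simp_all add: Suc.prems)
  then obtain F where F: "\<And>i. i < n \<Longrightarrow> polyfun_on T coord (F i)" "alg_indep_on (Z n) n F"
    by blast
  have sub: "Z n \<subset> Z (Suc n)" using Suc.prems by simp
  then obtain p where p: "p \<in> Z (Suc n)" "p \<notin> Z n" by blast
  have irr: "irreducible_in (subtopology zariski T) (Z (Suc n))" using Suc.prems by simp
  then have "p \<in> T" using p by (auto simp: irreducible_in_def)
  moreover have "closedin (subtopology zariski T) (Z n)" using Suc.prems by simp
  ultimately obtain f where f: "polyfun_on T coord f" "\<forall>q\<in>Z n. f q = 0" "f p \<noteq> 0"
    using closedin_zariski_separate p by blast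
  have "alg_indep_on (Z (Suc n)) (Suc n) (F(n := f))"
    by (rule alg_indep_extend[OF irr F(1) f(1) _ _ p(1) f(3) F(2)]) (use sub f in auto)
  moreover have "\<forall>i<Suc n. polyfun_on T coord ((F(n := f)) i)" using F f by auto
  ultimately show ?case by blast
qed

section \<open>Sets parametrized by an affine space\<close>

lemma vector_space_fun: "vector_space (\<lambda>a (f :: 'x \<Rightarrow> 'k::field) x. a * f x)"
  by unfold_locales (auto simp: algebra_simps fun_eq_iff)

text \<open>The index type may be larger than S, so a point of the affine space with coordinates S is
a function that vanishes outside S.\<close>

definition affine_space :: "'s set \<Rightarrow> ('s \<Rightarrow> 'k::zero) set" where
  "affine_space S = {c. \<forall>s. s \<notin> S \<longrightarrow> c s = 0}"

definition mons_le :: "'s set \<Rightarrow> nat \<Rightarrow> (('s \<Rightarrow> 'k::field) \<Rightarrow> 'k) set" where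
  "mons_le S D = (\<lambda>\<alpha> c. \<Prod>s\<in>S. c s ^ \<alpha> s) ` PiE S (\<lambda>_. {..D})"

abbreviation fspan :: "(('x \<Rightarrow> 'k::field)) set \<Rightarrow> ('x \<Rightarrow> 'k) set" where
  "fspan \<equiv> Modules.module.span (\<lambda>a f x. a * f x)"

lemma mons_le_mult:
  assumes "f \<in> mons_le S D" "g \<in> mons_le S E"
  shows "(\<lambda>c. f c * g c) \<in> mons_le S (D + E)"
proof -
  obtain \<alpha> \<beta> where ab: "\<alpha> \<in> PiE S (\<lambda>_. {..D})" "\<beta> \<in> PiE S (\<lambda>_. {..E})"
    "f = (\<lambda>c. \<Prod>s\<in>S. c s ^ \<alpha> s)" "g = (\<lambda>c. \<Prod>s\<in>S. c s ^ \<beta> s)"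
    using assms by (auto simp: mons_le_def)
  have "(\<lambda>c. f c * g c) = (\<lambda>c. \<Prod>s\<in>S. c s ^ (restrict (\<lambda>s. \<alpha> s + \<beta> s) S) s)"
    by (auto simp: ab fun_eq_iff power_add prod.distrib)
  moreover have "restrict (\<lambda>s. \<alpha> s + \<beta> s) S \<in> PiE S (\<lambda>_. {..D + E})"
    using ab by (auto simp: PiE_iff intro: add_mono)
  ultimately show ?thesis unfolding mons_le_def by blast
qed

lemma fspan_mons_le_mult:
  assumes "f \<in> fspan (mons_le S D)" "g \<in> fspan (mons_le S E)"
  shows "(\<lambda>c. f c * g c) \<in> fspan (mons_le S (D + E))"
proof -
  interpret vector_space "\<lambda>a (f :: ('a \<Rightarrow> 'b) \<Rightarrow> 'b) x. a * f x" by (rule vector_space_fun)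
  show ?thesis using assms(1)
  proof (induction rule: span_induct_alt)
    case base
    then show ?case using span_zero by (simp add: zero_fun_def)
  next
    case (step a f1 f2)
    have "(\<lambda>c. f1 c * g c) \<in> span (mons_le S (D + E))"
      using assms(2)
    proof (induction rule: span_induct_alt)
      case base
      then show ?case using span_zero by (simp add: zero_fun_def)
    next
      case (step b g1 g2)
      have "(\<lambda>c. f1 c * g1 c) \<in> span (mons_le S (D + E))"
        by (intro span_base mons_le_mult) (use step \<open>f1 \<in> _\<close> in auto)
      from span_add[OF span_scale[OF this, of b] step.IH]
      show ?case by (simp add: plus_fun_def algebra_simps)
    qed
    from span_add[OF span_scale[OF this, of a] step.IH]
    show ?case by (simp add: plus_fun_def algebra_simps)
  qed
qed

lemma mons_le_mono: "D \<le> E \<Longrightarrow> mons_le S D \<subseteq> mons_le S E"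
  unfolding mons_le_def by (intro image_mono PiE_mono) auto

lemma one_in_mons_le: "finite S \<Longrightarrow> (\<lambda>_. 1) \<in> mons_le S D"
  unfolding mons_le_def by (intro image_eqI[of _ _ "restrict (\<lambda>_. 0) S"]) auto

lemma fspan_mons_le_power:
  assumes "finite S" "f \<in> fspan (mons_le S D)"
  shows "(\<lambda>c. f c ^ n) \<in> fspan (mons_le S (n * D))"
proof -
  interpret vector_space "\<lambda>a (f :: ('a \<Rightarrow> 'b) \<Rightarrow> 'b) x. a * f x" by (rule vector_space_fun)
  show ?thesis
  proof (induction n)
    case 0
    then show ?case using span_base[OF one_in_mons_le[OF assms(1)]] by simp
  next
    case (Suc n)
    then show ?case using fspan_mons_le_mult[OF assms(2) Suc] by simp
  qed
qed

text \<open>Polynomial functions on the affine space lie in the span of the finitely many monomials with all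
exponents at most some D.\<close>

lemma polyfun_on_affine_fspan:
  assumes "finite S" "polyfun_on (affine_space S) coord F"
  shows "\<exists>D. \<exists>G\<in>fspan (mons_le S D). \<forall>c\<in>affine_space S. F c = G c"
proof -
  interpret vector_space "\<lambda>a (f :: ('a \<Rightarrow> 'b) \<Rightarrow> 'b) x. a * f x" by (rule vector_space_fun)
  show ?thesis using assms(2)
  proof induction
    case (const a)
    have "(\<lambda>_. a) \<in> span (mons_le S 0)"
      using span_scale[OF span_base[OF one_in_mons_le[OF assms(1)]], of a] by simp
    then show ?case by (intro exI[of _ 0] bexI[of _ "\<lambda>_. a"]) auto
  next
    case (var s)
    show ?case
    proof (cases "s \<in> S")
      case True
      have "(\<lambda>c :: 'a \<Rightarrow> 'b. \<Prod>u\<in>S. c u ^ (restrict (\<lambda>u. if u = s then 1 else 0) S) u) = (\<lambda>c. c s)"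
      proof
        fix c :: "'a \<Rightarrow> 'b"
        have "(\<Prod>u\<in>S. c u ^ (restrict (\<lambda>u. if u = s then 1 else 0) S) u) =
          (\<Prod>u\<in>S. if u = s then c u else 1)"
          by (intro prod.cong) auto
        then show "(\<Prod>u\<in>S. c u ^ (restrict (\<lambda>u. if u = s then 1 else 0) S) u) = c s"
          using True assms(1) by (simp add: prod.delta)
      qed
      then have "(\<lambda>c :: 'a \<Rightarrow> 'b. c s) \<in> mons_le S 1"
        unfolding mons_le_def
        by (rule image_eqI[of _ _ "restrict (\<lambda>u. if u = s then 1 else 0) S", OF sym]) auto
      from span_base[OF this] show ?thesis
        by (intro exI[of _ 1] bexI[of _ "\<lambda>c :: 'a \<Rightarrow> 'b. c s"]) simp_all
    next
      case False
      then show ?thesis using span_zero[of "mons_le S 0"]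
        by (intro exI[of _ 0] bexI[of _ 0]) (auto simp: affine_space_def)
    qed
  next
    case (add F G)
    from add.IH(1) obtain D F' where F': "F' \<in> span (mons_le S D)" "\<forall>c\<in>affine_space S. F c = F' c" by blast
    from add.IH(2) obtain E G' where G': "G' \<in> span (mons_le S E)" "\<forall>c\<in>affine_space S. G c = G' c" by blast
    have "F' \<in> span (mons_le S (max D E))" "G' \<in> span (mons_le S (max D E))"
      using F'(1) G'(1) span_mono[OF mons_le_mono[of D "max D E" S]] span_mono[OF mons_le_mono[of E "max D E" S]]
      by auto
    from span_add[OF this] show ?case
      by (intro exI[of _ "max D E"] bexI[of _ "F' + G'"]) (simp_all add: F' G')
  next
    case (mult F G)
    from mult.IH(1) obtain D F' where F': "F' \<in> span (mons_le S D)" "\<forall>c\<in>affine_space S. F c = F' c" by blast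
    from mult.IH(2) obtain E G' where G': "G' \<in> span (mons_le S E)" "\<forall>c\<in>affine_space S. G c = G' c" by blast
    show ?case using fspan_mons_le_mult[OF F'(1) G'(1)]
      by (intro exI[of _ "D + E"] bexI[of _ "\<lambda>c. F' c * G' c"]) (simp_all add: F' G')
  next
    case (cong F G)
    from cong.IH obtain D F' where "F' \<in> span (mons_le S D)" "\<forall>c\<in>affine_space S. F c = F' c" by blast
    moreover from this(2) have "\<forall>c\<in>affine_space S. G c = F' c" by (simp add: cong.hyps)
    ultimately show ?case by (intro exI[of _ D] bexI[of _ F'])
  qed
qed

text \<open>If n functions of degree at most D are independent, their \<open>(N + 1)^n\<close> monomials with
exponents at most N are linearly independent in a space of dimension at most
\<open>(n * N * D + 1)^card S\<close>. For large N this forces \<open>n \<le> card S\<close>.\<close>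

lemma alg_indep_affine_le:
  fixes F :: "nat \<Rightarrow> ('s \<Rightarrow> 'k::field) \<Rightarrow> 'k"
  assumes S: "finite S" and F: "\<And>i. i < n \<Longrightarrow> polyfun_on (affine_space S) coord (F i)"
    and indep: "alg_indep_on (affine_space S) n F"
  shows "n \<le> card S"
proof -
  interpret vector_space "\<lambda>a (f :: ('s \<Rightarrow> 'k) \<Rightarrow> 'k) x. a * f x" by (rule vector_space_fun)
  have "\<forall>i\<in>{..<n}. \<exists>DG. snd DG \<in> span (mons_le S (fst DG)) \<and>
      (\<forall>c\<in>affine_space S. F i c = snd DG c)"
    using polyfun_on_affine_fspan[OF S F] by fastforce
  from bchoice[OF this] obtain DG where DG: "\<forall>i\<in>{..<n}. snd (DG i) \<in> span (mons_le S (fst (DG i))) \<and>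
      (\<forall>c\<in>affine_space S. F i c = snd (DG i) c)" ..
  define E where "E i = fst (DG i)" for i
  define G where "G i = snd (DG i)" for i
  have G: "\<forall>i\<in>{..<n}. G i \<in> span (mons_le S (E i)) \<and> (\<forall>c\<in>affine_space S. F i c = G i c)"
    using DG by (simp add: E_def G_def)
  define D where "D = (\<Sum>i<n. E i)"
  have GD: "G i \<in> span (mons_le S D)" if "i < n" for i
  proof -
    have "E i \<le> D" unfolding D_def using that by (intro member_le_sum) auto
    from span_mono[OF mons_le_mono[OF this]] show ?thesis using G that by auto
  qed
  define H where "H \<alpha> c = (\<Prod>i<n. G i c ^ \<alpha> i)" for \<alpha> c
  have key: "(N + 1) ^ n \<le> (n * (N * D) + 1) ^ card S" for N
  proof -
    have Hspan: "H \<alpha> \<in> span (mons_le S (n * (N * D)))" if "\<alpha> \<in> exponent_box n N" for \<alpha>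
    proof -
      have "(\<lambda>c. \<Prod>i<k. G i c ^ \<alpha> i) \<in> span (mons_le S (k * (N * D)))" if "k \<le> n" for k
        using that
      proof (induction k)
        case 0
        then show ?case using span_base[OF one_in_mons_le[OF S]] by simp
      next
        case (Suc k)
        have "\<alpha> k \<le> N" using \<open>\<alpha> \<in> exponent_box n N\<close> Suc.prems by (auto simp: exponent_box_def PiE_iff)
        then have "span (mons_le S (\<alpha> k * D)) \<subseteq> span (mons_le S (N * D))"
          by (intro span_mono mons_le_mono mult_le_mono1)
        moreover have "(\<lambda>c. G k c ^ \<alpha> k) \<in> span (mons_le S (\<alpha> k * D))"
          using Suc.prems by (intro fspan_mons_le_power[OF S GD]) simp
        ultimately have "(\<lambda>c. G k c ^ \<alpha> k) \<in> span (mons_le S (N * D))" by (rule subsetD)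
        moreover have "(\<lambda>c. \<Prod>i<k. G i c ^ \<alpha> i) \<in> span (mons_le S (k * (N * D)))"
          using Suc by simp
        ultimately show ?case
          using fspan_mons_le_mult[of "\<lambda>c. G k c ^ \<alpha> k" S "N * D" "\<lambda>c. \<Prod>i<k. G i c ^ \<alpha> i"]
          by (simp add: mult.commute)
      qed
      from this[of n] show ?thesis unfolding H_def by simp
    qed
    have lin: "\<forall>\<alpha>\<in>exponent_box n N. q \<alpha> = 0" if "\<And>c. (\<Sum>\<alpha>\<in>exponent_box n N. q \<alpha> * H \<alpha> c) = 0" for q
    proof -
      have "\<forall>c\<in>affine_space S. (\<Sum>\<alpha>\<in>exponent_box n N. q \<alpha> * (\<Prod>i<n. F i c ^ \<alpha> i)) = 0"
      proof
        fix c :: "'s \<Rightarrow> 'k" assume "c \<in> affine_space S"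
        then have "(\<Prod>i<n. F i c ^ \<alpha> i) = H \<alpha> c" for \<alpha>
          unfolding H_def using G by (intro prod.cong) auto
        then show "(\<Sum>\<alpha>\<in>exponent_box n N. q \<alpha> * (\<Prod>i<n. F i c ^ \<alpha> i)) = 0" using that by simp
      qed
      then show ?thesis
        by (rule indep[unfolded alg_indep_on_def, THEN spec[of _ N], THEN spec[of _ q], THEN mp])
    qed
    have inj: "inj_on H (exponent_box n N)"
    proof (rule inj_onI, rule ccontr)
      fix \<alpha> \<beta> assume *: "\<alpha> \<in> exponent_box n N" "\<beta> \<in> exponent_box n N" "H \<alpha> = H \<beta>" "\<alpha> \<noteq> \<beta>"
      let ?q = "\<lambda>\<gamma>. if \<gamma> = \<alpha> then 1 else if \<gamma> = \<beta> then -1 else (0::'k)"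
      have "(\<Sum>\<gamma>\<in>exponent_box n N. ?q \<gamma> * H \<gamma> c) = 0" for c
      proof -
        have "(\<Sum>\<gamma>\<in>exponent_box n N. ?q \<gamma> * H \<gamma> c) = (\<Sum>\<gamma>\<in>{\<alpha>, \<beta>}. ?q \<gamma> * H \<gamma> c)"
          using * by (intro sum.mono_neutral_right) auto
        then show ?thesis using * by simp
      qed
      from lin[of ?q, OF this] have "?q \<alpha> = 0" using *(1) by (rule bspec)
      then show False by simp
    qed
    have ind: "independent (H ` exponent_box n N)"
    proof
      assume "dependent (H ` exponent_box n N)"
      then obtain u x where u: "(\<Sum>x\<in>H ` exponent_box n N. (\<lambda>xa. u x * x xa)) = 0"
        and x: "x \<in> H ` exponent_box n N" "u x \<noteq> 0"
        by (auto simp: dependent_finite)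
      have "(\<Sum>\<alpha>\<in>exponent_box n N. u (H \<alpha>) * H \<alpha> c) = 0" for c
      proof -
        have "(\<Sum>x\<in>W. (\<lambda>xa. u x * x xa)) c = (\<Sum>x\<in>W. u x * x c)" for W
          by (induction W rule: infinite_finite_induct) simp_all
        from this[of "H ` exponent_box n N"] have "(\<Sum>x\<in>H ` exponent_box n N. u x * x c) = 0"
          unfolding u by simp
        then show ?thesis unfolding sum.reindex[OF inj] comp_def .
      qed
      from lin[of "\<lambda>\<alpha>. u (H \<alpha>)", OF this] have "\<forall>\<alpha>\<in>exponent_box n N. u (H \<alpha>) = 0" .
      moreover obtain \<alpha> where "\<alpha> \<in> exponent_box n N" "x = H \<alpha>" using x(1) by (rule imageE)
      ultimately show False using x(2) by simp
    qed
    have fin: "finite (mons_le S (n * (N * D)) :: (('s \<Rightarrow> 'k) \<Rightarrow> 'k) set)"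
      unfolding mons_le_def using S by (intro finite_imageI finite_PiE) auto
    have "card (H ` exponent_box n N) \<le> card (mons_le S (n * (N * D)) :: (('s \<Rightarrow> 'k) \<Rightarrow> 'k) set)"
      using independent_span_bound[OF fin ind] Hspan by blast
    also have "\<dots> \<le> card (PiE S (\<lambda>_. {..n * (N * D)}))"
      unfolding mons_le_def using S by (intro card_image_le finite_PiE) auto
    also have "\<dots> = (n * (N * D) + 1) ^ card S" using S by (simp add: card_PiE)
    finally show ?thesis by (simp add: card_image[OF inj] card_exponent_box)
  qed
  show ?thesis
  proof (rule ccontr)
    assume "\<not> n \<le> card S"
    then have n: "Suc (card S) \<le> n" by simp
    \<comment> \<open>The box size N = C already violates the inequality if n exceeds card S.\<close>
    define C where "C = (n * D + 1) ^ card S"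
    have "(C + 1) * (C + 1) ^ card S \<le> (C + 1) ^ n"
      using power_increasing[OF n, of "C + 1"] by simp
    also have "\<dots> \<le> (n * (C * D) + 1) ^ card S" by (rule key)
    also have "\<dots> \<le> ((n * D + 1) * (C + 1)) ^ card S"
      by (intro power_mono) (auto simp: algebra_simps)
    also have "\<dots> = C * (C + 1) ^ card S" unfolding power_mult_distrib C_def[symmetric] ..
    finally show False by simp
  qed
qed

lemma polyfun_on_affine_line:
  assumes "polyfun_on (affine_space S) coord F" "a \<in> affine_space S" "b \<in> affine_space S"
  shows "\<exists>u. \<forall>r. F (\<lambda>s. a s + r * (b s - a s)) = poly u r"
  using assms(1)
proof induction
  case (const c)
  show ?case by (intro exI[of _ "[:c:]"]) simp
next
  case (var s)
  show ?case by (intro exI[of _ "[:a s, b s - a s:]"]) simp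
next
  case (add F G)
  then show ?case by (metis poly_add)
next
  case (mult F G)
  then show ?case by (metis poly_mult)
next
  case (cong F G)
  have "(\<lambda>s. a s + r * (b s - a s)) \<in> affine_space S" for r
    using assms by (auto simp: affine_space_def)
  then show ?case using cong by metis
qed

text \<open>On the line through a and b the two functions become nonzero polynomials in one variable, whose
product has only finitely many zeros.\<close>

lemma polyfun_on_affine_mult_nonzero:
  fixes F :: "('s \<Rightarrow> 'k::field) \<Rightarrow> 'k"
  assumes "infinite (UNIV :: 'k set)"
    and "polyfun_on (affine_space S) coord F" "polyfun_on (affine_space S) coord G"
    and "a \<in> affine_space S" "F a \<noteq> 0" "b \<in> affine_space S" "G b \<noteq> 0"
  shows "\<exists>c\<in>affine_space S. F c * G c \<noteq> 0"
proof -
  obtain u v where u: "\<And>r. F (\<lambda>s. a s + r * (b s - a s)) = poly u r"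
    and v: "\<And>r. G (\<lambda>s. a s + r * (b s - a s)) = poly v r"
    using polyfun_on_affine_line[OF assms(2,4,6)] polyfun_on_affine_line[OF assms(3,4,6)] by metis
  have "poly u 0 \<noteq> 0" "poly v 1 \<noteq> 0" using u[of 0] v[of 1] assms by simp_all
  then have "u * v \<noteq> 0" by auto
  then have "finite {r. poly (u * v) r = 0}" by (rule poly_roots_finite)
  then obtain r where "poly (u * v) r \<noteq> 0"
    using assms(1) by (metis (mono_tags, lifting) UNIV_eq_I mem_Collect_eq)
  then show ?thesis using u[of r] v[of r] assms
    by (intro bexI[of _ "\<lambda>s. a s + r * (b s - a s)"]) (auto simp: affine_space_def)
qed

text \<open>Here T is the bijective image of an affine space under \<open>\<Phi>\<close>, polynomial in both directions. The upper
bound pulls independent functions back along \<open>\<Phi>\<close>. For the lower bound, the images of the coordinate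
subspaces are closed because they are cut out by the functions \<open>\<Psi> s\<close>, and irreducible because
polynomial functions on an affine space over an infinite field form a domain.\<close>

theorem krull_dim_parametrized:
  fixes T :: "('i \<Rightarrow> 'k::field) set" and \<Phi> :: "('s \<Rightarrow> 'k) \<Rightarrow> 'i \<Rightarrow> 'k"
  assumes inf: "infinite (UNIV :: 'k set)" and S: "finite S"
    and T: "T = \<Phi> ` affine_space S"
    and \<Phi>: "\<And>i. polyfun_on (affine_space S) coord (\<lambda>c. \<Phi> c i)"
    and \<Psi>: "\<And>s. s \<in> S \<Longrightarrow> polyfun_on T coord (\<Psi> s)"
    and inv: "\<And>s c. s \<in> S \<Longrightarrow> c \<in> affine_space S \<Longrightarrow> \<Psi> s (\<Phi> c) = c s"
  shows "krull_dim (subtopology zariski T) = ereal (card S)"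
proof (rule antisym)
  show "krull_dim (subtopology zariski T) \<le> ereal (card S)"
    unfolding krull_dim_def
  proof (rule Sup_least, clarify)
    fix n Z assume Z: "\<forall>i\<le>n. closedin (subtopology zariski T) (Z i) \<and> irreducible_in (subtopology zariski T) (Z i)"
      "\<forall>i<n. Z i \<subset> Z (Suc i)"
    have "\<exists>F. (\<forall>i<n. polyfun_on T coord (F i)) \<and> alg_indep_on (Z n) n F"
      by (rule chain_alg_indep) (use Z in auto)
    then obtain F where F: "\<And>i. i < n \<Longrightarrow> polyfun_on T coord (F i)" "alg_indep_on (Z n) n F"
      by blast
    have "Z n \<subseteq> T" using Z by (auto simp: irreducible_in_def)
    have "alg_indep_on (affine_space S) n (\<lambda>i c. F i (\<Phi> c))"
      unfolding alg_indep_on_def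
    proof (rule allI, rule allI, rule impI)
      fix N q
      assume "\<forall>c\<in>affine_space S. (\<Sum>\<alpha>\<in>exponent_box n N. q \<alpha> * (\<Prod>i<n. F i (\<Phi> c) ^ \<alpha> i)) = 0"
      then have "\<forall>x\<in>Z n. (\<Sum>\<alpha>\<in>exponent_box n N. q \<alpha> * (\<Prod>i<n. F i x ^ \<alpha> i)) = 0"
        using \<open>Z n \<subseteq> T\<close> T by fast
      then show "\<forall>\<alpha>\<in>exponent_box n N. q \<alpha> = 0"
        by (rule F(2)[unfolded alg_indep_on_def, THEN spec[of _ N], THEN spec[of _ q], THEN mp])
    qed
    moreover have "polyfun_on (affine_space S) coord (\<lambda>c. F i (\<Phi> c))" if "i < n" for i
      by (rule polyfun_on_compose[OF F(1)[OF that]]) (use T \<Phi> in auto)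
    ultimately show "ereal (real n) \<le> ereal (real (card S))"
      using alg_indep_affine_le[OF S, of n "\<lambda>i c. F i (\<Phi> c)"] by simp
  qed
next
  obtain e where e: "bij_betw e {..<card S} S"
    using ex_bij_betw_nat_finite[OF S] by (auto simp: atLeast0LessThan)
  define A :: "nat \<Rightarrow> ('s \<Rightarrow> 'k) set" where "A k = affine_space (e ` {..<k})" for k
  define Z where "Z k = \<Phi> ` A k" for k
  have AS: "A k \<subseteq> affine_space S" if "k \<le> card S" for k
  proof -
    have "e ` {..<k} \<subseteq> S" using e that by (auto simp: bij_betw_def)
    then show ?thesis unfolding A_def affine_space_def by blast
  qed
  have closed: "closedin (subtopology zariski T) (Z k)" if "k \<le> card S" for k
  proof -
    have "Z k = {p\<in>T. \<forall>F\<in>insert (\<lambda>_. 0) (\<Psi> ` (S - e ` {..<k})). F p = 0}"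
    proof (intro equalityI subsetI)
      fix p assume "p \<in> Z k"
      then obtain c where c: "c \<in> A k" "p = \<Phi> c" by (auto simp: Z_def)
      then have cS: "c \<in> affine_space S" using AS[OF that] by blast
      have "\<Psi> s p = 0" if "s \<in> S - e ` {..<k}" for s
        using inv[of s c] cS c that by (auto simp: A_def affine_space_def)
      then show "p \<in> {p\<in>T. \<forall>F\<in>insert (\<lambda>_. 0) (\<Psi> ` (S - e ` {..<k})). F p = 0}"
        using cS c T by auto
    next
      fix p assume p: "p \<in> {p\<in>T. \<forall>F\<in>insert (\<lambda>_. 0) (\<Psi> ` (S - e ` {..<k})). F p = 0}"
      then obtain c where c: "c \<in> affine_space S" "p = \<Phi> c" using T by auto
      have "c s = 0" if "s \<notin> e ` {..<k}" for s
        using p c inv that by (cases "s \<in> S") (auto simp: affine_space_def)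
      then show "p \<in> Z k" using c by (auto simp: Z_def A_def affine_space_def)
    qed
    moreover have "closedin (subtopology zariski T) {p\<in>T. \<forall>F\<in>insert (\<lambda>_. 0) (\<Psi> ` (S - e ` {..<k})). F p = 0}"
      by (rule closedin_zariski_zeros) (auto intro: polyfun_on.const \<Psi>)
    ultimately show ?thesis by simp
  qed
  have irr: "irreducible_in (subtopology zariski T) (Z k)" if k: "k \<le> card S" for k
    unfolding irreducible_in_def
  proof (intro conjI allI impI)
    have ZT: "Z k \<subseteq> T" using AS[OF k] by (auto simp: Z_def T)
    then show "Z k \<subseteq> topspace (subtopology zariski T)" by simp
    have "(\<lambda>_. 0) \<in> A k" by (simp add: A_def affine_space_def)
    then show "Z k \<noteq> {}" by (auto simp: Z_def)
    fix C D assume CD: "closedin (subtopology zariski T) C \<and> closedin (subtopology zariski T) D \<and> Z k \<subseteq> C \<union> D"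
    show "Z k \<subseteq> C \<or> Z k \<subseteq> D"
    proof (rule ccontr)
      assume "\<not> (Z k \<subseteq> C \<or> Z k \<subseteq> D)"
      then obtain a b where ab: "a \<in> A k" "\<Phi> a \<notin> C" "b \<in> A k" "\<Phi> b \<notin> D" by (auto simp: Z_def)
      have abT: "\<Phi> a \<in> T" "\<Phi> b \<in> T" using ab ZT by (auto simp: Z_def)
      obtain F where F: "polyfun_on T coord F" "\<forall>q\<in>C. F q = 0" "F (\<Phi> a) \<noteq> 0"
        using closedin_zariski_separate[of T C "\<Phi> a"] CD ab abT by blast
      obtain G where G: "polyfun_on T coord G" "\<forall>q\<in>D. G q = 0" "G (\<Phi> b) \<noteq> 0"
        using closedin_zariski_separate[of T D "\<Phi> b"] CD ab abT by blast
      have \<Phi>': "polyfun_on (affine_space (e ` {..<k})) coord (\<lambda>c. \<Phi> c i)" for i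
        by (rule polyfun_on_compose[OF \<Phi>, where \<Phi> = "\<lambda>c. c"])
          (use AS[OF k] in \<open>auto simp: A_def intro: polyfun_on.var\<close>)
      have "polyfun_on (affine_space (e ` {..<k})) coord (\<lambda>c. F (\<Phi> c))"
        "polyfun_on (affine_space (e ` {..<k})) coord (\<lambda>c. G (\<Phi> c))"
        by (rule polyfun_on_compose[OF F(1)] polyfun_on_compose[OF G(1)];
            use \<Phi>' AS[OF k] in \<open>auto simp: T A_def\<close>)+
      then obtain c where "c \<in> A k" "F (\<Phi> c) * G (\<Phi> c) \<noteq> 0"
        using polyfun_on_affine_mult_nonzero[OF inf, of "e ` {..<k}" "\<lambda>c. F (\<Phi> c)" "\<lambda>c. G (\<Phi> c)" a b]
          ab F G by (auto simp: A_def)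
      moreover have "\<Phi> c \<in> C \<union> D" using CD \<open>c \<in> A k\<close> by (auto simp: Z_def)
      ultimately show False using F G by auto
    qed
  qed
  have strict: "Z k \<subset> Z (Suc k)" if k: "k < card S" for k
  proof
    have "A k \<subseteq> A (Suc k)" by (auto simp: A_def affine_space_def lessThan_Suc)
    then show "Z k \<subseteq> Z (Suc k)" by (auto simp: Z_def)
    have ek: "e k \<in> S" using e k by (auto simp: bij_betw_def)
    have ek': "e k \<noteq> e l" if "l < k" for l
      using e k that inj_onD[of e "{..<card S}" k l] by (auto simp: bij_betw_def)
    let ?c = "\<lambda>s. if s = e k then 1 else (0::'k)"
    have c: "?c \<in> A (Suc k)" by (auto simp: A_def affine_space_def)
    have "\<Phi> ?c \<notin> Z k"
    proof
      assume "\<Phi> ?c \<in> Z k"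
      then obtain c' where c': "c' \<in> A k" "\<Phi> ?c = \<Phi> c'" by (auto simp: Z_def)
      have "?c \<in> affine_space S" "c' \<in> affine_space S" using c c'(1) AS[of k] AS[of "Suc k"] k by auto
      then have "?c (e k) = c' (e k)" using inv[OF ek, of ?c] inv[OF ek, of c'] c'(2) by simp
      moreover have "c' (e k) = 0" using c'(1) ek' by (auto simp: A_def affine_space_def)
      ultimately show False by simp
    qed
    then show "Z k \<noteq> Z (Suc k)" using c by (auto simp: Z_def)
  qed
  show "ereal (card S) \<le> krull_dim (subtopology zariski T)"
    unfolding krull_dim_def
    by (intro Sup_upper CollectI exI[of _ "card S"] conjI exI[of _ Z]) (simp_all add: closed irr strict)
qed

section \<open>Monomials and leading terms\<close>

abbreviation cf :: "'k::field poly2 \<Rightarrow> mon \<Rightarrow> 'k" where "cf \<equiv> Poly_Mapping.lookup"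
abbreviation supp :: "'k::field poly2 \<Rightarrow> mon set" where "supp \<equiv> Poly_Mapping.keys"

lemma drl_less_irrefl [simp]: "\<not> drl_less u u" by (cases u) auto
lemma drl_less_trans: "drl_less u v \<Longrightarrow> drl_less v w \<Longrightarrow> drl_less u w"
  by (cases u; cases v; cases w) auto
lemma drl_less_linear: "drl_less u v \<or> u = v \<or> drl_less v u"
  by (cases u; cases v) auto
lemma drl_less_add: "drl_less (s + u) (s + v) \<longleftrightarrow> drl_less u v"
  by (cases u; cases v; cases s) auto
lemma mon_dvd_iff: "mon_dvd u v \<longleftrightarrow> (\<exists>s. v = s + u)"
proof (cases u; cases v)
  fix a b c d assume [simp]: "u = (a, b)" "v = (c, d)"
  have "mon_dvd u v \<Longrightarrow> v = (c - a, d - b) + u" by simp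
  moreover have "v = s + u \<Longrightarrow> mon_dvd u v" for s by (cases s) auto
  ultimately show ?thesis by blast
qed
lemma mon_dvd_refl [simp]: "mon_dvd u u" by (cases u) auto
lemma mon_dvd_trans: "mon_dvd u v \<Longrightarrow> mon_dvd v w \<Longrightarrow> mon_dvd u w"
  by (cases u; cases v; cases w) auto
lemma mon_dvd_antisym: "mon_dvd u v \<Longrightarrow> mon_dvd v u \<Longrightarrow> u = v"
  by (cases u; cases v) auto
lemma mon_dvd_add [simp]: "mon_dvd u (s + u)" by (cases u; cases s) auto
lemma mon_dvd_imp_drl: "mon_dvd u v \<Longrightarrow> u \<noteq> v \<Longrightarrow> drl_less u v"
  by (cases u; cases v) auto
lemma finite_drl_below: "finite {v. drl_less v u}"
proof (cases u)
  case (Pair a b)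
  have "{v. drl_less v u} \<subseteq> {..a + b} \<times> {..a + b}" using Pair by auto
  then show ?thesis by (rule finite_subset) simp
qed
lemma wf_drl: "wf {(u, v). drl_less u v}"
proof (rule wf_subset)
  show "{(u, v). drl_less u v} \<subseteq> inv_image (less_than <*lex*> less_than) (\<lambda>(a, b). (a + b, a))"
    by auto
qed (intro wf_inv_image wf_lex_prod wf_less_than)
lemma drl_induct: "(\<And>u. (\<And>v. drl_less v u \<Longrightarrow> P v) \<Longrightarrow> P u) \<Longrightarrow> P u"
  using wf_induct_rule[OF wf_drl, of P u] by simp

lemma poly2_eq_sum: "f = (\<Sum>u\<in>supp f. Poly_Mapping.single u (cf f u))"
  by (rule poly_mapping_eqI) (auto simp: lookup_sum lookup_single when_def in_keys_iff sum.delta)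

lemma cf_single_mult:
  "cf (Poly_Mapping.single u c * f) v = (if mon_dvd u v then c * cf f (v - u) else 0)"
proof -
  have "Poly_Mapping.single u c * f = (\<Sum>w\<in>supp f. Poly_Mapping.single (u + w) (c * cf f w))"
    by (subst (1) poly2_eq_sum[of f]) (simp add: sum_distrib_left mult_single)
  then have *: "cf (Poly_Mapping.single u c * f) v = (\<Sum>w\<in>supp f. if u + w = v then c * cf f w else 0)"
    by (simp add: lookup_sum lookup_single when_def)
  show ?thesis
  proof (cases "mon_dvd u v")
    case True
    have "u + w = v \<longleftrightarrow> w = v - u" for w using True by (cases u; cases v; cases w) auto
    then show ?thesis unfolding * using True by (auto simp: sum.delta in_keys_iff)
  next
    case False
    then have "u + w \<noteq> v" for w by (metis mon_dvd_add add.commute)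
    then show ?thesis unfolding * using False by simp
  qed
qed

lemma cf_single_mult_add [simp]: "cf (Poly_Mapping.single u c * f) (u + v) = c * cf f v"
  by (simp add: cf_single_mult add.commute[of u])

text \<open>The pairs of exponents are summed over a box, which is finite independently of the factors; this
is what makes coefficients of products polynomial in the coefficients of the factors.\<close>

lemma cf_mult: "cf (f * g) s = (\<Sum>u\<in>{..fst s} \<times> {..snd s}. cf f u * cf g (s - u))"
proof -
  have dvd: "mon_dvd u s \<longleftrightarrow> u \<in> {..fst s} \<times> {..snd s}" for u by (cases u; cases s) auto
  have "f * g = (\<Sum>u\<in>supp f. Poly_Mapping.single u (cf f u) * g)"
    by (subst (1) poly2_eq_sum[of f]) (simp add: sum_distrib_right)
  then have "cf (f * g) s = (\<Sum>u\<in>supp f. if mon_dvd u s then cf f u * cf g (s - u) else 0)"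
    by (simp add: lookup_sum cf_single_mult)
  also have "\<dots> = (\<Sum>u\<in>supp f \<inter> {u. mon_dvd u s}. cf f u * cf g (s - u))"
    by (subst sum.inter_restrict) simp_all
  also have "\<dots> = (\<Sum>u\<in>{..fst s} \<times> {..snd s}. cf f u * cf g (s - u))"
    by (rule sum.mono_neutral_left) (auto simp: dvd in_keys_iff)
  finally show ?thesis .
qed

lemma supp_single_mult: "supp (Poly_Mapping.single u c * f) \<subseteq> (+) u ` supp f"
proof
  fix w assume "w \<in> supp (Poly_Mapping.single u c * f)"
  then obtain a b where "w = a + b" "a \<in> supp (Poly_Mapping.single u c)" "b \<in> supp f"
    using keys_mult[of "Poly_Mapping.single u c" f] by blast
  then show "w \<in> (+) u ` supp f" by (simp split: if_splits)
qed

text \<open>Leading monomials are used through this relation, which unlike \<^const>\<open>lead_mon\<close> also asserts that the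
polynomial is nonzero.\<close>

definition is_lead :: "'k::field poly2 \<Rightarrow> mon \<Rightarrow> bool" where
  "is_lead f u \<longleftrightarrow> cf f u \<noteq> 0 \<and> (\<forall>v\<in>supp f. v \<noteq> u \<longrightarrow> drl_less v u)"

lemma is_leadD: "is_lead f u \<Longrightarrow> cf f v \<noteq> 0 \<Longrightarrow> v = u \<or> drl_less v u"
  by (auto simp: is_lead_def in_keys_iff)

lemma is_lead_unique: "is_lead f u \<Longrightarrow> is_lead f v \<Longrightarrow> u = v"
  by (metis is_leadD is_lead_def drl_less_trans drl_less_irrefl)

lemma lead_mon_eq: "is_lead f u \<Longrightarrow> lead_mon f = u"
  unfolding lead_mon_def
  by (rule the_equality) (auto simp: is_lead_def in_keys_iff intro: is_lead_unique[of f, unfolded is_lead_def in_keys_iff])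

lemma drl_max:
  assumes "finite A" "A \<noteq> {}" shows "\<exists>u\<in>A. \<forall>v\<in>A. v \<noteq> u \<longrightarrow> drl_less v u"
  using assms
proof (induction A rule: finite_ne_induct)
  case (insert x A)
  then obtain u where u: "u \<in> A" "\<forall>v\<in>A. v \<noteq> u \<longrightarrow> drl_less v u" by blast
  show ?case
  proof (cases "drl_less x u")
    case True
    then show ?thesis using u by (intro bexI[of _ u]) auto
  next
    case False
    then have "drl_less u x" using drl_less_linear[of x u] u insert by auto
    then show ?thesis using u by (intro bexI[of _ x]) (auto intro: drl_less_trans)
  qed
qed simp

lemma is_lead_ex: "f \<noteq> 0 \<Longrightarrow> \<exists>u. is_lead f u"
  using drl_max[of "supp f"] by (auto simp: is_lead_def in_keys_iff)

lemma is_lead_lead_mon: "f \<noteq> 0 \<Longrightarrow> is_lead f (lead_mon f)"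
  using is_lead_ex lead_mon_eq by metis

lemma is_lead_nonzero: "is_lead f u \<Longrightarrow> f \<noteq> 0"
  by (auto simp: is_lead_def)

lemma is_lead_single_mult:
  assumes "is_lead f u" "c \<noteq> 0" shows "is_lead (Poly_Mapping.single s c * f) (s + u)"
  unfolding is_lead_def
proof (intro conjI ballI impI)
  show "cf (Poly_Mapping.single s c * f) (s + u) \<noteq> 0" using assms by (simp add: is_lead_def)
  fix v assume v: "v \<in> supp (Poly_Mapping.single s c * f)" "v \<noteq> s + u"
  then obtain w where w: "v = s + w" "w \<in> supp f" using supp_single_mult by blast
  then show "drl_less v (s + u)" using v assms by (auto simp: drl_less_add is_lead_def)
qed

section \<open>Ideals, normal forms and reduced Groebner bases\<close>

lemma ideal_iff: "is_ideal I \<longleftrightarrow> 0 \<in> I \<and> (\<forall>f\<in>I. \<forall>g\<in>I. f + g \<in> I) \<and> (\<forall>r. \<forall>f\<in>I. r * f \<in> I)"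
  unfolding is_ideal_def Modules.module.subspace_def[OF module_times] by blast

lemma ideal_zero: "is_ideal I \<Longrightarrow> 0 \<in> I" by (simp add: ideal_iff)
lemma ideal_add: "is_ideal I \<Longrightarrow> f \<in> I \<Longrightarrow> g \<in> I \<Longrightarrow> f + g \<in> I" by (simp add: ideal_iff)
lemma ideal_mult: "is_ideal I \<Longrightarrow> f \<in> I \<Longrightarrow> r * f \<in> I" by (simp add: ideal_iff)
lemma ideal_uminus: "is_ideal I \<Longrightarrow> f \<in> I \<Longrightarrow> - f \<in> I" using ideal_mult[of I f "-1"] by simp
lemma ideal_diff: "is_ideal I \<Longrightarrow> f \<in> I \<Longrightarrow> g \<in> I \<Longrightarrow> f - g \<in> I"
  using ideal_add[OF _ _ ideal_uminus] by (metis ab_group_add_class.ab_diff_conv_add_uminus)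
lemma ideal_sum: "is_ideal I \<Longrightarrow> (\<And>a. a \<in> A \<Longrightarrow> f a \<in> I) \<Longrightarrow> sum f A \<in> I"
  by (induction A rule: infinite_finite_induct) (auto intro: ideal_zero ideal_add)

lemma ideal_gen_ideal: "is_ideal (ideal_gen S)"
  unfolding is_ideal_def ideal_gen_def by (rule Modules.module.subspace_span[OF module_times])
lemma ideal_gen_superset: "S \<subseteq> ideal_gen S"
  unfolding ideal_gen_def by (rule Modules.module.span_superset[OF module_times])
lemma ideal_gen_least: "S \<subseteq> I \<Longrightarrow> is_ideal I \<Longrightarrow> ideal_gen S \<subseteq> I"
  unfolding is_ideal_def ideal_gen_def by (rule Modules.module.span_minimal[OF module_times])

definition monspan :: "mon set \<Rightarrow> 'k::field poly2 set" where
  "monspan M = {f. supp f \<subseteq> M}"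

definition up_closed :: "mon set \<Rightarrow> bool" where
  "up_closed M \<longleftrightarrow> (\<forall>u\<in>M. \<forall>s. s + u \<in> M)"

lemma monspan_ideal:
  assumes "up_closed M" shows "is_ideal (monspan M)"
  unfolding ideal_iff monspan_def
proof (intro conjI ballI allI)
  fix f g r :: "'a poly2"
  assume f: "f \<in> {f. supp f \<subseteq> M}"
  show "r * f \<in> {f. supp f \<subseteq> M}"
    using keys_mult[of r f] f assms by (force simp: up_closed_def)
  assume g: "g \<in> {f. supp f \<subseteq> M}"
  show "f + g \<in> {f. supp f \<subseteq> M}" using keys_add[of f g] f g by auto
qed simp

lemma monspan_monomial [simp]: "monomial u \<in> monspan M \<longleftrightarrow> u \<in> M"
  by (simp add: monspan_def)

lemma monspan_inject: "monspan M = (monspan N :: 'k::field poly2 set) \<longleftrightarrow> M = N"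
  by (metis monspan_monomial subsetI subset_antisym)

lemma ideal_gen_monomials:
  "(ideal_gen (monomial ` A) :: 'k::field poly2 set) = monspan {u. \<exists>m\<in>A. mon_dvd m u}" (is "_ = monspan ?M")
proof
  have "up_closed ?M" unfolding up_closed_def using mon_dvd_trans[OF _ mon_dvd_add] by blast
  moreover have "(monomial ` A :: 'k poly2 set) \<subseteq> monspan ?M"
    by (intro image_subsetI) (simp only: monspan_monomial mem_Collect_eq, blast intro: mon_dvd_refl)
  ultimately show "(ideal_gen (monomial ` A) :: 'k poly2 set) \<subseteq> monspan ?M"
    by (intro ideal_gen_least monspan_ideal)
  show "(monspan ?M :: 'k poly2 set) \<subseteq> ideal_gen (monomial ` A)"
  proof
    fix f :: "'k poly2" assume f: "f \<in> monspan ?M"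
    have "Poly_Mapping.single u (cf f u) \<in> ideal_gen (monomial ` A)" if u: "u \<in> supp f" for u
    proof -
      obtain m s where m: "m \<in> A" "u = s + m" using f u unfolding monspan_def mon_dvd_iff by blast
      then have "(monomial m :: 'k poly2) \<in> ideal_gen (monomial ` A)"
        using ideal_gen_superset[of "monomial ` A"] by auto
      then have "Poly_Mapping.single s (cf f u) * monomial m \<in> ideal_gen (monomial ` A)"
        by (intro ideal_mult ideal_gen_ideal)
      then show ?thesis using m by (simp add: mult_single)
    qed
    then show "f \<in> ideal_gen (monomial ` A)"
      by (subst poly2_eq_sum[of f]) (intro ideal_sum ideal_gen_ideal)
  qed
qed

definition lead_mons :: "'k::field poly2 set \<Rightarrow> mon set" where
  "lead_mons I = {u. \<exists>f\<in>I. is_lead f u}"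

lemma initial_ideal_eq:
  fixes I :: "'k::field poly2 set"
  assumes "is_ideal I" shows "initial_ideal I = monspan (lead_mons I)"
proof -
  have "{monomial (lead_mon f) | f. f \<in> I \<and> f \<noteq> 0} = (monomial ` lead_mons I :: 'k poly2 set)"
    by (auto simp: lead_mons_def lead_mon_eq is_lead_nonzero image_iff dest: is_lead_lead_mon)
      (metis lead_mon_eq is_lead_nonzero)
  moreover have "{u. \<exists>m\<in>lead_mons I. mon_dvd m u} = lead_mons I"
  proof (intro equalityI subsetI)
    fix u assume "u \<in> {u. \<exists>m\<in>lead_mons I. mon_dvd m u}"
    then obtain f m s where f: "f \<in> I" "is_lead f m" "u = s + m"
      unfolding lead_mons_def mon_dvd_iff by blast
    then have "is_lead (Poly_Mapping.single s 1 * f) u" by (simp add: is_lead_single_mult)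
    then show "u \<in> lead_mons I" using f assms by (auto simp: lead_mons_def intro: ideal_mult)
  next
    fix u assume "u \<in> lead_mons I"
    then show "u \<in> {u. \<exists>m\<in>lead_mons I. mon_dvd m u}" using mon_dvd_refl by blast
  qed
  ultimately show ?thesis by (simp add: initial_ideal_def ideal_gen_monomials)
qed

text \<open>The initial ideal of an ideal is spanned by its leading monomials, which form a set closed under
multiples.\<close>

lemma V_monspan: "V (monspan M) = {I. is_ideal I \<and> lead_mons I = M}"
  by (auto simp: V_def initial_ideal_eq monspan_inject)

lemma standard_unique:
  assumes "f \<in> I" "supp f \<inter> lead_mons I = {}" shows "f = 0"
proof (rule ccontr)
  assume "f \<noteq> 0"
  then obtain u where u: "is_lead f u" using is_lead_ex by blast
  then have "u \<in> lead_mons I" using assms(1) unfolding lead_mons_def by blast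
  moreover have "u \<in> supp f" using u by (simp add: is_lead_def in_keys_iff)
  ultimately show False using assms(2) by blast
qed

lemma lead_mons_monic:
  assumes "is_ideal I" "u \<in> lead_mons I"
  shows "\<exists>f\<in>I. is_lead f u \<and> cf f u = 1"
proof -
  obtain f where f: "f \<in> I" "is_lead f u" using assms by (auto simp: lead_mons_def)
  let ?g = "Poly_Mapping.single 0 (inverse (cf f u)) * f"
  have "is_lead ?g (0 + u)" using f by (intro is_lead_single_mult) (auto simp: is_lead_def)
  moreover have "cf ?g (0 + u) = 1"
    unfolding cf_single_mult_add using f by (simp add: is_lead_def)
  ultimately show ?thesis using f assms by (intro bexI[of _ ?g]) (auto intro: ideal_mult)
qed

text \<open>Division with remainder, by induction along the term order: subtract an element of I with
leading monomial u and reduce the remaining smaller terms.\<close>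

lemma normal_form_monomial:
  assumes I: "is_ideal I"
  shows "\<exists>r. monomial u - r \<in> I \<and> supp r \<inter> lead_mons I = {} \<and> (\<forall>v\<in>supp r. v = u \<or> drl_less v u)"
proof (induction u rule: drl_induct)
  case (1 u)
  show ?case
  proof (cases "u \<in> lead_mons I")
    case False
    then show ?thesis using I by (intro exI[of _ "monomial u"]) (auto simp: ideal_zero)
  next
    case True
    then obtain f where f: "f \<in> I" "is_lead f u" "cf f u = 1" using lead_mons_monic[OF I] by blast
    let ?A = "supp f - {u}"
    have "\<forall>v\<in>?A. \<exists>r. monomial v - r \<in> I \<and> supp r \<inter> lead_mons I = {} \<and> (\<forall>w\<in>supp r. w = v \<or> drl_less w v)"
      using 1 f by (auto simp: is_lead_def)
    from bchoice[OF this] obtain r where r: "\<forall>v\<in>?A. monomial v - r v \<in> I \<and> supp (r v) \<inter> lead_mons I = {} \<and>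
        (\<forall>w\<in>supp (r v). w = v \<or> drl_less w v)" ..
    define R where "R = (\<Sum>v\<in>?A. Poly_Mapping.single 0 (- cf f v) * r v)"
    have ufin: "u \<in> supp f" using f by (simp add: in_keys_iff)
    define S where "S = (\<Sum>v\<in>?A. Poly_Mapping.single v (cf f v))"
    have fS: "f = monomial u + S"
      unfolding S_def using poly2_eq_sum[of f] f(3) sum.remove[OF finite_keys ufin, of "\<lambda>v. Poly_Mapping.single v (cf f v)"]
      by simp
    have "(\<Sum>v\<in>?A. Poly_Mapping.single 0 (- cf f v) * (monomial v - r v)) = - S - R"
      by (simp add: R_def S_def right_diff_distrib sum_subtractf sum_negf single_uminus mult_single)
    then have "monomial u - R = f + (\<Sum>v\<in>?A. Poly_Mapping.single 0 (- cf f v) * (monomial v - r v))"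
      using fS by (metis (no_types) add.assoc add_uminus_conv_diff diff_add_cancel diff_diff_eq2 add_diff_cancel_right')
    also have "\<dots> \<in> I" using f r by (intro ideal_add[OF I] ideal_sum[OF I] ideal_mult[OF I]) auto
    finally have "monomial u - R \<in> I" .
    moreover have suppR: "\<exists>v\<in>?A. w \<in> supp (r v)" if "w \<in> supp R" for w
    proof -
      have "w \<in> (\<Union>v\<in>?A. supp (Poly_Mapping.single 0 (- cf f v) * r v))"
        using that keys_sum[of "\<lambda>v. Poly_Mapping.single 0 (- cf f v) * r v" ?A] unfolding R_def by blast
      then obtain v where v: "v \<in> ?A" "w \<in> supp (Poly_Mapping.single 0 (- cf f v) * r v)" by blast
      have "w \<in> (+) 0 ` supp (r v)" using subsetD[OF supp_single_mult v(2)] .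
      then have "w \<in> supp (r v)" by simp
      then show ?thesis using v(1) by blast
    qed
    moreover have "supp R \<inter> lead_mons I = {}" using suppR r by blast
    moreover have "drl_less w u" if w: "w \<in> supp R" for w
    proof -
      obtain v where v: "v \<in> ?A" "w \<in> supp (r v)" using suppR[OF w] by blast
      then have "drl_less v u" using f(2) by (auto simp: is_lead_def)
      then show ?thesis using r v by (metis drl_less_trans)
    qed
    ultimately show ?thesis by blast
  qed
qed

text \<open>The element of the reduced Groebner basis with leading monomial u. The condition on the support
determines it without reference to a Groebner basis: two such elements differ by an element of I
without terms in the initial ideal, which must be 0.\<close>

definition red :: "'k::field poly2 set \<Rightarrow> mon \<Rightarrow> 'k poly2" where
  "red I u = (THE g. g \<in> I \<and> cf g u = 1 \<and> supp g \<inter> lead_mons I \<subseteq> {u})"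

lemma red_unique:
  assumes I: "is_ideal I" and g: "g \<in> I" "cf g u = 1" "supp g \<inter> lead_mons I \<subseteq> {u}"
    and h: "h \<in> I" "cf h u = 1" "supp h \<inter> lead_mons I \<subseteq> {u}"
  shows "g = h"
proof -
  have "g - h = 0"
  proof (rule standard_unique)
    show "g - h \<in> I" using g h I by (simp add: ideal_diff)
    have "cf (g - h) v = 0" if "v \<in> lead_mons I" for v
    proof (cases "v = u")
      case False
      then have "v \<notin> supp g" "v \<notin> supp h" using g h that by blast+
      then show ?thesis by (simp add: lookup_minus in_keys_iff)
    qed (use g h in \<open>simp add: lookup_minus\<close>)
    then show "supp (g - h) \<inter> lead_mons I = {}" by (auto simp: in_keys_iff)
  qed
  then show ?thesis by simp
qed

lemma red_eqI:
  assumes "is_ideal I" "g \<in> I" "cf g u = 1" "supp g \<inter> lead_mons I \<subseteq> {u}"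
  shows "red I u = g"
  unfolding red_def by (rule the_equality) (use assms red_unique[OF assms(1)] in blast)+

lemma red_props:
  assumes I: "is_ideal I" and u: "u \<in> lead_mons I"
  shows "red I u \<in> I" "cf (red I u) u = 1" "supp (red I u) \<inter> lead_mons I \<subseteq> {u}" "is_lead (red I u) u"
proof -
  obtain r where r: "monomial u - r \<in> I" "supp r \<inter> lead_mons I = {}" "\<forall>v\<in>supp r. v = u \<or> drl_less v u"
    using normal_form_monomial[OF I] by blast
  have ur: "cf r u = 0" using r(2) u by (auto simp: in_keys_iff)
  have cf: "cf (monomial u - r) v = (if v = u then 1 else - cf r v)" for v
    using ur by (simp add: lookup_minus lookup_single when_def)
  have eq: "red I u = monomial u - r"
    by (rule red_eqI[OF I r(1)]) (use cf r(2) in \<open>auto simp: in_keys_iff split: if_splits\<close>)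
  show "red I u \<in> I" "cf (red I u) u = 1" "supp (red I u) \<inter> lead_mons I \<subseteq> {u}" "is_lead (red I u) u"
    unfolding eq using r cf by (auto simp: in_keys_iff is_lead_def split: if_splits)
qed

locale minimal_generators =
  fixes I :: "'k::field poly2 set" and A :: "mon set"
  assumes I: "is_ideal I" and fin: "finite A"
    and gen: "lead_mons I = {u. \<exists>m\<in>A. mon_dvd m u}"
    and anti: "\<And>u v. u \<in> A \<Longrightarrow> v \<in> A \<Longrightarrow> mon_dvd u v \<Longrightarrow> u = v"
begin

lemma A_sub: "A \<subseteq> lead_mons I" unfolding gen using mon_dvd_refl by blast

lemma lead_red: "u \<in> A \<Longrightarrow> lead_mon (red I u) = u"
  using red_props(4)[OF I] A_sub lead_mon_eq by blast

lemma is_reduced_gb_red: "is_reduced_gb I (red I ` A)"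
  unfolding is_reduced_gb_def
proof (intro conjI)
  show "finite (red I ` A)" using fin by simp
  show "red I ` A \<subseteq> I" using red_props(1)[OF I] A_sub by blast
  have "red I u \<noteq> 0" if "u \<in> A" for u
    using red_props(4)[OF I subsetD[OF A_sub that]] by (rule is_lead_nonzero)
  then show "0 \<notin> red I ` A" by force
  have "(\<lambda>g. monomial (lead_mon g)) ` red I ` A = (monomial ` A :: 'k poly2 set)"
    by (auto simp: lead_red image_image)
  then show "ideal_gen ((\<lambda>g. monomial (lead_mon g)) ` red I ` A) = initial_ideal I"
    by (simp add: ideal_gen_monomials initial_ideal_eq[OF I] gen)
  show "\<forall>g\<in>red I ` A. cf g (lead_mon g) = 1"
    using red_props(2)[OF I] A_sub by (auto simp: lead_red)
  show "\<forall>g\<in>red I ` A. \<forall>g'\<in>red I ` A. g' \<noteq> g \<longrightarrow> (\<forall>t\<in>supp g. \<not> mon_dvd (lead_mon g') t)"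
  proof (intro ballI impI notI)
    fix g g' t assume "g \<in> red I ` A" "g' \<in> red I ` A" and ne: "g' \<noteq> g" and t: "t \<in> supp g" "mon_dvd (lead_mon g') t"
    then obtain u u' where u: "u \<in> A" "u' \<in> A" "g = red I u" "g' = red I u'" by (elim imageE)
    then have "t \<in> lead_mons I" using t(2) unfolding gen by (auto simp: lead_red)
    moreover have "t \<in> supp (red I u)" "u \<in> lead_mons I" using t(1) u A_sub by auto
    ultimately have "t = u" using red_props(3)[OF I, of u] by auto
    then have "u' = u" using anti u t by (auto simp: lead_red)
    then show False using ne u by simp
  qed
qed

text \<open>The minimal generators of the initial ideal must occur among the leading monomials of G, and a
further leading monomial would be divisible by one of them, against reducedness.\<close>

lemma is_reduced_gb_unique:
  assumes "is_reduced_gb I G" shows "G = red I ` A"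
proof -
  note G = assms[unfolded is_reduced_gb_def]
  have lead: "is_lead g (lead_mon g)" if "g \<in> G" for g
    using G that is_lead_lead_mon by metis
  have "ideal_gen (monomial ` lead_mon ` G) = (monspan (lead_mons I) :: 'k poly2 set)"
    using G by (simp add: image_image initial_ideal_eq[OF I])
  then have M: "{u. \<exists>m\<in>lead_mon ` G. mon_dvd m u} = lead_mons I"
    by (simp add: ideal_gen_monomials monspan_inject)
  have A: "\<exists>g\<in>G. lead_mon g = u" if "u \<in> A" for u
  proof -
    have "u \<in> lead_mons I" using that A_sub by blast
    then obtain g where g: "g \<in> G" "mon_dvd (lead_mon g) u" using M by blast
    then have "lead_mon g \<in> lead_mons I" using M by force
    then obtain u' where "u' \<in> A" "mon_dvd u' (lead_mon g)" using gen by blast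
    then have "lead_mon g = u" using anti that g mon_dvd_trans mon_dvd_antisym by metis
    then show ?thesis using g by blast
  qed
  have red: "\<exists>u\<in>A. lead_mon g = u \<and> g = red I u" if g: "g \<in> G" for g
  proof -
    have key: "lead_mon g \<in> A \<and> t = lead_mon g" if t: "t \<in> supp g" "t \<in> lead_mons I" for t
    proof -
      obtain u where u: "u \<in> A" "mon_dvd u t" using gen t by blast
      obtain g' where g': "g' \<in> G" "lead_mon g' = u" using A u by blast
      have "g' = g" using G g g' t u by blast
      then have "u = lead_mon g" using g' by simp
      moreover have "t = u"
      proof (rule ccontr)
        assume "t \<noteq> u"
        then have "drl_less u t" using mon_dvd_imp_drl u by blast
        moreover have "drl_less t u" using lead[OF g] t \<open>t \<noteq> u\<close> \<open>u = lead_mon g\<close>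
          by (auto simp: is_lead_def)
        ultimately show False using drl_less_trans drl_less_irrefl by blast
      qed
      ultimately show ?thesis using u by simp
    qed
    have lg: "lead_mon g \<in> supp g" "lead_mon g \<in> lead_mons I"
    proof -
      show "lead_mon g \<in> supp g" using lead[OF g] by (simp add: is_lead_def in_keys_iff)
      show "lead_mon g \<in> lead_mons I"
        unfolding lead_mons_def by (intro CollectI bexI[of _ g]) (use lead[OF g] g G in auto)
    qed
    have "red I (lead_mon g) = g"
      by (rule red_eqI[OF I]) (use G g key in auto)
    then show ?thesis using key[OF lg] by auto
  qed
  show ?thesis
  proof (intro equalityI subsetI)
    fix g assume "g \<in> G" then show "g \<in> red I ` A" using red by blast
  next
    fix g assume "g \<in> red I ` A"
    then obtain u where "u \<in> A" "g = red I u" by blast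
    then show "g \<in> G" using A red by metis
  qed
qed

lemma gb_coords_eq:
  "gb_coords I (u, v) = (if u \<in> A \<and> v \<noteq> u then cf (red I u) v else 0)"
proof -
  have gb: "reduced_gb I = red I ` A"
    unfolding reduced_gb_def
    by (rule the_equality) (use is_reduced_gb_red is_reduced_gb_unique in blast)+
  have ex: "(\<exists>g\<in>red I ` A. lead_mon g = u) \<longleftrightarrow> u \<in> A" by (auto simp: lead_red)
  have "(THE g. g \<in> red I ` A \<and> lead_mon g = u) = red I u" if "u \<in> A"
    by (rule the_equality) (use that in \<open>auto simp: lead_red\<close>)
  then show ?thesis unfolding gb_coords_def gb using ex by simp
qed

end

section \<open>Leading terms of products and sums\<close>

lemma is_lead_mult:
  assumes f: "is_lead f u" and g: "is_lead g v"
  shows "is_lead (f * g) (u + v)" "cf (f * g) (u + v) = cf f u * cf g v"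
proof -
  have key: "w = u \<and> w' = v \<or> drl_less (w + w') (u + v)" if "w \<in> supp f" "w' \<in> supp g" for w w'
  proof -
    have "w = u \<or> drl_less w u" "w' = v \<or> drl_less w' v" using f g that by (auto simp: is_lead_def)
    then show ?thesis
      using drl_less_add[of u w' v] drl_less_add[of w' w u] drl_less_trans[of "w + w'" "u + w'" "u + v"]
      by (auto simp: add.commute)
  qed
  show eq: "cf (f * g) (u + v) = cf f u * cf g v"
  proof -
    have "cf f w * cf g (u + v - w) = 0" if "w \<in> {..fst (u + v)} \<times> {..snd (u + v)}" "w \<noteq> u" for w
    proof (rule ccontr)
      assume "cf f w * cf g (u + v - w) \<noteq> 0"
      then have "w \<in> supp f" "u + v - w \<in> supp g" by (auto simp: in_keys_iff)
      moreover have "w + (u + v - w) = u + v" using that by (cases w; cases u; cases v) auto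
      ultimately show False using key[of w "u + v - w"] that(2) by auto
    qed
    then have "(\<Sum>w\<in>{..fst (u + v)} \<times> {..snd (u + v)}. cf f w * cf g (u + v - w)) =
      (\<Sum>w\<in>{u}. cf f w * cf g (u + v - w))"
      by (intro sum.mono_neutral_right) (auto simp: mem_Times_iff)
    then show ?thesis by (simp add: cf_mult)
  qed
  show "is_lead (f * g) (u + v)"
    unfolding is_lead_def
  proof (intro conjI ballI impI)
    show "cf (f * g) (u + v) \<noteq> 0" using f g eq by (simp add: is_lead_def)
    fix s assume s: "s \<in> supp (f * g)" "s \<noteq> u + v"
    then obtain w w' where "s = w + w'" "w \<in> supp f" "w' \<in> supp g" using keys_mult[of f g] by blast
    then show "drl_less s (u + v)" using key[of w w'] s(2) by blast
  qed
qed

text \<open>Terms with distinct leading monomials cannot cancel at the largest of these.\<close>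

lemma is_lead_sum_distinct:
  assumes "finite J" "J \<noteq> {}" "\<And>j. j \<in> J \<Longrightarrow> is_lead (g j) (l j)" "inj_on l J"
  shows "\<exists>j\<in>J. is_lead (\<Sum>j\<in>J. g j) (l j) \<and> (\<forall>i\<in>J. i = j \<or> drl_less (l i) (l j))"
proof -
  obtain j where j: "j \<in> J" "\<forall>v\<in>l ` J. v \<noteq> l j \<longrightarrow> drl_less v (l j)"
    using drl_max[of "l ` J"] assms by auto
  have less: "i = j \<or> drl_less (l i) (l j)" if "i \<in> J" for i
    using j that assms(4) by (auto dest: inj_onD)
  have gl: "v = l i \<or> drl_less v (l i)" if "i \<in> J" "cf (g i) v \<noteq> 0" for i v
    using is_leadD[OF assms(3)] that by blast
  have "cf (g i) (l j) = 0" if "i \<in> J - {j}" for i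
  proof (rule ccontr)
    assume "cf (g i) (l j) \<noteq> 0"
    then have "l j = l i \<or> drl_less (l j) (l i)" using gl that by blast
    moreover have "drl_less (l i) (l j)" using less that by blast
    ultimately show False using drl_less_trans drl_less_irrefl by metis
  qed
  then have "cf (\<Sum>j\<in>J. g j) (l j) = cf (g j) (l j)"
    using sum.remove[OF assms(1) j(1), of "\<lambda>i. cf (g i) (l j)"] by (simp add: lookup_sum)
  moreover have "drl_less v (l j)" if v: "v \<in> supp (\<Sum>j\<in>J. g j)" "v \<noteq> l j" for v
  proof -
    obtain i where i: "i \<in> J" "cf (g i) v \<noteq> 0"
      using v(1) by (auto simp: in_keys_iff lookup_sum dest: sum.not_neutral_contains_not_neutral)
    then have "v = l i \<or> drl_less v (l i)" using gl by blast
    moreover have "i = j \<or> drl_less (l i) (l j)" using less i by blast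
    ultimately show ?thesis using v(2) drl_less_trans by blast
  qed
  ultimately have "is_lead (\<Sum>j\<in>J. g j) (l j)"
    using assms(3)[OF j(1)] by (simp add: is_lead_def)
  then show ?thesis using j(1) less by blast
qed

section \<open>The subring K[y]\<close>

definition ypoly :: "'k::field poly \<Rightarrow> 'k poly2" where
  "ypoly p = (\<Sum>b\<le>Polynomial.degree p. Poly_Mapping.single (0, b) (Polynomial.coeff p b))"

lemma cf_ypoly: "cf (ypoly p) (a, b) = (if a = 0 then Polynomial.coeff p b else 0)"
proof -
  have "cf (ypoly p) (a, b) = (\<Sum>b'\<le>Polynomial.degree p. if b' = b then (if a = 0 then Polynomial.coeff p b else 0) else 0)"
    unfolding ypoly_def lookup_sum by (intro sum.cong) (auto simp: lookup_single when_def)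
  then show ?thesis by (auto simp: sum.delta coeff_eq_0)
qed

lemma cf_ypoly_mult: "cf (ypoly p * f) (a, b) = (\<Sum>j\<le>b. Polynomial.coeff p j * cf f (a, b - j))"
proof -
  have "cf (ypoly p * f) (a, b) = (\<Sum>(i, j)\<in>{..a} \<times> {..b}. if i = 0 then Polynomial.coeff p j * cf f (a, b - j) else 0)"
    unfolding cf_mult by (intro sum.cong) (auto simp: cf_ypoly)
  also have "\<dots> = (\<Sum>i\<le>a. \<Sum>j\<le>b. if i = 0 then Polynomial.coeff p j * cf f (a, b - j) else 0)"
    by (simp add: sum.cartesian_product)
  also have "\<dots> = (\<Sum>i\<le>a. if i = 0 then (\<Sum>j\<le>b. Polynomial.coeff p j * cf f (a, b - j)) else 0)"
    by (intro sum.cong) auto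
  finally show ?thesis by (simp add: sum.delta)
qed

lemma ypoly_mult: "ypoly (p * q) = ypoly p * ypoly q"
proof (rule poly_mapping_eqI)
  fix s :: mon show "cf (ypoly (p * q)) s = cf (ypoly p * ypoly q) s"
    by (cases s) (auto simp: cf_ypoly_mult cf_ypoly Polynomial.coeff_mult)
qed

lemma ypoly_add: "ypoly (p + q) = ypoly p + ypoly q"
proof (rule poly_mapping_eqI)
  fix s :: mon show "cf (ypoly (p + q)) s = cf (ypoly p + ypoly q) s"
    by (cases s) (auto simp: cf_ypoly lookup_add)
qed

lemma ypoly_0 [simp]: "ypoly 0 = 0" by (simp add: ypoly_def)

lemma ypoly_diff: "ypoly (p - q) = ypoly p - ypoly q"
  using ypoly_add[of "p - q" q] by (simp add: algebra_simps)

lemma ypoly_sum: "ypoly (\<Sum>a\<in>A. p a) = (\<Sum>a\<in>A. ypoly (p a))"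
  by (induction A rule: infinite_finite_induct) (auto simp: ypoly_add)

lemma ypoly_monom: "ypoly (Polynomial.monom c b) = Poly_Mapping.single (0, b) c"
proof (rule poly_mapping_eqI)
  fix s :: mon show "cf (ypoly (Polynomial.monom c b)) s = cf (Poly_Mapping.single (0, b) c) s"
    by (cases s) (auto simp: cf_ypoly lookup_single when_def)
qed

lemma ypoly_1 [simp]: "ypoly 1 = 1"
  using ypoly_monom[of 1 0] by (metis monom_eq_1 single_one zero_prod_def)

lemma is_lead_ypoly: "p \<noteq> 0 \<Longrightarrow> is_lead (ypoly p) (0, Polynomial.degree p)"
proof -
  assume p: "p \<noteq> 0"
  have "b = Polynomial.degree p" if "Polynomial.coeff p b \<noteq> 0" "\<not> b < Polynomial.degree p" for b
    using le_degree[OF that(1)] that(2) by simp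
  then show ?thesis using p by (auto simp: is_lead_def cf_ypoly in_keys_iff split: if_splits)
qed

section \<open>Staircases\<close>

text \<open>The indices count downwards in the x-exponent: the i-th generator has x-exponent t - i. For a
lex-segment ideal every x-exponent up to t contributes a minimal generator, which is why all steps
of m are positive.\<close>

locale staircase =
  fixes t :: nat and m :: "nat \<Rightarrow> nat"
  assumes m_0: "m 0 = 0" and m_Suc: "\<And>i. i < t \<Longrightarrow> m i < m (Suc i)"
begin

definition L :: "nat \<Rightarrow> mon" where "L i = (t - i, m i)"
definition d :: "nat \<Rightarrow> nat" where "d i = m i - m (i - 1)"
definition M :: "mon set" where "M = {u. \<exists>i\<le>t. mon_dvd (L i) u}"
text \<open>A bound above all x-exponents that occur; it makes \<open>wt\<close> below represent the term order.\<close>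

definition B :: nat where "B = t + m t + 2"
text \<open>An additive function that agrees with the term order on monomials of x-exponent less than B.
Replacing the term order by a numerical weight turns comparisons into linear arithmetic
and quotients of monomials into differences of numbers.\<close>

fun wt :: "mon \<Rightarrow> nat" where "wt (a, b) = (a + b) * B + a"
abbreviation wL :: "nat \<Rightarrow> nat" where "wL i \<equiv> wt (L i)"

lemma m_less: "i < j \<Longrightarrow> j \<le> t \<Longrightarrow> m i < m j"
proof (induction j)
  case (Suc j)
  have "m j < m (Suc j)" using Suc.prems by (intro m_Suc) simp
  then show ?case using Suc.IH Suc.prems by (cases "i = j") simp_all
qed simp

lemma m_le: "i \<le> j \<Longrightarrow> j \<le> t \<Longrightarrow> m i \<le> m j"
  using m_less[of i j] by (cases "i = j") auto

lemma d_pos: "1 \<le> i \<Longrightarrow> i \<le> t \<Longrightarrow> 1 \<le> d i"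
  using m_less[of "i - 1" i] by (simp add: d_def)

lemma m_d: "1 \<le> i \<Longrightarrow> i \<le> t \<Longrightarrow> m i = m (i - 1) + d i"
  using m_less[of "i - 1" i] by (simp add: d_def)

lemma deg_mono: "i \<le> j \<Longrightarrow> j \<le> t \<Longrightarrow> t - i + m i \<le> t - j + m j"
proof (induction j)
  case (Suc j)
  have "m j < m (Suc j)" using Suc.prems by (intro m_Suc) simp
  then show ?case using Suc.IH Suc.prems by (cases "i = Suc j") simp_all
qed simp

lemma M_iff: "u \<in> M \<longleftrightarrow> m (t - fst u) \<le> snd u"
proof
  assume "u \<in> M"
  then obtain i where i: "i \<le> t" "t - i \<le> fst u" "m i \<le> snd u" by (cases u) (auto simp: M_def L_def)
  then have "m (t - fst u) \<le> m i" by (intro m_le) auto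
  then show "m (t - fst u) \<le> snd u" using i by simp
next
  assume "m (t - fst u) \<le> snd u"
  then show "u \<in> M" unfolding M_def by (cases u) (auto simp: L_def intro!: exI[of _ "t - fst u"])
qed

lemma L_in_M: "i \<le> t \<Longrightarrow> L i \<in> M"
  by (auto simp: M_def)

lemma L_antichain: "i \<le> t \<Longrightarrow> j \<le> t \<Longrightarrow> mon_dvd (L i) (L j) \<Longrightarrow> i = j"
  using m_less[of j i] by (cases i j rule: linorder_cases) (auto simp: L_def)

lemma wt_add: "wt (u + v) = wt u + wt v"
  by (cases u; cases v) (auto simp: algebra_simps)

lemma wt_imp_drl: "wt u < wt v \<Longrightarrow> fst v < B \<Longrightarrow> drl_less u v"
proof (cases u; cases v)
  fix a b c e assume *: "wt u < wt v" "fst v < B" "u = (a, b)" "v = (c, e)"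
  show ?thesis
  proof (rule ccontr)
    assume "\<not> drl_less u v"
    then consider "a + b = c + e" "a \<ge> c" | "a + b \<ge> Suc (c + e)" using * by fastforce
    then show False
    proof cases
      case 2
      then have "(a + b) * B \<ge> Suc (c + e) * B" by (rule mult_le_mono1)
      then show ?thesis using * by simp
    qed (use * in simp)
  qed
qed

lemma drl_imp_wt: "drl_less u v \<Longrightarrow> fst u < B \<Longrightarrow> wt u < wt v"
proof (cases u; cases v)
  fix a b c e assume *: "drl_less u v" "fst u < B" "u = (a, b)" "v = (c, e)"
  then consider "a + b = c + e" "a < c" | "Suc (a + b) \<le> c + e" by fastforce
  then show "wt u < wt v"
  proof cases
    case 2
    then have "Suc (a + b) * B \<le> (c + e) * B" by (rule mult_le_mono1)
    then show ?thesis using * by simp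
  qed (use * in simp)
qed

lemma fst_L: "fst (L i) \<le> t" by (simp add: L_def)

lemma fst_below_L:
  assumes "v = L i \<or> drl_less v (L i)" "i \<le> t" shows "fst v < B"
proof -
  have "fst v + snd v \<le> t - i + m i" using assms(1) by (cases v) (auto simp: L_def)
  also have "\<dots> \<le> t + m t" using m_le[OF assms(2)] by simp
  finally show ?thesis by (simp add: B_def)
qed

lemma lead_wt:
  assumes "is_lead f (L i)" "i \<le> t" "v \<in> supp f" "v \<noteq> L i" shows "wt v < wL i"
  using assms fst_below_L[of v i] by (intro drl_imp_wt) (auto simp: is_lead_def)

lemma wt_lead:
  assumes "cf f (L i) \<noteq> 0" "\<And>v. v \<in> supp f \<Longrightarrow> v \<noteq> L i \<Longrightarrow> wt v < wL i"
  shows "is_lead f (L i)"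
  using assms fst_L[of i] by (auto simp: is_lead_def B_def intro!: wt_imp_drl)

lemma wt_y: "wt (0, b) = b * B" by simp

lemma wL_0: "wL 0 = t * (B + 1)" by (simp add: L_def m_0)

text \<open>The two leading terms x L i and y^(d i) L (i-1) of the i-th relation coincide.\<close>

lemma wL_step: "1 \<le> i \<Longrightarrow> i \<le> t \<Longrightarrow> d i * B + wL (i - 1) = B + 1 + wL i"
proof -
  assume i: "1 \<le> i" "i \<le> t"
  obtain k where k: "i = Suc k" using i by (cases i) auto
  then have "(0, d i) + L (i - 1) = (1, 0) + L i"
    using m_d[OF i] i by (auto simp: L_def)
  from arg_cong[OF this, of wt] show ?thesis by (simp only: wt_add) simp
qed

definition lead_family :: "(nat \<Rightarrow> 'k::field poly2) \<Rightarrow> bool" where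
  "lead_family f \<longleftrightarrow> (\<forall>i\<le>t. is_lead (f i) (L i))"

lemma lead_ypoly_mult:
  assumes "lead_family f" "j \<le> t" "p \<noteq> 0"
  shows "is_lead (ypoly p * f j) ((0, Polynomial.degree p) + L j)"
  using is_lead_mult(1)[OF is_lead_ypoly[OF assms(3)]] assms by (auto simp: lead_family_def)

text \<open>The summands \<open>ypoly (p j) * f j\<close> have leading monomials with distinct x-exponents, so nothing
cancels at the top and the degree of each \<open>p j\<close> is controlled by the terms of the sum. The
case n = 0 is the linear independence of the f j over K[y].\<close>

lemma expansion_bound:
  assumes f: "lead_family f"
    and h: "\<And>v. v \<in> supp (\<Sum>j\<le>t. ypoly (p j) * f j) \<Longrightarrow> wt v < n"
    and c: "j \<le> t" "Polynomial.coeff (p j) b \<noteq> 0"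
  shows "b * B + wL j < n"
proof -
  let ?J = "{j. j \<le> t \<and> p j \<noteq> 0}" and ?l = "\<lambda>j. (0, Polynomial.degree (p j)) + L j"
  have sum: "(\<Sum>j\<le>t. ypoly (p j) * f j) = (\<Sum>j\<in>?J. ypoly (p j) * f j)"
    by (rule sum.mono_neutral_right) auto
  have j: "j \<in> ?J" using c by auto
  have lead: "is_lead (ypoly (p i) * f i) (?l i)" if "i \<in> ?J" for i
    using lead_ypoly_mult[OF f] that by blast
  have "inj_on ?l ?J" by (auto simp: inj_on_def L_def)
  then obtain i where i: "i \<in> ?J" "is_lead (\<Sum>j\<in>?J. ypoly (p j) * f j) (?l i)"
    "\<forall>j\<in>?J. j = i \<or> drl_less (?l j) (?l i)"
    using is_lead_sum_distinct[of ?J "\<lambda>j. ypoly (p j) * f j" ?l] lead j by fastforce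
  have "wt (?l i) < n"
    by (rule h) (use i(2) in \<open>simp add: sum is_lead_def in_keys_iff\<close>)
  moreover have "wt (?l j) \<le> wt (?l i)"
  proof (cases "j = i")
    case False
    then have "drl_less (?l j) (?l i)" using i(3) j by blast
    moreover have "fst (?l j) < B" using fst_L[of j] by (simp add: B_def)
    ultimately show ?thesis using drl_imp_wt less_imp_le by blast
  qed simp
  moreover have "b * B \<le> Polynomial.degree (p j) * B" using le_degree[OF c(2)] by simp
  ultimately show ?thesis unfolding wt_add wt_y by linarith
qed

lemma expansion_unique:
  assumes f: "lead_family f" and eq: "(\<Sum>j\<le>t. ypoly (p j) * f j) = (\<Sum>j\<le>t. ypoly (q j) * f j)"
    and j: "j \<le> t"
  shows "p j = q j"
proof (rule poly_eqI)
  fix b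
  have "(\<Sum>j\<le>t. ypoly (p j - q j) * f j) = 0"
    using eq by (simp add: ypoly_diff left_diff_distrib sum_subtractf)
  then have "Polynomial.coeff (p j - q j) b = 0"
    using expansion_bound[OF f, of "\<lambda>j. p j - q j" 0 j b] j by auto
  then show "Polynomial.coeff (p j) b = Polynomial.coeff (q j) b" by simp
qed

text \<open>Reduction of leading terms never raises the x-degree above t, so only the f j themselves and
not x-multiples of f 0 are needed.\<close>

lemma expansion_ex:
  assumes I: "is_ideal I" "lead_mons I = M"
    and f: "lead_family f" "\<And>i. i \<le> t \<Longrightarrow> f i \<in> I" "\<And>i v. i \<le> t \<Longrightarrow> v \<in> supp (f i) \<Longrightarrow> fst v \<le> t"
    and h: "h \<in> I" "\<And>v. v \<in> supp h \<Longrightarrow> fst v \<le> t"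
  shows "\<exists>p. h = (\<Sum>j\<le>t. ypoly (p j) * f j)"
proof -
  have "\<forall>h. h \<in> I \<longrightarrow> (\<forall>v\<in>supp h. fst v \<le> t) \<longrightarrow> (\<forall>v\<in>supp h. v = u \<or> drl_less v u) \<longrightarrow>
      (\<exists>p. h = (\<Sum>j\<le>t. ypoly (p j) * f j))" for u
  proof (induction u rule: drl_induct)
    case (1 u)
    show ?case
    proof (intro allI impI)
      fix h assume h: "h \<in> I" "\<forall>v\<in>supp h. fst v \<le> t" "\<forall>v\<in>supp h. v = u \<or> drl_less v u"
      show "\<exists>p. h = (\<Sum>j\<le>t. ypoly (p j) * f j)"
      proof (cases "h = 0")
        case True
        then show ?thesis by (intro exI[of _ "\<lambda>_. 0"]) simp
      next
        case False
        then obtain w where w: "is_lead h w" using is_lead_ex by blast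
        then have wM: "w \<in> M" using h(1) I(2) by (auto simp: lead_mons_def)
        have ws: "w \<in> supp h" using w by (simp add: is_lead_def in_keys_iff)
        then have wu: "w = u \<or> drl_less w u" and wt: "fst w \<le> t" using h by auto
        define i where "i = t - fst w"
        define b where "b = snd w - m i"
        have it: "i \<le> t" by (simp add: i_def)
        have wL: "w = (0, b) + L i" using wM wt by (cases w) (auto simp: M_iff L_def i_def b_def)
        define c where "c = cf h w / cf (f i) (L i)"
        have fi: "is_lead (f i) (L i)" using f(1) it by (auto simp: lead_family_def)
        have c0: "c \<noteq> 0" using w fi by (simp add: c_def is_lead_def)
        let ?g = "Poly_Mapping.single (0, b) c * f i"
        have g: "is_lead ?g w" unfolding wL by (rule is_lead_single_mult[OF fi c0])
        have gw: "cf ?g w = cf h w"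
          unfolding wL cf_single_mult_add using fi by (simp add: c_def wL is_lead_def)
        have less: "drl_less v w" if "v \<in> supp (h - ?g)" for v
        proof -
          have "v \<noteq> w" using that gw by (auto simp: in_keys_iff lookup_minus)
          moreover have "cf h v \<noteq> 0 \<or> cf ?g v \<noteq> 0" using that by (auto simp: in_keys_iff lookup_minus)
          ultimately show ?thesis using is_leadD[OF w] is_leadD[OF g] by blast
        qed
        have "?g \<in> I" using f(2)[OF it] I(1) by (rule ideal_mult[rotated])
        then have hg: "h - ?g \<in> I" using h(1) I(1) by (simp add: ideal_diff)
        have "\<exists>p. h - ?g = (\<Sum>j\<le>t. ypoly (p j) * f j)"
        proof (cases "h - ?g = 0")
          case True
          then show ?thesis by (intro exI[of _ "\<lambda>_. 0"]) simp
        next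
          case False
          then obtain w' where w': "is_lead (h - ?g) w'" using is_lead_ex by blast
          then have w's: "w' \<in> supp (h - ?g)" by (simp add: is_lead_def in_keys_iff)
          then have "drl_less w' u" using less wu drl_less_trans by blast
          moreover have "\<forall>v\<in>supp (h - ?g). v = w' \<or> drl_less v w'" using w' by (auto simp: is_lead_def)
          moreover have "\<forall>v\<in>supp (h - ?g). fst v \<le> t"
          proof
            fix v assume "v \<in> supp (h - ?g)"
            then have "v \<in> supp h \<or> v \<in> supp ?g" by (auto simp: in_keys_iff lookup_minus)
            then show "fst v \<le> t"
            proof
              assume "v \<in> supp ?g"
              then have "v \<in> (+) (0, b) ` supp (f i)" by (rule subsetD[OF supp_single_mult])
              then show "fst v \<le> t" using f(3)[OF it] by auto
            qed (use h(2) in blast)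
          qed
          ultimately show ?thesis using 1 hg by blast
        qed
        then obtain p where p: "h - ?g = (\<Sum>j\<le>t. ypoly (p j) * f j)" ..
        have "?g = (\<Sum>j\<le>t. if j = i then ypoly (Polynomial.monom c b) * f j else 0)"
          using it by (simp add: sum.delta ypoly_monom)
        then have "h = (\<Sum>j\<le>t. ypoly (p j) * f j + (if j = i then ypoly (Polynomial.monom c b) * f j else 0))"
          using p by (simp add: sum.distrib algebra_simps)
        also have "\<dots> = (\<Sum>j\<le>t. ypoly (p j + (if j = i then Polynomial.monom c b else 0)) * f j)"
          by (intro sum.cong) (auto simp: ypoly_add distrib_right)
        finally show ?thesis
          by (rule exI[of _ "\<lambda>j. p j + (if j = i then Polynomial.monom c b else 0)"])
      qed
    qed
  qed
  moreover have "\<exists>u. \<forall>v\<in>supp h. v = u \<or> drl_less v u"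
    using drl_max[of "supp h"] by (cases "supp h = {}") auto
  ultimately show ?thesis using h by blast
qed

text \<open>Every monomial in M is uniquely of the form s L i, where i = t - a for x-exponent a (truncated to 0 for
a > t). The corresponding multiples \<open>gen u\<close> of the f i span a space J which is closed
under multiplication by y trivially and by x because of the relations; so J contains the ideal
generated by f. The leading monomials of the \<open>gen u\<close> are distinct and exhaust M.\<close>

lemma family_ideal:
  fixes f :: "nat \<Rightarrow> 'k::field poly2"
  assumes f: "lead_family f"
    and rel: "\<And>i. 1 \<le> i \<Longrightarrow> i \<le> t \<Longrightarrow> monomial (1, 0) * f i = (\<Sum>j\<le>t. ypoly (C i j) * f j)"
  shows "lead_mons (ideal_gen (f ` {..t})) = M"
proof -
  interpret vs: vector_space "poly_scale :: 'k \<Rightarrow> 'k poly2 \<Rightarrow> 'k poly2" by (rule vector_space_poly_scale)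
  define gen where "gen u = monomial (u - L (t - fst u)) * f (t - fst u)" for u
  define J where "J = vs.span (gen ` M)"
  have genI: "gen u \<in> J" if "u \<in> M" for u unfolding J_def by (rule vs.span_base) (use that in blast)
  have scale: "Poly_Mapping.single (0, 0) c * h \<in> J" if "h \<in> J" for c h
    using vs.span_scale[of h "gen ` M" c] that by (simp add: J_def poly_scale_def)
  have addJ: "h + h' \<in> J" if "h \<in> J" "h' \<in> J" for h h'
    using that vs.span_add by (simp add: J_def)
  have zeroJ: "0 \<in> J" using vs.span_zero by (simp add: J_def)
  have sumJ: "(\<Sum>a\<in>A. h a) \<in> J" if "\<And>a. a \<in> A \<Longrightarrow> h a \<in> J" for A :: "nat set" and h
    unfolding J_def by (rule vs.span_sum) (use that in \<open>simp add: J_def\<close>)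
  have yb: "Poly_Mapping.single (0, b) c * f j \<in> J" if j: "j \<le> t" for b c j
  proof -
    have "(0, b) + L j \<in> M" using L_in_M[OF j] by (auto simp: M_def intro: mon_dvd_trans[OF _ mon_dvd_add])
    then have "gen ((0, b) + L j) \<in> J" by (rule genI)
    moreover have "gen ((0, b) + L j) = monomial (0, b) * f j"
      using j by (simp add: gen_def L_def)
    ultimately have "Poly_Mapping.single (0, 0) c * (monomial (0, b) * f j) \<in> J" using scale by simp
    then show ?thesis by (simp add: mult_single mult.assoc[symmetric])
  qed
  have yJ: "ypoly p * f j \<in> J" if "j \<le> t" for p j
    unfolding ypoly_def sum_distrib_right by (intro sumJ yb that)
  have ymul: "monomial (0, 1) * gen u = gen ((0, 1) + u)" if "u \<in> M" for u
  proof -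
    have "(0, 1) + (u - L (t - fst u)) = (0, 1) + u - L (t - fst u)"
      using that by (cases u) (auto simp: M_iff L_def)
    then show ?thesis by (simp add: gen_def mult_single mult.assoc[symmetric])
  qed
  have xmul: "monomial (1, 0) * gen u \<in> J" if u: "u \<in> M" for u
  proof (cases "t \<le> fst u")
    case True
    have "(1, 0) + u \<in> M" using u by (auto simp: M_def intro: mon_dvd_trans[OF _ mon_dvd_add])
    moreover have "(1, 0) + (u - L 0) = (1, 0) + u - L 0"
      using True u by (cases u) (auto simp: M_iff L_def m_0)
    then have "monomial (1, 0) * gen u = gen ((1, 0) + u)"
      using True by (simp add: gen_def mult_single mult.assoc[symmetric])
    ultimately show ?thesis using genI by simp
  next
    case False
    define i where "i = t - fst u"
    have i: "1 \<le> i" "i \<le> t" using False by (auto simp: i_def)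
    define b where "b = snd u - m i"
    have ub: "u - L i = (0, b)" using False by (cases u) (auto simp: L_def i_def b_def)
    have "gen u = monomial (0, b) * f i" by (simp add: gen_def i_def[symmetric] ub)
    then have "monomial (1, 0) * gen u = monomial (0, b) * (monomial (1, 0) * f i)"
      by (simp add: mult.left_commute)
    also have "\<dots> = (\<Sum>j\<le>t. ypoly (Polynomial.monom 1 b * C i j) * f j)"
      unfolding rel[OF i] by (simp add: sum_distrib_left ypoly_mult ypoly_monom mult.assoc)
    also have "\<dots> \<in> J" by (intro sumJ yJ) auto
    finally show ?thesis .
  qed
  have mulJ: "monomial s * h \<in> J" if s: "\<And>u. u \<in> M \<Longrightarrow> monomial s * gen u \<in> J" and h: "h \<in> J" for s h
    using h unfolding J_def
  proof (induction rule: vs.span_induct_alt)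
    case base
    show ?case using zeroJ by (simp add: J_def)
  next
    case (step c g y)
    then obtain u where "u \<in> M" "g = gen u" by blast
    then have "Poly_Mapping.single (0, 0) c * (monomial s * g) \<in> J" using s scale by blast
    moreover have "monomial s * (poly_scale c g + y) = Poly_Mapping.single (0, 0) c * (monomial s * g) + monomial s * y"
      by (simp add: poly_scale_def algebra_simps)
    ultimately show ?case using step.IH addJ by (simp add: J_def)
  qed
  have xJ: "monomial (1, 0) * h \<in> J" if "h \<in> J" for h by (rule mulJ[OF xmul that])
  have yJ': "monomial (0, 1) * h \<in> J" if "h \<in> J" for h
  proof (rule mulJ[OF _ that])
    fix u assume "u \<in> M"
    moreover from this have "(0, 1) + u \<in> M" by (auto simp: M_def intro: mon_dvd_trans[OF _ mon_dvd_add])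
    ultimately show "monomial (0, 1) * gen u \<in> J" using ymul genI by simp
  qed
  have monJ: "monomial (a, b) * h \<in> J" if "h \<in> J" for a b h
  proof (induction a)
    case 0
    show ?case
    proof (induction b)
      case 0
      show ?case using that by (simp add: zero_prod_def[symmetric])
    next
      case (Suc b)
      have "monomial (0, Suc b) * h = monomial (0, 1) * (monomial (0, b) * h)"
        by (simp add: mult_single mult.assoc[symmetric])
      then show ?case using yJ'[OF Suc] by simp
    qed
  next
    case (Suc a)
    have "monomial (Suc a, b) * h = monomial (1, 0) * (monomial (a, b) * h)"
      by (simp add: mult_single mult.assoc[symmetric])
    then show ?case using xJ[OF Suc] by simp
  qed
  have idJ: "is_ideal J"
    unfolding ideal_iff
  proof (intro conjI ballI allI)
    fix r h assume h: "h \<in> J"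
    have trm: "Poly_Mapping.single u (cf r u) * h \<in> J" for u
    proof -
      have "Poly_Mapping.single (0, 0) (cf r u) * (monomial (fst u, snd u) * h) \<in> J"
        using scale monJ h by blast
      then show ?thesis by (simp add: mult_single mult.assoc[symmetric] zero_prod_def[symmetric])
    qed
    have "(\<Sum>u\<in>supp r. Poly_Mapping.single u (cf r u) * h) \<in> J"
      unfolding J_def by (rule vs.span_sum) (use trm in \<open>simp add: J_def\<close>)
    then show "r * h \<in> J"
      by (subst poly2_eq_sum[of r]) (simp only: sum_distrib_right)
  qed (use zeroJ addJ in auto)
  have gen_lead: "is_lead (gen u) u" if u: "u \<in> M" for u
  proof -
    have "is_lead (gen u) (u - L (t - fst u) + L (t - fst u))"
      unfolding gen_def by (rule is_lead_single_mult) (use f in \<open>auto simp: lead_family_def\<close>)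
    moreover have "u - L (t - fst u) + L (t - fst u) = u" using u by (cases u) (auto simp: M_iff L_def)
    ultimately show ?thesis by simp
  qed
  have "lead_mons (ideal_gen (f ` {..t})) \<subseteq> M"
  proof
    fix w assume "w \<in> lead_mons (ideal_gen (f ` {..t}))"
    then obtain h where h: "h \<in> ideal_gen (f ` {..t})" "is_lead h w" by (auto simp: lead_mons_def)
    have "f j \<in> J" if "j \<le> t" for j using yJ[OF that, of 1] by simp
    then have "f ` {..t} \<subseteq> J" by auto
    from ideal_gen_least[OF this idJ] have "h \<in> J" using h(1) by (rule subsetD)
    then obtain T r where T: "finite T" "T \<subseteq> gen ` M" "h = (\<Sum>a\<in>T. poly_scale (r a) a)"
      unfolding J_def vs.span_explicit by blast
    define T' where "T' = {a\<in>T. r a \<noteq> 0}"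
    have hT': "h = (\<Sum>a\<in>T'. poly_scale (r a) a)"
      unfolding T'_def T(3) using T(1) by (intro sum.mono_neutral_right) (auto simp: poly_scale_def)
    have "h \<noteq> 0" using h(2) by (rule is_lead_nonzero)
    then have ne: "T' \<noteq> {}" using hT' by auto
    have leadT: "is_lead a (lead_mon a)" "lead_mon a \<in> M" "a = gen (lead_mon a)" if "a \<in> T'" for a
      using that T(2) gen_lead lead_mon_eq[OF gen_lead] by (auto simp: T'_def)
    have "inj_on lead_mon T'" by (rule inj_onI) (metis leadT(3))
    moreover have "is_lead (poly_scale (r a) a) (lead_mon a)" if "a \<in> T'" for a
      using is_lead_single_mult[OF leadT(1)[OF that], of "r a" "(0, 0)"] that
      by (simp add: poly_scale_def T'_def zero_prod_def[symmetric])
    ultimately obtain a where "a \<in> T'" "is_lead h (lead_mon a)"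
      using is_lead_sum_distinct[of T' "\<lambda>a. poly_scale (r a) a" lead_mon] ne T(1) hT'
      by (auto simp: T'_def)
    then show "w \<in> M" using is_lead_unique[OF h(2)] leadT(2) by metis
  qed
  moreover have "M \<subseteq> lead_mons (ideal_gen (f ` {..t}))"
  proof
    fix w assume w: "w \<in> M"
    have "f (t - fst w) \<in> ideal_gen (f ` {..t})" using ideal_gen_superset[of "f ` {..t}"] by auto
    then have "gen w \<in> ideal_gen (f ` {..t})"
      unfolding gen_def by (intro ideal_mult ideal_gen_ideal)
    then show "w \<in> lead_mons (ideal_gen (f ` {..t}))" using gen_lead[OF w] by (auto simp: lead_mons_def)
  qed
  ultimately show ?thesis by blast
qed

end

section \<open>Hilbert-Burch matrices and their minors\<close>

definition polyfun2 :: "'x set \<Rightarrow> ('i \<Rightarrow> 'x \<Rightarrow> 'k::field) \<Rightarrow> ('x \<Rightarrow> 'k poly2) \<Rightarrow> bool" where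
  "polyfun2 U \<gamma> F \<longleftrightarrow> (\<forall>s. polyfun_on U \<gamma> (\<lambda>x. cf (F x) s))"

lemma polyfun2D: "polyfun2 U \<gamma> F \<Longrightarrow> polyfun_on U \<gamma> (\<lambda>x. cf (F x) s)"
  unfolding polyfun2_def by (rule spec)

lemma polyfun2_const: "polyfun2 U \<gamma> (\<lambda>_. f)"
  by (simp add: polyfun2_def polyfun_on.const)

lemma polyfun2_diff: "polyfun2 U \<gamma> F \<Longrightarrow> polyfun2 U \<gamma> G \<Longrightarrow> polyfun2 U \<gamma> (\<lambda>x. F x - G x)"
  by (simp add: polyfun2_def lookup_minus polyfun_on_diff)

lemma polyfun2_mult:
  assumes "polyfun2 U \<gamma> F" "polyfun2 U \<gamma> G" shows "polyfun2 U \<gamma> (\<lambda>x. F x * G x)"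
  unfolding polyfun2_def cf_mult
proof (rule allI, rule polyfun_on_sum)
  fix s u
  show "polyfun_on U \<gamma> (\<lambda>x. cf (F x) u * cf (G x) (s - u))"
    by (intro polyfun_on.mult polyfun2D assms)
qed

lemma polyfun2_sum:
  assumes "\<And>j. j \<in> J \<Longrightarrow> polyfun2 U \<gamma> (F j)" shows "polyfun2 U \<gamma> (\<lambda>x. \<Sum>j\<in>J. F j x)"
  unfolding polyfun2_def lookup_sum
  by (intro allI polyfun_on_sum polyfun2D assms)

lemma polyfun2_prod:
  assumes "\<And>j. j \<in> J \<Longrightarrow> polyfun2 U \<gamma> (F j)" shows "polyfun2 U \<gamma> (\<lambda>x. \<Prod>j\<in>J. F j x)"
  using assms
proof (induction J rule: infinite_finite_induct)
  case (insert j J)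
  have "polyfun2 U \<gamma> (\<lambda>x. F j x * (\<Prod>j\<in>J. F j x))"
    by (rule polyfun2_mult) (use insert in simp_all)
  then show ?case using insert.hyps by simp
qed (simp_all add: polyfun2_const)

lemma polyfun2_ypoly:
  assumes "\<And>b. polyfun_on U \<gamma> (\<lambda>x. Polynomial.coeff (p x) b)"
  shows "polyfun2 U \<gamma> (\<lambda>x. ypoly (p x))"
  unfolding polyfun2_def
proof
  fix s :: mon
  obtain a b where s: "s = (a, b)" by (cases s)
  show "polyfun_on U \<gamma> (\<lambda>x. cf (ypoly (p x)) s)"
    unfolding s cf_ypoly using assms by (cases "a = 0") (simp_all add: polyfun_on.const)
qed

lemma supp_prod:
  assumes "finite R" "v \<in> supp (\<Prod>r\<in>R. g r)"
  shows "\<exists>\<phi>. v = (\<Sum>r\<in>R. \<phi> r) \<and> (\<forall>r\<in>R. \<phi> r \<in> supp (g r))"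
  using assms
proof (induction R arbitrary: v rule: finite_induct)
  case empty
  then show ?case by (auto simp: zero_prod_def)
next
  case (insert r R)
  then have "v \<in> supp (g r * (\<Prod>r\<in>R. g r))" by simp
  then obtain a b where ab: "v = a + b" "a \<in> supp (g r)" "b \<in> supp (\<Prod>r\<in>R. g r)"
    using keys_mult[of "g r"] by blast
  then obtain \<phi> where \<phi>: "b = (\<Sum>r\<in>R. \<phi> r)" "\<forall>r\<in>R. \<phi> r \<in> supp (g r)" using insert.IH by blast
  have "(\<Sum>i\<in>R. (\<phi>(r := a)) i) = (\<Sum>i\<in>R. \<phi> i)"
    by (rule sum.cong) (use insert.hyps in auto)
  then have "v = (\<Sum>i\<in>insert r R. (\<phi>(r := a)) i)"
    using insert.hyps ab \<phi> by simp
  moreover have "\<forall>i\<in>insert r R. (\<phi>(r := a)) i \<in> supp (g i)" using ab \<phi> by simp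
  ultimately show ?case by blast
qed

lemma is_lead_prod:
  assumes "finite R" "\<And>r. r \<in> R \<Longrightarrow> is_lead (g r) (u r)"
  shows "is_lead (\<Prod>r\<in>R. g r) (\<Sum>r\<in>R. u r) \<and> cf (\<Prod>r\<in>R. g r) (\<Sum>r\<in>R. u r) = (\<Prod>r\<in>R. cf (g r) (u r))"
  using assms
proof (induction R rule: finite_induct)
  case empty
  then show ?case by (auto simp: is_lead_def)
next
  case (insert r R)
  then have IH: "is_lead (\<Prod>r\<in>R. g r) (\<Sum>r\<in>R. u r)"
    "cf (\<Prod>r\<in>R. g r) (\<Sum>r\<in>R. u r) = (\<Prod>r\<in>R. cf (g r) (u r))" by auto
  have "is_lead (g r) (u r)" using insert.prems by simp
  from is_lead_mult[OF this IH(1)] IH(2) insert.hyps show ?case by simp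
qed

context staircase begin

text \<open>The index bound: \<open>y\<^sup>b L j\<close> is smaller than \<open>x L i\<close>. Exactly these terms may occur in the relation
for x f i besides its leading term.\<close>

definition bnd :: "nat \<Rightarrow> nat \<Rightarrow> nat \<Rightarrow> bool" where
  "bnd i j b \<longleftrightarrow> b * B + wL j < B + 1 + wL i"

definition bounded :: "(nat \<Rightarrow> nat \<Rightarrow> 'k::field poly) \<Rightarrow> bool" where
  "bounded c \<longleftrightarrow> (\<forall>i j b. 1 \<le> i \<longrightarrow> i \<le> t \<longrightarrow> j \<le> t \<longrightarrow> Polynomial.coeff (c i j) b \<noteq> 0 \<longrightarrow> bnd i j b)"

text \<open>The relations between the monomials L i themselves: x L i = y^(d i) L (i-1).\<close>

definition YM :: "nat \<Rightarrow> nat \<Rightarrow> 'k::field poly" where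
  "YM i j = (if Suc j = i then Polynomial.monom 1 (d i) else 0)"

definition rel_entry :: "(nat \<Rightarrow> nat \<Rightarrow> 'k::field poly) \<Rightarrow> nat \<Rightarrow> nat \<Rightarrow> 'k poly2" where
  "rel_entry c i j = (if j = i then monomial (1, 0) else 0) - ypoly (YM i j + c i j)"

definition col :: "nat \<Rightarrow> nat \<Rightarrow> nat" where "col k s = (if s < k then s else Suc s)"

definition submat :: "(nat \<Rightarrow> nat \<Rightarrow> 'k::field poly) \<Rightarrow> nat \<Rightarrow> 'k poly2 Matrix.mat" where
  "submat c k = Matrix.mat t t (\<lambda>(r, s). rel_entry c (Suc r) (col k s))"

definition minor :: "(nat \<Rightarrow> nat \<Rightarrow> 'k::field poly) \<Rightarrow> nat \<Rightarrow> 'k poly2" where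
  "minor c k = (-1) ^ k * Determinant.det (submat c k)"

definition minor_term :: "(nat \<Rightarrow> nat \<Rightarrow> 'k::field poly) \<Rightarrow> nat \<Rightarrow> (nat \<Rightarrow> nat) \<Rightarrow> 'k poly2" where
  "minor_term c k p = (\<Prod>r\<in>{0..<t}. rel_entry c (Suc r) (col k (p r)))"

text \<open>The Leibniz expansion, whose terms can be compared in weight one permutation at a time.\<close>

lemma minor_expand:
  "minor c k = (\<Sum>p | p permutes {0..<t}. (-1) ^ k * signof p * minor_term c k p)"
proof -
  have "(\<Prod>r = 0..<t. submat c k $$ (r, p r)) = minor_term c k p" if "p permutes {0..<t}" for p
    unfolding minor_term_def
  proof (rule prod.cong)
    fix r assume r: "r \<in> {0..<t}"
    then have "p r < t" using permutes_in_image[OF that, of r] by simp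
    then show "submat c k $$ (r, p r) = rel_entry c (Suc r) (col k (p r))" using r by (simp add: submat_def)
  qed simp
  then have "Determinant.det (submat c k) = (\<Sum>p | p permutes {0..<t}. signof p * minor_term c k p)"
    by (subst det_def'[of _ t]) (auto simp: submat_def intro!: sum.cong)
  then show ?thesis by (simp add: minor_def sum_distrib_left mult.assoc)
qed

text \<open>Expand a determinant with two equal rows: the i-th row of the matrix of relations is repeated on
top.\<close>

lemma minor_relation:
  assumes i: "1 \<le> i" "i \<le> t"
  shows "(\<Sum>j\<le>t. rel_entry c i j * minor c j) = 0"
proof -
  define N where "N = Matrix.mat (Suc t) (Suc t) (\<lambda>(r, j). if r = 0 then rel_entry c i j else rel_entry c r j)"
  have N: "N \<in> carrier_mat (Suc t) (Suc t)" by (simp add: N_def)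
  have "Determinant.det N = 0"
    by (rule det_identical_rows[OF N, of 0 i]) (use i in \<open>auto simp: N_def intro!: eq_vecI\<close>)
  moreover have "Determinant.det N = (\<Sum>j<Suc t. N $$ (0, j) * cofactor N 0 j)"
    by (rule laplace_expansion_row[OF N]) simp
  moreover have "N $$ (0, j) * cofactor N 0 j = rel_entry c i j * minor c j" if "j < Suc t" for j
  proof -
    have "mat_delete N 0 j = submat c j"
      by (rule eq_matI) (use that in \<open>auto simp: mat_delete_def N_def submat_def col_def\<close>)
    then show ?thesis using that by (simp add: cofactor_def minor_def N_def)
  qed
  ultimately show ?thesis by (simp add: lessThan_Suc_atMost)
qed

lemma rel_entry_relation:
  "(\<Sum>j\<le>t. rel_entry c i j * f j) = 0 \<longleftrightarrow> monomial (1, 0) * f i = (\<Sum>j\<le>t. ypoly (YM i j + c i j) * f j)"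
  if "i \<le> t" for f :: "nat \<Rightarrow> 'k::field poly2"
proof -
  have "(\<Sum>j\<le>t. rel_entry c i j * f j) = (\<Sum>j\<le>t. (if j = i then monomial (1, 0) * f j else 0) - ypoly (YM i j + c i j) * f j)"
    by (intro sum.cong) (auto simp: rel_entry_def left_diff_distrib)
  also have "\<dots> = monomial (1, 0) * f i - (\<Sum>j\<le>t. ypoly (YM i j + c i j) * f j)"
    using that by (simp add: sum_subtractf sum.delta)
  finally show ?thesis by simp
qed

lemma supp_rel_entry:
  fixes c :: "nat \<Rightarrow> nat \<Rightarrow> 'k::field poly"
  assumes c: "bounded c" and i: "1 \<le> i" "i \<le> t" "j \<le> t" and v: "v \<in> supp (rel_entry c i j)"
  shows "wt v + wL j \<le> B + 1 + wL i" "j \<noteq> i \<Longrightarrow> Suc j \<noteq> i \<Longrightarrow> wt v + wL j < B + 1 + wL i"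
    "fst v \<le> (if j = i then 1 else 0)"
proof -
  obtain a b where ab: "v = (a, b)" by (cases v)
  have ne: "cf (rel_entry c i j) v \<noteq> 0" using v by (simp add: in_keys_iff)
  have "cf (rel_entry c i j) v = (if j = i \<and> v = (1, 0) then 1 else 0) -
      (if a = 0 then Polynomial.coeff (YM i j :: 'k poly) b + Polynomial.coeff (c i j) b else 0)"
    by (auto simp: rel_entry_def ab lookup_minus cf_ypoly lookup_single when_def)
  with ne consider "j = i" "v = (1, 0)" | "a = 0" "Polynomial.coeff (YM i j :: 'k poly) b \<noteq> 0" | "a = 0" "Polynomial.coeff (c i j) b \<noteq> 0"
    by (cases "Polynomial.coeff (YM i j :: 'k poly) b = 0"; cases "Polynomial.coeff (c i j) b = 0")
      (auto split: if_splits)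
  then have "(wt v + wL j < B + 1 + wL i \<or> (wt v + wL j = B + 1 + wL i \<and> (j = i \<or> Suc j = i))) \<and> fst v \<le> (if j = i then 1 else 0)"
  proof cases
    case 2
    then have j: "Suc j = i" "b = d i" by (auto simp: YM_def split: if_splits)
    then have "i - 1 = j" by simp
    then show ?thesis using 2 j wL_step[OF i(1,2)] by (simp add: ab)
  next
    case 3
    then have "bnd i j b" using c i unfolding bounded_def by blast
    then show ?thesis using 3 by (simp add: ab bnd_def)
  qed auto
  then show "wt v + wL j \<le> B + 1 + wL i" "j \<noteq> i \<Longrightarrow> Suc j \<noteq> i \<Longrightarrow> wt v + wL j < B + 1 + wL i"
    "fst v \<le> (if j = i then 1 else 0)" by auto
qed

lemma sum_col: "k \<le> t \<Longrightarrow> (\<Sum>s<t. g (col k s)) + g k = (\<Sum>j\<le>t. (g j :: nat))"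
proof -
  assume k: "k \<le> t"
  have inj: "inj_on (col k) {..<t}" by (auto simp: inj_on_def col_def split: if_splits)
  have "col k ` {..<t} = {..t} - {k}"
  proof (intro equalityI subsetI)
    fix j assume j: "j \<in> {..t} - {k}"
    then have "j = col k (if j < k then j else j - 1)" "(if j < k then j else j - 1) < t"
      using k by (auto simp: col_def)
    then show "j \<in> col k ` {..<t}" by blast
  qed (use k in \<open>auto simp: col_def split: if_splits\<close>)
  then have "(\<Sum>s<t. g (col k s)) = (\<Sum>j\<in>{..t} - {k}. g j)"
    using sum.reindex[OF inj, of g] by simp
  then show ?thesis using k sum.remove[of "{..t}" k g] by simp
qed

lemma wt_sum: "finite R \<Longrightarrow> wt (\<Sum>r\<in>R. \<phi> r) = (\<Sum>r\<in>R. wt (\<phi> r))"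
  by (induction R rule: finite_induct) (simp_all add: wt_add zero_prod_def)

lemma col_le: "s < t \<Longrightarrow> col k s \<le> t" by (simp add: col_def)

text \<open>Row i, column j of the matrix has weight at most B + 1 + wL i - wL j, with equality only on the
two diagonals j = i and j = i - 1. Summed over all rows these bounds give wL k, independently of the
permutation; and a permutation that uses only the two diagonals is the identity, since after removal
of column k it must follow the lower diagonal before k and the upper one from k on. The bound
on the x-exponent for k > 0 holds because the entry x of row k has been removed.\<close>

lemma supp_minor_term:
  assumes c: "bounded c" and k: "k \<le> t" and p: "p permutes {0..<t}" and v: "v \<in> supp (minor_term c k p)"
  shows "wt v \<le> wL k" "p \<noteq> id \<Longrightarrow> wt v < wL k" "fst v \<le> (if k = 0 then t else t - 1)"
proof -
  obtain \<phi> where \<phi>: "v = (\<Sum>r\<in>{0..<t}. \<phi> r)" "\<forall>r\<in>{0..<t}. \<phi> r \<in> supp (rel_entry c (Suc r) (col k (p r)))"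
    using supp_prod[OF _ v[unfolded minor_term_def]] by auto
  have pt: "p r < t" if "r < t" for r using permutes_in_image[OF p, of r] that by simp
  have e: "wt (\<phi> r) + wL (col k (p r)) \<le> B + 1 + wL (Suc r)"
    "col k (p r) \<noteq> Suc r \<Longrightarrow> col k (p r) \<noteq> r \<Longrightarrow> wt (\<phi> r) + wL (col k (p r)) < B + 1 + wL (Suc r)"
    "fst (\<phi> r) \<le> (if col k (p r) = Suc r then 1 else 0)" if r: "r < t" for r
    using supp_rel_entry[OF c _ _ col_le[OF pt[OF r]], of "Suc r" "\<phi> r" k] r \<phi>(2) by auto
  have perm: "(\<Sum>r<t. wL (col k (p r))) = (\<Sum>r<t. wL (col k r))"
    using sum.permute[OF p, of "\<lambda>r. wL (col k r)"] by (simp add: atLeast0LessThan comp_def)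
  have shift: "(\<Sum>r<t. wL (Suc r)) + wL 0 = (\<Sum>j\<le>t. wL j)"
    using sum.atMost_shift[of wL t] by simp
  have "(\<Sum>r<t. wt (\<phi> r)) + wL 0 + wL k + (\<Sum>r<t. wL (col k (p r))) = (\<Sum>r<t. wt (\<phi> r)) + wL 0 + (\<Sum>j\<le>t. wL j)"
    using sum_col[OF k, of wL] perm by simp
  then have L: "(\<Sum>r<t. wt (\<phi> r) + wL (col k (p r))) + wL k = wt v + (\<Sum>j\<le>t. wL j)"
    using \<phi>(1) by (simp add: wt_sum sum.distrib atLeast0LessThan)
  have R: "(\<Sum>r<t. B + 1 + wL (Suc r)) = (\<Sum>j\<le>t. wL j)"
    unfolding sum.distrib using shift by (simp add: wL_0 algebra_simps)
  have "(\<Sum>r<t. wt (\<phi> r) + wL (col k (p r))) \<le> (\<Sum>r<t. B + 1 + wL (Suc r))"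
    by (rule sum_mono) (use e(1) in simp)
  then show "wt v \<le> wL k" using L R by linarith
  show "wt v < wL k" if "p \<noteq> id"
  proof -
    have "\<exists>r<t. col k (p r) \<noteq> Suc r \<and> col k (p r) \<noteq> r"
    proof (rule ccontr)
      assume "\<not> (\<exists>r<t. col k (p r) \<noteq> Suc r \<and> col k (p r) \<noteq> r)"
      then have near: "col k (p r) = Suc r \<or> col k (p r) = r" if "r < t" for r using that by blast
      have fixed: "p r = r" if "r < t" for r
        using that
      proof (induction r rule: less_induct)
        case (less r)
        have "\<not> p r < r"
        proof
          assume *: "p r < r"
          then have "p (p r) = p r" using less by simp
          then have "p r = r" using permutes_inj[OF p] by (auto dest: injD)
          then show False using * by simp
        qed
        then consider "p r = r" | "p r = Suc r" "Suc r < k"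
          using near[OF less.prems] by (auto simp: col_def split: if_splits)
        then show ?case
        proof cases
          case 2
          \<comment> \<open>The smallest moved index r would be moved upwards, and its preimage s would be an index above r
            that lies too far from the diagonals.\<close>
          obtain s where s: "p s = r" using permutes_surj[OF p] by (metis surjD)
          have "s < t" using s less.prems permutes_in_image[OF p, of s] by simp
          have "s \<noteq> r" using s 2 by auto
          moreover have "\<not> s < r" using less.IH[of s] s \<open>s < t\<close> by auto
          ultimately have "s > r" by simp
          then show ?thesis using near[OF \<open>s < t\<close>] s 2 by (simp add: col_def)
        qed simp
      qed
      have "p = id"
      proof
        fix r show "p r = id r" using fixed[of r] permutes_not_in[OF p, of r] by (cases "r < t") auto
      qed
      then show False using that by simp
    qed
    then obtain r where r: "r < t" "col k (p r) \<noteq> Suc r" "col k (p r) \<noteq> r" by blast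
    have "(\<Sum>r<t. wt (\<phi> r) + wL (col k (p r))) < (\<Sum>r<t. B + 1 + wL (Suc r))"
      by (rule sum_strict_mono_ex1) (use e(1) e(2)[OF r] r in auto)
    then show "wt v < wL k" using L R by linarith
  qed
  have fv: "fst v = (\<Sum>r<t. fst (\<phi> r))" using \<phi>(1) by (simp add: fst_sum atLeast0LessThan)
  show "fst v \<le> (if k = 0 then t else t - 1)"
  proof (cases "k = 0")
    case True
    have "(\<Sum>r<t. fst (\<phi> r)) \<le> (\<Sum>r<t. 1)" by (rule sum_mono) (use e(3) in \<open>fastforce split: if_splits\<close>)
    then show ?thesis using fv True by simp
  next
    case False
    have kc: "col k s \<noteq> k" for s by (simp add: col_def)
    have "(\<Sum>r<t. fst (\<phi> r)) \<le> (\<Sum>r<t. if r = k - 1 then 0 else 1)"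
    proof (rule sum_mono)
      fix r assume "r \<in> {..<t}"
      then have "fst (\<phi> r) \<le> (if col k (p r) = Suc r then 1 else 0)" using e(3) by simp
      then show "fst (\<phi> r) \<le> (if r = k - 1 then 0 else 1)" using kc[of "p r"] False by (auto split: if_splits)
    qed
    also have "\<dots> = card ({..<t} - {k - 1})"
      by (simp add: sum.If_cases Collect_neg_eq Diff_eq)
    also have "\<dots> = t - 1" using False k by (simp add: card_Diff_singleton_if)
    finally show ?thesis using fv False by simp
  qed
qed

text \<open>The product over the diagonal has a factor - y^(d i) for each of the k rows i \<le> k and a factor x
for the others, up to smaller terms.\<close>

lemma lead_minor_term_id:
  fixes c :: "nat \<Rightarrow> nat \<Rightarrow> 'k::field poly"
  assumes c: "bounded c" and k: "k \<le> t"
  shows "is_lead (minor_term c k id) (L k)" "cf (minor_term c k id) (L k) = (-1) ^ k"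
proof -
  let ?u = "\<lambda>r. if r < k then (0, d (Suc r)) else (1, 0 :: nat)"
  let ?e = "\<lambda>r. rel_entry c (Suc r) (col k (id r))"
  have e: "is_lead (?e r) (?u r) \<and> cf (?e r) (?u r) = (if r < k then -1 else 1)" if r: "r < t" for r
  proof (cases "r < k")
    case True
    have cb: "b < d (Suc r)" if "Polynomial.coeff (c (Suc r) r) b \<noteq> 0" for b
    proof -
      have "bnd (Suc r) r b" using c r that unfolding bounded_def by auto
      moreover have "d (Suc r) * B + wL r = B + 1 + wL (Suc r)" using wL_step[of "Suc r"] r by simp
      ultimately have "b * B < d (Suc r) * B" unfolding bnd_def by linarith
      then show ?thesis by simp
    qed
    have cfe: "cf (?e r) v = (if fst v = 0 then - Polynomial.coeff (YM (Suc r) r + c (Suc r) r) (snd v) else 0)" for v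
      using True by (cases v) (simp add: rel_entry_def col_def cf_ypoly lookup_minus)
    have top: "Polynomial.coeff (c (Suc r) r) (d (Suc r)) = 0" using cb[of "d (Suc r)"] by auto
    have val: "cf (?e r) (0, d (Suc r)) = -1" unfolding cfe using top by (simp add: YM_def)
    moreover have "drl_less v (0, d (Suc r))" if v: "v \<in> supp (?e r)" "v \<noteq> (0, d (Suc r))" for v
    proof -
      have "cf (?e r) v \<noteq> 0" using v(1) unfolding in_keys_iff .
      then have "fst v = 0" "Polynomial.coeff (YM (Suc r) r + c (Suc r) r) (snd v) \<noteq> 0"
        unfolding cfe by (metis neg_equal_0_iff_equal)+
      then obtain b where b: "v = (0, b)" "Polynomial.coeff (YM (Suc r) r + c (Suc r) r) b \<noteq> 0"
        by (cases v) auto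
      then have "Polynomial.coeff (c (Suc r) r) b \<noteq> 0" using v(2) by (auto simp: YM_def split: if_splits)
      then show ?thesis using cb b by simp
    qed
    ultimately show ?thesis using True by (simp add: is_lead_def)
  next
    case False
    have cb: "b \<le> 1" if "Polynomial.coeff (c (Suc r) (Suc r)) b \<noteq> 0" for b
    proof (rule ccontr)
      assume "\<not> b \<le> 1"
      have "bnd (Suc r) (Suc r) b" using c r that unfolding bounded_def by auto
      then have "b * B < B + 1" by (simp add: bnd_def)
      moreover have "2 * B \<le> b * B" using \<open>\<not> b \<le> 1\<close> by (intro mult_le_mono1) simp
      moreover have "B \<ge> 2" by (simp add: B_def)
      ultimately show False by linarith
    qed
    have cfe: "cf (?e r) v = (if v = (1, 0) then 1 else if fst v = 0 then - Polynomial.coeff (c (Suc r) (Suc r)) (snd v) else 0)" for v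
      using False by (cases v) (auto simp: rel_entry_def col_def cf_ypoly lookup_minus YM_def lookup_single when_def)
    have val: "cf (?e r) (1, 0) = 1" unfolding cfe by simp
    moreover have "drl_less v (1, 0)" if v: "v \<in> supp (?e r)" "v \<noteq> (1, 0)" for v
    proof -
      obtain b where b: "v = (0, b)" "Polynomial.coeff (c (Suc r) (Suc r)) b \<noteq> 0"
        using v cfe[of v] by (cases v) (auto simp: in_keys_iff split: if_splits)
      then show ?thesis using cb[of b] by (auto simp: le_Suc_eq)
    qed
    ultimately show ?thesis using False by (simp add: is_lead_def)
  qed
  have sumL: "(\<Sum>r\<in>{0..<t}. ?u r) = L k"
  proof -
    have "(\<Sum>r<j. ?u r) = (j - k, m (min j k))" if "j \<le> t" for j
      using that
    proof (induction j)
      case 0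
      then show ?case by (simp add: zero_prod_def m_0)
    next
      case (Suc j)
      have "m (Suc j) = m j + d (Suc j)" using m_d[of "Suc j"] Suc.prems by simp
      then show ?case using Suc by (auto simp: min_def)
    qed
    from this[of t] show ?thesis using k by (simp add: L_def atLeast0LessThan min_def)
  qed
  have P: "is_lead (\<Prod>r\<in>{0..<t}. ?e r) (\<Sum>r\<in>{0..<t}. ?u r) \<and>
      cf (\<Prod>r\<in>{0..<t}. ?e r) (\<Sum>r\<in>{0..<t}. ?u r) = (\<Prod>r\<in>{0..<t}. cf (?e r) (?u r))"
    by (rule is_lead_prod) (use e in auto)
  then show "is_lead (minor_term c k id) (L k)" unfolding sumL minor_term_def by blast
  have "(\<Prod>r\<in>{0..<t}. cf (?e r) (?u r)) = (\<Prod>r\<in>{0..<t}. if r < k then -1 else 1 :: 'k)"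
    by (rule prod.cong) (use e in auto)
  also have "\<dots> = (\<Prod>r\<in>{0..<k}. -1 :: 'k)"
    by (rule prod.mono_neutral_cong_right) (use k in auto)
  finally show "cf (minor_term c k id) (L k) = (-1) ^ k" using P unfolding sumL minor_term_def by simp
qed

lemma minor_lead:
  fixes c :: "nat \<Rightarrow> nat \<Rightarrow> 'k::field poly"
  assumes c: "bounded c" and k: "k \<le> t"
  shows "cf (minor c k) (L k) = 1" "is_lead (minor c k) (L k)"
    "v \<in> supp (minor c k) \<Longrightarrow> fst v \<le> (if k = 0 then t else t - 1)"
proof -
  let ?P = "{p. p permutes {0..<t}}"
  have sgn: "cf ((-1) ^ k * signof p * f) v = (-1) ^ k * signof p * cf f v"
    for p :: "nat \<Rightarrow> nat" and f :: "'k poly2" and v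
    by (cases "even k"; cases "evenperm p") (auto simp: sign_def)
  have cfm: "cf (minor c k) v = (\<Sum>p\<in>?P. (-1) ^ k * signof p * cf (minor_term c k p) v)" for v
    unfolding minor_expand lookup_sum sgn ..
  have fin: "finite ?P" by (simp add: finite_permutations)
  have "cf (minor_term c k p) (L k) = 0" if "p \<in> ?P - {id}" for p
    using supp_minor_term(2)[OF c k, of p "L k"] that by (auto simp: in_keys_iff)
  then have "cf (minor c k) (L k) = (\<Sum>p\<in>{id}. (-1) ^ k * signof p * cf (minor_term c k p) (L k))"
    unfolding cfm using fin by (intro sum.mono_neutral_right) (auto simp: permutes_id)
  also have "\<dots> = (-1) ^ k * (-1) ^ k" by (simp add: lead_minor_term_id(2)[OF c k])
  also have "\<dots> = 1" by (simp add: power_mult_distrib[symmetric])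
  finally show one: "cf (minor c k) (L k) = 1" .
  have ex: "\<exists>p\<in>?P. v \<in> supp (minor_term c k p)" if v: "v \<in> supp (minor c k)" for v
  proof (rule ccontr)
    assume "\<not> ?thesis"
    then have "cf (minor c k) v = 0" unfolding cfm by (intro sum.neutral) (auto simp: in_keys_iff)
    then show False using v by (simp add: in_keys_iff)
  qed
  show "is_lead (minor c k) (L k)"
  proof (rule wt_lead)
    fix v assume v: "v \<in> supp (minor c k)" "v \<noteq> L k"
    obtain p where p: "p \<in> ?P" "v \<in> supp (minor_term c k p)" using ex v by blast
    show "wt v < wL k"
    proof (cases "p = id")
      case True
      then show ?thesis using lead_wt[OF lead_minor_term_id(1)[OF c k] k] p v by simp
    next
      case False
      then show ?thesis using supp_minor_term(2)[OF c k] p by simp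
    qed
  qed (use one in simp)
  show "fst v \<le> (if k = 0 then t else t - 1)" if v: "v \<in> supp (minor c k)"
  proof -
    obtain p where "p \<in> ?P" "v \<in> supp (minor_term c k p)" using ex v by blast
    then show ?thesis using supp_minor_term(3)[OF c k] by simp
  qed
qed

lemma polyfun2_minor:
  assumes "\<And>i j b. polyfun_on U \<gamma> (\<lambda>x. Polynomial.coeff (c x i j) b)"
  shows "polyfun2 U \<gamma> (\<lambda>x. minor (c x) k)"
  unfolding minor_expand minor_term_def rel_entry_def
  by (intro polyfun2_sum polyfun2_mult polyfun2_prod polyfun2_const polyfun2_diff polyfun2_ypoly)
    (simp add: polyfun_on.add polyfun_on.const assms)

text \<open>Solutions of the relations are rigid: compare the relations in the highest weight, relative to wL i, that
occurs in h. There they reduce to x h i = y^(d i) h (i-1), so the top part of each h i is z L i for one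
common Laurent polynomial z. Since z x^t and z y^(m t) are polynomials, so is z. Hence its weight is at
least 0, while all terms of h i lie below L i.\<close>

lemma kernel_below_zero:
  fixes h :: "nat \<Rightarrow> 'k::field poly2"
  assumes c: "bounded c"
    and low: "\<And>i v. i \<le> t \<Longrightarrow> v \<in> supp (h i) \<Longrightarrow> wt v < wL i"
    and rel: "\<And>i. 1 \<le> i \<Longrightarrow> i \<le> t \<Longrightarrow> monomial (1, 0) * h i = (\<Sum>j\<le>t. ypoly (YM i j + c i j) * h j)"
    and i: "i \<le> t"
  shows "h i = 0"
proof (rule ccontr)
  assume "h i \<noteq> 0"
  define def where "def \<equiv> \<lambda>(i, v). wL i - wt v"
  let ?Z = "\<lambda>(i, v). i \<le> t \<and> v \<in> supp (h i)"
  obtain v where "v \<in> supp (h i)" using \<open>h i \<noteq> 0\<close> by (metis ex_in_conv keys_eq_empty)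
  then have "?Z (i, v)" using i by simp
  then obtain iv where iv: "?Z iv" "\<And>jw. ?Z jw \<Longrightarrow> def iv \<le> def jw"
    using exists_least_lemma[of "\<lambda>n. \<exists>iv. ?Z iv \<and> def iv = n"]
    by (metis (no_types, lifting) ex_has_least_nat)
  \<comment> \<open>The least distance below the leading monomials; it is minus the weight of z.\<close>
  define \<delta> where "\<delta> = def iv"
  have min: "wt w + \<delta> \<le> wL j" if "j \<le> t" "w \<in> supp (h j)" for j w
    using iv(2)[of "(j, w)"] that low[OF that] by (simp add: def_def \<delta>_def)
  have \<delta>0: "\<delta> > 0" using iv(1) low by (cases iv) (auto simp: \<delta>_def def_def)
  have step: "cf (monomial (1, 0) * h i) w = cf (monomial (0, d i) * h (i - 1)) w"
    if i: "1 \<le> i" "i \<le> t" and w: "wt w + \<delta> = B + 1 + wL i" for i w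
  proof -
    obtain w1 w2 where w12: "w = (w1, w2)" by (cases w)
    have c0: "cf (ypoly (c i j) * h j) w = 0" if j: "j \<le> t" for j
      unfolding w12 cf_ypoly_mult
    proof (rule sum.neutral, rule ballI, rule ccontr)
      fix b assume b: "b \<in> {..w2}" "Polynomial.coeff (c i j) b * cf (h j) (w1, w2 - b) \<noteq> 0"
      then have "bnd i j b" using c i j unfolding bounded_def by simp
      moreover have "wt (w1, w2 - b) + \<delta> \<le> wL j"
        by (rule min[OF j]) (use b(2) in \<open>auto simp: in_keys_iff\<close>)
      moreover have "w = (0, b) + (w1, w2 - b)" using b by (simp add: w12)
      then have "wt w = b * B + wt (w1, w2 - b)" by (simp only: wt_add wt_y)
      ultimately show False using w unfolding bnd_def by linarith
    qed
    have "cf (monomial (1, 0) * h i) w = (\<Sum>j\<le>t. cf (ypoly (YM i j) * h j) w)"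
      unfolding rel[OF i] lookup_sum by (rule sum.cong) (use c0 in \<open>auto simp: ypoly_add distrib_right lookup_add\<close>)
    also have "\<dots> = (\<Sum>j\<le>t. if j = i - 1 then cf (monomial (0, d i) * h j) w else 0)"
      by (rule sum.cong) (use i in \<open>auto simp: YM_def ypoly_monom\<close>)
    also have "\<dots> = cf (monomial (0, d i) * h (i - 1)) w" using i by (simp add: sum.delta)
    finally show ?thesis .
  qed
  have down: "\<exists>v0\<in>supp (h 0). wt v0 + \<delta> = wL 0" if "i \<le> t" "v \<in> supp (h i)" "wt v + \<delta> = wL i" for i v
    using that
  proof (induction i arbitrary: v)
    case (Suc i)
    have "cf (monomial (1, 0) * h (Suc i)) ((1, 0) + v) \<noteq> 0"
      using Suc.prems(2) unfolding cf_single_mult_add by (simp add: in_keys_iff)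
    moreover have wv: "wt ((1, 0) + v) + \<delta> = B + 1 + wL (Suc i)"
      unfolding wt_add using Suc.prems(3) by simp
    ultimately have ne: "cf (monomial (0, d (Suc i)) * h i) ((1, 0) + v) \<noteq> 0"
      using step[of "Suc i" "(1, 0) + v"] Suc.prems(1) by simp
    then have dv: "mon_dvd (0, d (Suc i)) ((1, 0) + v)" by (auto simp: cf_single_mult split: if_splits)
    define u where "u = (1, 0) + v - (0, d (Suc i))"
    have u: "(1, 0) + v = (0, d (Suc i)) + u" using dv by (cases v) (auto simp: u_def)
    have "u \<in> supp (h i)" using ne unfolding u cf_single_mult_add by (simp add: in_keys_iff)
    moreover have "d (Suc i) * B + wt u = wt ((1, 0) + v)" unfolding u wt_add wt_y ..
    then have "wt u + \<delta> = wL i" using wv wL_step[of "Suc i"] Suc.prems(1) by simp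
    ultimately show ?case using Suc.IH Suc.prems(1) by simp
  qed blast
  obtain i' v' where iv': "iv = (i', v')" by (cases iv)
  have "i' \<le> t" "v' \<in> supp (h i')" using iv(1) by (simp_all add: iv')
  moreover from low[OF this] have "wt v' + \<delta> = wL i'" by (simp add: \<delta>_def def_def iv')
  ultimately have "\<exists>v0\<in>supp (h 0). wt v0 + \<delta> = wL 0" by (rule down)
  then obtain v0 where v0: "v0 \<in> supp (h 0)" "wt v0 + \<delta> = wL 0" by (rule bexE)
  have up: "i \<le> t \<Longrightarrow> \<exists>v\<in>supp (h i). v0 + (0, m i) = v + (i, 0)" for i
  proof (induction i)
    case 0
    then show ?case using v0 by (auto simp: m_0 zero_prod_def[symmetric])
  next
    case (Suc i)
    then obtain v where v: "v \<in> supp (h i)" "v0 + (0, m i) = v + (i, 0)" by auto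
    have md: "m (Suc i) = m i + d (Suc i)" using m_d[of "Suc i"] Suc.prems by simp
    have "wt v0 + m i * B = wt v + i * (B + 1)" using arg_cong[OF v(2), of wt] unfolding wt_add by simp
    moreover have "wL i + i * (B + 1) = wL 0 + m i * B"
    proof -
      have "L i + (i, 0) = L 0 + (0, m i)" using Suc.prems by (simp add: L_def m_0)
      from arg_cong[OF this, of wt] show ?thesis unfolding wt_add by simp
    qed
    ultimately have wv: "wt v + \<delta> = wL i" using v0(2) by linarith
    let ?w = "(0, d (Suc i)) + v"
    have "wt ?w + \<delta> = B + 1 + wL (Suc i)" unfolding wt_add wt_y using wv wL_step[of "Suc i"] Suc.prems by simp
    moreover have "cf (monomial (0, d (Suc i)) * h i) ?w \<noteq> 0"
      using v(1) unfolding cf_single_mult_add by (simp add: in_keys_iff)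
    ultimately have ne: "cf (monomial (1, 0) * h (Suc i)) ?w \<noteq> 0"
      using step[of "Suc i" ?w] Suc.prems by simp
    then have dv: "mon_dvd (1, 0) ?w" by (auto simp: cf_single_mult split: if_splits)
    define u where "u = ?w - (1, 0)"
    have u: "?w = (1, 0) + u" using dv by (cases v) (auto simp: u_def)
    have "u \<in> supp (h (Suc i))" using ne unfolding u cf_single_mult_add by (simp add: in_keys_iff)
    moreover have "v0 + (0, m (Suc i)) = u + (Suc i, 0)"
      using v(2) u md by (cases v0; cases v; cases u) auto
    ultimately show ?case by blast
  qed
  from up[of t] obtain v where "v0 + (0, m t) = v + (t, 0)" by blast
  then have "t \<le> fst v0" by (cases v0; cases v) auto
  moreover from this have "t * B \<le> fst v0 * B" by (rule mult_le_mono1)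
  moreover have "wt v0 = fst v0 * B + snd v0 * B + fst v0" by (cases v0) (simp add: algebra_simps)
  moreover have "wL 0 = t * B + t" by (simp add: wL_0)
  ultimately have "wL 0 \<le> wt v0" by linarith
  then show False using v0(2) \<delta>0 by simp
qed

end

section \<open>Canonical matrices\<close>

text \<open>The solution is built by recursion along the rank, which the dependency condition makes well founded.\<close>

lemma triangular_solution:
  fixes G :: "('q \<Rightarrow> 'k) \<Rightarrow> 'q \<Rightarrow> 'k" and rank :: "'q \<Rightarrow> nat"
  assumes dep: "\<And>z z' q. (\<And>q'. rank q' < rank q \<Longrightarrow> z q' = z' q') \<Longrightarrow> G z q = G z' q"
  shows "\<exists>z. \<forall>q. z q = G z q" "(\<forall>q. z q = G z q) \<Longrightarrow> (\<forall>q. z' q = G z' q) \<Longrightarrow> z = z'"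
proof -
  have "wfrec (Wellfounded.measure rank) G q = G (wfrec (Wellfounded.measure rank) G) q" for q
  proof -
    have "wfrec (Wellfounded.measure rank) G q = G (cut (wfrec (Wellfounded.measure rank) G) (Wellfounded.measure rank) q) q"
      by (rule wfrec) simp
    also have "\<dots> = G (wfrec (Wellfounded.measure rank) G) q" by (rule dep) (simp add: cut_apply)
    finally show ?thesis .
  qed
  then show "\<exists>z. \<forall>q. z q = G z q" by (intro exI allI)
  assume *: "\<forall>q. z q = G z q" "\<forall>q. z' q = G z' q"
  show "z = z'"
  proof
    fix q show "z q = z' q"
    proof (induction q rule: measure_induct_rule[of rank])
      case (less q)
      have "G z q = G z' q" by (rule dep) (rule less)
      then show ?case using * by metis
    qed
  qed
qed

context staircase begin

definition Q :: "(nat \<times> nat \<times> nat) set" where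
  "Q = {(i, j, b). 1 \<le> i \<and> i \<le> t \<and> j \<le> t \<and> bnd i j b}"

text \<open>To first order, conjugation by 1 + a adds to c i j the multiples y^(d (j+1)) a i (j+1) and
- y^(d i) a (i-1) j. Below the diagonal the first and on or above the diagonal the second is used
to reduce the degree of c i j. Each of these terms affects two neighbouring entries of the same diagonal, so
the diagonals are normalized by increasing i below the main diagonal and by decreasing i elsewhere.\<close>

definition canon :: "nat \<Rightarrow> nat \<Rightarrow> nat \<Rightarrow> bool" where
  "canon i j b \<longleftrightarrow> (if j < i then b < d (Suc j) else b < d i)"

text \<open>The coordinates of the space of canonical matrices.\<close>

definition S :: "(nat \<times> nat \<times> nat) set" where
  "S = {(i, j, b). (i, j, b) \<in> Q \<and> canon i j b}"

lemma bnd_less_B: "i \<le> t \<Longrightarrow> bnd i j b \<Longrightarrow> b < B"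
proof (rule ccontr)
  assume i: "i \<le> t" and b: "bnd i j b" "\<not> b < B"
  have "wL i = (t - i + m i) * B + (t - i)" by (simp add: L_def)
  also have "\<dots> \<le> (t + m t) * B + t" using m_le[OF i] by (intro add_mono mult_le_mono1) auto
  finally have "b * B < B + 1 + ((t + m t) * B + t)" using b(1) unfolding bnd_def by linarith
  moreover have "B * B \<le> b * B" using b(2) by (intro mult_le_mono1) simp
  moreover have "B * B = (t + m t) * B + B + B" by (subst (1) B_def) (simp add: algebra_simps)
  moreover have "B > t + 1" by (simp add: B_def)
  ultimately show False by linarith
qed

lemma finite_Q: "finite Q"
proof (rule finite_subset)
  show "Q \<subseteq> {..t} \<times> {..t} \<times> {..<B}" using bnd_less_B by (auto simp: Q_def)
qed simp

lemma finite_S: "finite S"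
  by (rule finite_subset[OF _ finite_Q]) (auto simp: S_def)

definition mkpoly :: "(nat \<Rightarrow> 'k::field) \<Rightarrow> 'k poly" where
  "mkpoly f = (\<Sum>b<B. Polynomial.monom (f b) b)"

lemma coeff_mkpoly: "Polynomial.coeff (mkpoly f) b = (if b < B then f b else 0)"
  by (simp add: mkpoly_def Polynomial.coeff_sum sum.delta)

text \<open>The weight of the unknown and of the equation with index (i, j, b): how far \<open>y\<^sup>b L j\<close> lies below
\<open>x L i\<close>. The conjugation equations are homogeneous for it.\<close>

definition weight :: "nat \<times> nat \<times> nat \<Rightarrow> nat" where
  "weight = (\<lambda>(i, j, b). B + 1 + wL i - (b * B + wL j))"

text \<open>Order by weight and, within one weight, along the diagonals of the matrix: by increasing i below the main
diagonal, by decreasing i on and above it.\<close>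

definition gauge_rank :: "nat \<times> nat \<times> nat \<Rightarrow> nat" where
  "gauge_rank = (\<lambda>(i, j, b). weight (i, j, b) * (t + 1) + (if j < i then min i t else t - i))"

lemma weight_Q: "(i, j, b) \<in> Q \<Longrightarrow> weight (i, j, b) + b * B + wL j = B + 1 + wL i \<and> weight (i, j, b) > 0"
  by (auto simp: weight_def Q_def bnd_def)

lemma gauge_rank_less: "weight q < weight q' \<Longrightarrow> gauge_rank q < gauge_rank q'"
proof -
  assume "weight q < weight q'"
  then have "Suc (weight q) * (t + 1) \<le> weight q' * (t + 1)" by (intro mult_le_mono1) simp
  then show ?thesis by (cases q; cases q') (auto simp: gauge_rank_def)
qed

text \<open>The coefficients that a unipotent matrix a may have if the leading monomials of (1 + a) f and f are to
agree. Column 0 is excluded: for i \<ge> 1 it would bring x^t into f i.\<close>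

definition conj_valid :: "nat \<Rightarrow> nat \<Rightarrow> nat \<Rightarrow> bool" where
  "conj_valid i j b \<longleftrightarrow> i \<le> t \<and> 1 \<le> j \<and> j \<le> t \<and> j \<noteq> i \<and> b * B + wL j < wL i"

text \<open>The equation that is solved for the coefficient of y^b in a i j.\<close>

definition conj_idx :: "nat \<Rightarrow> nat \<Rightarrow> nat \<Rightarrow> nat \<times> nat \<times> nat" where
  "conj_idx i j b = (if j < i then (i, j - 1, b + d j) else (Suc i, j, b + d (Suc i)))"

text \<open>The unknown z collects the coefficients of two matrices: at indices in S those of the canonical
matrix c, at the other indices in Q those of the unipotent matrix a, with a sign below the diagonal.
Here a is read off.\<close>

definition conj_coeff :: "(nat \<times> nat \<times> nat \<Rightarrow> 'k::field) \<Rightarrow> nat \<Rightarrow> nat \<Rightarrow> nat \<Rightarrow> 'k" where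
  "conj_coeff z i j b = (if conj_valid i j b then (if j < i then - z (conj_idx i j b) else z (conj_idx i j b)) else 0)"

definition form_coeff :: "(nat \<times> nat \<times> nat \<Rightarrow> 'k::field) \<Rightarrow> nat \<Rightarrow> nat \<Rightarrow> nat \<Rightarrow> 'k" where
  "form_coeff z i j b = (if (i, j, b) \<in> S then z (i, j, b) else 0)"

lemma conj_idx_Q:
  assumes "conj_valid i j b"
  shows "conj_idx i j b \<in> Q" "weight (conj_idx i j b) + b * B + wL j = wL i" "conj_idx i j b \<notin> S"
proof -
  have step: "(b + d k) * B + wL (k - 1) = b * B + (B + 1 + wL k)" if "1 \<le> k" "k \<le> t" for k
    using wL_step[OF that] by (simp add: distrib_right)
  have "conj_idx i j b \<in> Q \<and> weight (conj_idx i j b) + b * B + wL j = wL i \<and> conj_idx i j b \<notin> S"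
  proof (cases "j < i")
    case True
    have "(b + d j) * B + wL (j - 1) = b * B + (B + 1 + wL j)"
      using assms by (intro step) (auto simp: conj_valid_def)
    then show ?thesis using True assms
      by (auto simp: conj_idx_def Q_def bnd_def conj_valid_def weight_def S_def canon_def)
  next
    case False
    have "(b + d (Suc i)) * B + wL i = b * B + (B + 1 + wL (Suc i))"
      using assms False step[of "Suc i"] by (auto simp: conj_valid_def)
    then show ?thesis using False assms
      by (auto simp: conj_idx_def Q_def bnd_def conj_valid_def weight_def S_def canon_def)
  qed
  then show "conj_idx i j b \<in> Q" "weight (conj_idx i j b) + b * B + wL j = wL i" "conj_idx i j b \<notin> S" by auto
qed

text \<open>The linear term of the equation that is not its pivot.\<close>

definition shift_term :: "(nat \<times> nat \<times> nat \<Rightarrow> 'k::field) \<Rightarrow> nat \<Rightarrow> nat \<Rightarrow> nat \<Rightarrow> 'k" where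
  "shift_term z i j b = (if j < i then (if d i \<le> b then conj_coeff z (i - 1) j (b - d i) else 0)
     else (if j < t \<and> d (Suc j) \<le> b then - conj_coeff z i (Suc j) (b - d (Suc j)) else 0))"

definition quad_term :: "(nat \<Rightarrow> nat \<Rightarrow> 'k::field poly) \<Rightarrow> (nat \<times> nat \<times> nat \<Rightarrow> 'k) \<Rightarrow> nat \<Rightarrow> nat \<Rightarrow> nat \<Rightarrow> 'k" where
  "quad_term e z i j b = (\<Sum>k\<in>{1..t}. \<Sum>l\<le>b. conj_coeff z i k l * Polynomial.coeff (e k j) (b - l)) -
     (\<Sum>k\<le>t. \<Sum>l\<le>b. form_coeff z i k l * conj_coeff z k j (b - l))"

text \<open>The conjugation equation with index (i, j, b), solved for its pivot.\<close>

definition gauge_map :: "(nat \<Rightarrow> nat \<Rightarrow> 'k::field poly) \<Rightarrow> (nat \<times> nat \<times> nat \<Rightarrow> 'k) \<Rightarrow> nat \<times> nat \<times> nat \<Rightarrow> 'k" where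
  "gauge_map e z = (\<lambda>(i, j, b). if (i, j, b) \<in> Q
     then Polynomial.coeff (e i j) b - shift_term z i j b + quad_term e z i j b else 0)"

lemma conj_idx_shift_lower:
  assumes "(i, j, b) \<in> Q" "j < i" "d i \<le> b" "conj_valid (i - 1) j (b - d i)"
  shows "gauge_rank (conj_idx (i - 1) j (b - d i)) < gauge_rank (i, j, b)"
proof -
  have i: "1 \<le> i" "i \<le> t" using assms(1) by (auto simp: Q_def)
  have ji: "j < i - 1" using assms(2,4) by (auto simp: conj_valid_def)
  have "d i * B + (b - d i) * B = b * B" using assms(3) by (simp add: distrib_right[symmetric])
  then have "weight (conj_idx (i - 1) j (b - d i)) = weight (i, j, b)"
    using conj_idx_Q(2)[OF assms(4)] weight_Q[OF assms(1)] wL_step[OF i] by linarith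
  moreover have "j - 1 < i - 1" "j < i" using ji by linarith+
  ultimately show ?thesis using ji i by (simp add: gauge_rank_def conj_idx_def)
qed

lemma conj_idx_shift_upper:
  assumes "(i, j, b) \<in> Q" "i \<le> j" "j < t" "d (Suc j) \<le> b" "conj_valid i (Suc j) (b - d (Suc j))"
  shows "gauge_rank (conj_idx i (Suc j) (b - d (Suc j))) < gauge_rank (i, j, b)"
proof -
  have "d (Suc j) * B + wL j = B + 1 + wL (Suc j)" using wL_step[of "Suc j"] assms(3) by simp
  moreover have "d (Suc j) * B + (b - d (Suc j)) * B = b * B"
    using assms(4) by (simp add: distrib_right[symmetric])
  ultimately have "weight (conj_idx i (Suc j) (b - d (Suc j))) = weight (i, j, b)"
    using conj_idx_Q(2)[OF assms(5)] weight_Q[OF assms(1)] by linarith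
  then show ?thesis using assms(2,3) by (simp add: gauge_rank_def conj_idx_def)
qed

lemma conj_idx_quad_left:
  assumes "(i, j, b) \<in> Q" "l \<le> b" "1 \<le> k" "k \<le> t" "bnd k j (b - l)" "conj_valid i k l"
  shows "gauge_rank (conj_idx i k l) < gauge_rank (i, j, b)"
proof (rule gauge_rank_less)
  have "l * B + (b - l) * B = b * B" using assms(2) by (simp add: distrib_right[symmetric])
  then show "weight (conj_idx i k l) < weight (i, j, b)"
    using conj_idx_Q(2)[OF assms(6)] weight_Q[OF assms(1)] assms(5) unfolding bnd_def by linarith
qed

lemma conj_idx_quad_right:
  assumes "(i, j, b) \<in> Q" "l \<le> b" "(i, k, l) \<in> S" "conj_valid k j (b - l)"
  shows "gauge_rank (conj_idx k j (b - l)) < gauge_rank (i, j, b)" "gauge_rank (i, k, l) < gauge_rank (i, j, b)"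
proof -
  have lb: "l * B + (b - l) * B = b * B" using assms(2) by (simp add: distrib_right[symmetric])
  have Qk: "(i, k, l) \<in> Q" using assms(3) by (simp add: S_def)
  have pos: "weight (conj_idx k j (b - l)) > 0" using weight_Q conj_idx_Q(1)[OF assms(4)] by (cases "conj_idx k j (b - l)") auto
  note eqs = conj_idx_Q(2)[OF assms(4)] weight_Q[OF assms(1)] weight_Q[OF Qk] lb pos
  show "gauge_rank (conj_idx k j (b - l)) < gauge_rank (i, j, b)" by (rule gauge_rank_less) (use eqs in linarith)
  show "gauge_rank (i, k, l) < gauge_rank (i, j, b)" by (rule gauge_rank_less) (use eqs in linarith)
qed

text \<open>In the quadratic terms both factors have positive weight and the weights add up to that of the
equation; in the linear term the weight is the same, but the position on the diagonal is earlier.\<close>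

lemma gauge_map_lower:
  assumes e: "bounded e" and agree: "\<And>q'. gauge_rank q' < gauge_rank q \<Longrightarrow> z q' = z' q'"
  shows "gauge_map e z q = gauge_map e z' q"
proof -
  obtain i j b where q: "q = (i, j, b)" by (cases q)
  show ?thesis
  proof (cases "q \<in> Q")
    case True
    then have Qq: "(i, j, b) \<in> Q" by (simp add: q)
    have shift_term: "shift_term z i j b = shift_term z' i j b"
      unfolding shift_term_def conj_coeff_def
      using agree[unfolded q, OF conj_idx_shift_lower[OF Qq]] agree[unfolded q, OF conj_idx_shift_upper[OF Qq]] by auto
    have "conj_coeff z i k l * Polynomial.coeff (e k j) (b - l) = conj_coeff z' i k l * Polynomial.coeff (e k j) (b - l)"
      if kl: "k \<in> {1..t}" "l \<in> {..b}" for k l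
    proof (cases "Polynomial.coeff (e k j) (b - l) = 0")
      case False
      have "j \<le> t" using Qq by (simp add: Q_def)
      then have "bnd k j (b - l)" using e False kl unfolding bounded_def by simp
      then show ?thesis using agree[unfolded q, OF conj_idx_quad_left[OF Qq]] kl by (auto simp: conj_coeff_def)
    qed simp
    moreover have "form_coeff z i k l * conj_coeff z k j (b - l) = form_coeff z' i k l * conj_coeff z' k j (b - l)"
      if kl: "k \<in> {..t}" "l \<in> {..b}" for k l
    proof (cases "(i, k, l) \<in> S \<and> conj_valid k j (b - l)")
      case True
      then show ?thesis using agree[unfolded q, OF conj_idx_quad_right(1)[OF Qq]] agree[unfolded q, OF conj_idx_quad_right(2)[OF Qq]] kl
        by (auto simp: conj_coeff_def form_coeff_def)
    qed (auto simp: conj_coeff_def form_coeff_def)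
    ultimately have "quad_term e z i j b = quad_term e z' i j b"
      unfolding quad_term_def by (intro arg_cong2[of _ _ _ _ minus] sum.cong) auto
    then show ?thesis using shift_term by (simp add: gauge_map_def q)
  qed (simp add: gauge_map_def q)
qed

definition gauge_sol :: "(nat \<Rightarrow> nat \<Rightarrow> 'k::field poly) \<Rightarrow> nat \<times> nat \<times> nat \<Rightarrow> 'k" where
  "gauge_sol e = (SOME z. \<forall>q. z q = gauge_map e z q)"

lemma gauge_sol: "bounded e \<Longrightarrow> gauge_sol e q = gauge_map e (gauge_sol e) q"
  unfolding gauge_sol_def by (rule spec[OF someI_ex[OF triangular_solution(1)[of gauge_rank "gauge_map e", OF gauge_map_lower]]])

lemma gauge_sol_unique:
  assumes "bounded e" "\<And>q. z q = gauge_map e z q" shows "z = gauge_sol e"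
  by (rule triangular_solution(2)[of gauge_rank "gauge_map e", OF gauge_map_lower]) (use assms gauge_sol in auto)

lemma polyfun_on_gauge_sol:
  assumes e: "\<And>x. x \<in> U \<Longrightarrow> bounded (e x)"
    and poly: "\<And>i j b. 1 \<le> i \<Longrightarrow> i \<le> t \<Longrightarrow> j \<le> t \<Longrightarrow> polyfun_on U \<gamma> (\<lambda>x. Polynomial.coeff (e x i j) b)"
  shows "polyfun_on U \<gamma> (\<lambda>x. gauge_sol (e x) q)"
proof (induction q rule: measure_induct_rule[of gauge_rank])
  case (less q)
  obtain i j b where q: "q = (i, j, b)" by (cases q)
  have "polyfun_on U \<gamma> (\<lambda>x. gauge_map (e x) (gauge_sol (e x)) q)"
  proof (cases "q \<in> Q")
    case True
    then have Qq: "(i, j, b) \<in> Q" by (simp add: q)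
    then have ij: "1 \<le> i" "i \<le> t" "j \<le> t" by (auto simp: Q_def)
    have aaP: "polyfun_on U \<gamma> (\<lambda>x. conj_coeff (gauge_sol (e x)) i' j' b')"
      if "conj_valid i' j' b' \<Longrightarrow> gauge_rank (conj_idx i' j' b') < gauge_rank (i, j, b)" for i' j' b'
    proof (cases "conj_valid i' j' b'")
      case True
      then have "polyfun_on U \<gamma> (\<lambda>x. gauge_sol (e x) (conj_idx i' j' b'))" using less that by (simp add: q)
      then show ?thesis using True by (cases "j' < i'") (simp_all add: conj_coeff_def polyfun_on_uminus)
    qed (simp add: conj_coeff_def polyfun_on.const)
    have "polyfun_on U \<gamma> (\<lambda>x. shift_term (gauge_sol (e x)) i j b)"
    proof (cases "j < i")
      case True
      then show ?thesis
        using aaP[OF conj_idx_shift_lower[OF Qq True]] by (cases "d i \<le> b") (simp_all add: shift_term_def polyfun_on.const)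
    next
      case nlt: False
      show ?thesis
      proof (cases "j < t \<and> d (Suc j) \<le> b")
        case True
        then have "polyfun_on U \<gamma> (\<lambda>x. conj_coeff (gauge_sol (e x)) i (Suc j) (b - d (Suc j)))"
          using nlt by (intro aaP conj_idx_shift_upper[OF Qq]) auto
        then show ?thesis using True nlt by (simp add: shift_term_def polyfun_on_uminus)
      next
        case False
        then have "shift_term (gauge_sol (e x)) i j b = 0" for x using nlt unfolding shift_term_def by argo
        then show ?thesis by (simp add: polyfun_on.const)
      qed
    qed
    moreover have "polyfun_on U \<gamma> (\<lambda>x. quad_term (e x) (gauge_sol (e x)) i j b)"
      unfolding quad_term_def
    proof (intro polyfun_on_diff polyfun_on_sum)
      fix k l assume kl: "k \<in> {1..t}" "l \<in> {..b}"
      show "polyfun_on U \<gamma> (\<lambda>x. conj_coeff (gauge_sol (e x)) i k l * Polynomial.coeff (e x k j) (b - l))"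
      proof (cases "bnd k j (b - l)")
        case True
        show ?thesis
          by (intro polyfun_on.mult aaP poly conj_idx_quad_left[OF Qq]) (use kl True ij in auto)
      next
        case False
        then have "Polynomial.coeff (e x k j) (b - l) = 0" if "x \<in> U" for x
          using e[OF that] kl ij unfolding bounded_def by force
        then show ?thesis by (intro polyfun_on.cong[OF polyfun_on.const[of _ _ 0]]) simp
      qed
    next
      fix k l assume kl: "k \<in> {..t}" "l \<in> {..b}"
      show "polyfun_on U \<gamma> (\<lambda>x. form_coeff (gauge_sol (e x)) i k l * conj_coeff (gauge_sol (e x)) k j (b - l))"
      proof (cases "(i, k, l) \<in> S \<and> conj_valid k j (b - l)")
        case True
        have "polyfun_on U \<gamma> (\<lambda>x. gauge_sol (e x) (i, k, l))"
          by (rule less[unfolded q]) (use conj_idx_quad_right(2)[OF Qq] True kl in auto)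
        moreover have "polyfun_on U \<gamma> (\<lambda>x. conj_coeff (gauge_sol (e x)) k j (b - l))"
          by (rule aaP) (use conj_idx_quad_right(1)[OF Qq] True kl in auto)
        ultimately show ?thesis using True by (simp add: form_coeff_def polyfun_on.mult)
      next
        case False
        then have "form_coeff (gauge_sol (e x)) i k l * conj_coeff (gauge_sol (e x)) k j (b - l) = 0" for x
          by (auto simp: form_coeff_def conj_coeff_def)
        then show ?thesis by (simp only: polyfun_on.const)
      qed
    qed
    ultimately have "polyfun_on U \<gamma> (\<lambda>x. Polynomial.coeff (e x i j) b - shift_term (gauge_sol (e x)) i j b + quad_term (e x) (gauge_sol (e x)) i j b)"
      by (intro polyfun_on.add polyfun_on_diff poly ij)
    then show ?thesis using Qq by (simp add: gauge_map_def q)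
  qed (simp add: gauge_map_def q polyfun_on.const)
  then show ?case
    by (rule polyfun_on.cong) (simp add: gauge_sol[OF e, symmetric])
qed

definition canonical :: "(nat \<Rightarrow> nat \<Rightarrow> 'k::field poly) \<Rightarrow> bool" where
  "canonical c \<longleftrightarrow> (\<forall>i j b. 1 \<le> i \<longrightarrow> i \<le> t \<longrightarrow> j \<le> t \<longrightarrow> Polynomial.coeff (c i j) b \<noteq> 0 \<longrightarrow> (i, j, b) \<in> S)"

definition unipotent :: "(nat \<Rightarrow> nat \<Rightarrow> 'k::field poly) \<Rightarrow> bool" where
  "unipotent a \<longleftrightarrow> (\<forall>i j b. i \<le> t \<longrightarrow> j \<le> t \<longrightarrow> Polynomial.coeff (a i j) b \<noteq> 0 \<longrightarrow> conj_valid i j b)"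

text \<open>\<open>(1 + a') (YM + e) = (YM + c) (1 + a)\<close> where \<open>a'\<close> is a without row and column 0. This says that
if g satisfies the relations with matrix e, then f = (1 + a) g satisfies those with matrix c.\<close>

definition conjugates :: "(nat \<Rightarrow> nat \<Rightarrow> 'k::field poly) \<Rightarrow> (nat \<Rightarrow> nat \<Rightarrow> 'k poly) \<Rightarrow> (nat \<Rightarrow> nat \<Rightarrow> 'k poly) \<Rightarrow> bool" where
  "conjugates a e c \<longleftrightarrow> (\<forall>i j. 1 \<le> i \<longrightarrow> i \<le> t \<longrightarrow> j \<le> t \<longrightarrow>
     (\<Sum>k\<in>{1..t}. ((if i = k then 1 else 0) + a i k) * (YM k j + e k j)) =
     (\<Sum>k\<le>t. (YM i k + c i k) * ((if k = j then 1 else 0) + a k j)))"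

lemma canonical_bounded: "canonical c \<Longrightarrow> bounded c"
  unfolding canonical_def bounded_def S_def Q_def by blast

text \<open>The equation sorted by degree in the unknowns; the products with YM are the linear terms.\<close>

lemma conjugates_iff:
  fixes a e c :: "nat \<Rightarrow> nat \<Rightarrow> 'k::field poly"
  shows "conjugates a e c \<longleftrightarrow> (\<forall>i j. 1 \<le> i \<longrightarrow> i \<le> t \<longrightarrow> j \<le> t \<longrightarrow>
    c i j + Polynomial.monom 1 (d i) * a (i - 1) j - (if j < t then Polynomial.monom 1 (d (Suc j)) * a i (Suc j) else 0)
    = e i j + (\<Sum>k\<in>{1..t}. a i k * e k j) - (\<Sum>k\<le>t. c i k * a k j))"
proof -
  have "(\<Sum>k\<in>{1..t}. ((if i = k then 1 else 0) + a i k) * (YM k j + e k j)) =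
      YM i j + e i j + (if j < t then Polynomial.monom 1 (d (Suc j)) * a i (Suc j) else 0) + (\<Sum>k\<in>{1..t}. a i k * e k j)"
    (is "?lhs = _") if i: "1 \<le> i" "i \<le> t" for i j
  proof -
    have "?lhs = (\<Sum>k\<in>{1..t}. (if k = i then YM k j + e k j else 0) +
        (if k = Suc j then Polynomial.monom 1 (d (Suc j)) * a i (Suc j) else 0) + a i k * e k j)"
      by (rule sum.cong) (auto simp: YM_def algebra_simps)
    then show ?thesis using i by (simp add: sum.distrib sum.delta)
  qed
  moreover have "(\<Sum>k\<le>t. (YM i k + c i k) * ((if k = j then 1 else 0) + a k j)) =
      YM i j + c i j + Polynomial.monom 1 (d i) * a (i - 1) j + (\<Sum>k\<le>t. c i k * a k j)"
    (is "?rhs = _") if i: "1 \<le> i" "i \<le> t" "j \<le> t" for i j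
  proof -
    have "?rhs = (\<Sum>k\<le>t. (if k = j then YM i k + c i k else 0) +
        (if k = i - 1 then Polynomial.monom 1 (d i) * a (i - 1) j else 0) + c i k * a k j)"
      by (rule sum.cong) (use i in \<open>auto simp: YM_def algebra_simps\<close>)
    then show ?thesis using i by (simp add: sum.distrib sum.delta)
  qed
  ultimately show ?thesis
    unfolding conjugates_def by (intro all_cong1 imp_cong refl) (auto simp: algebra_simps)
qed

text \<open>At each index one of the three linear terms is the unknown of that index. For j < i this is the
coefficient of c or, once the degree of y reaches d (j+1), that of a i (j+1); for j \<ge> i it is the
coefficient of c or that of a (i-1) j.\<close>

lemma lhs_coeff:
  fixes z :: "nat \<times> nat \<times> nat \<Rightarrow> 'k::field"
  assumes q: "(i, j, b) \<in> Q"
  shows "form_coeff z i j b + (if d i \<le> b then conj_coeff z (i - 1) j (b - d i) else 0) -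
      (if j < t \<and> d (Suc j) \<le> b then conj_coeff z i (Suc j) (b - d (Suc j)) else 0) = z (i, j, b) + shift_term z i j b"
proof -
  have ij: "1 \<le> i" "i \<le> t" "j \<le> t" "bnd i j b" using q by (auto simp: Q_def)
  show ?thesis
  proof (cases "j < i")
    case True
    have jt: "j < t" using True ij by simp
    have "form_coeff z i j b - (if d (Suc j) \<le> b then conj_coeff z i (Suc j) (b - d (Suc j)) else 0) = z (i, j, b)"
    proof (cases "d (Suc j) \<le> b")
      case F: True
      have st: "d (Suc j) * B + wL j = B + 1 + wL (Suc j)" using wL_step[of "Suc j"] jt by simp
      have bB: "d (Suc j) * B + (b - d (Suc j)) * B = b * B" using F by (simp add: distrib_right[symmetric])
      have lt: "(b - d (Suc j)) * B + wL (Suc j) < wL i" using ij(4) st bB unfolding bnd_def by linarith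
      then have "Suc j \<noteq> i" by auto
      then have "conj_valid i (Suc j) (b - d (Suc j))" using lt ij True by (simp add: conj_valid_def)
      moreover have "Suc j < i" using True \<open>Suc j \<noteq> i\<close> by simp
      ultimately have "conj_coeff z i (Suc j) (b - d (Suc j)) = - z (i, j, b)" using F by (simp add: conj_coeff_def conj_idx_def)
      moreover have "form_coeff z i j b = 0" using F True by (simp add: form_coeff_def S_def canon_def)
      ultimately show ?thesis using F by simp
    next
      case False
      then show ?thesis using True q by (simp add: form_coeff_def S_def canon_def)
    qed
    then show ?thesis using True jt by (auto simp: shift_term_def algebra_simps)
  next
    case False
    have "form_coeff z i j b + (if d i \<le> b then conj_coeff z (i - 1) j (b - d i) else 0) = z (i, j, b)"
    proof (cases "d i \<le> b")
      case F: True
      have bB: "d i * B + (b - d i) * B = b * B" using F by (simp add: distrib_right[symmetric])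
      have "(b - d i) * B + wL j < wL (i - 1)" using ij(4) wL_step[OF ij(1,2)] bB unfolding bnd_def by linarith
      moreover have "\<not> j < i - 1" "j \<noteq> i - 1" "1 \<le> j" "i - 1 \<le> t" "Suc (i - 1) = i"
        using ij False by linarith+
      moreover from calculation have "conj_valid (i - 1) j (b - d i)" using ij by (simp add: conj_valid_def)
      ultimately have "conj_coeff z (i - 1) j (b - d i) = z (i, j, b)" using F by (simp add: conj_coeff_def conj_idx_def)
      moreover have "form_coeff z i j b = 0" using F False by (simp add: form_coeff_def S_def canon_def)
      ultimately show ?thesis using F by simp
    next
      case G: False
      then show ?thesis using False q by (simp add: form_coeff_def S_def canon_def)
    qed
    then show ?thesis using False by (auto simp: shift_term_def algebra_simps)
  qed
qed

text \<open>Comparison of coefficients; outside the index bound all terms vanish for reasons of weight.\<close>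

lemma conjugates_coeff:
  fixes a e c :: "nat \<Rightarrow> nat \<Rightarrow> 'k::field poly"
  assumes e: "bounded e" and z: "\<And>q. q \<notin> Q \<Longrightarrow> z q = 0"
    and a: "\<And>i j b. i \<le> t \<Longrightarrow> j \<le> t \<Longrightarrow> Polynomial.coeff (a i j) b = conj_coeff z i j b"
    and c: "\<And>i j b. 1 \<le> i \<Longrightarrow> i \<le> t \<Longrightarrow> j \<le> t \<Longrightarrow> Polynomial.coeff (c i j) b = form_coeff z i j b"
  shows "conjugates a e c \<longleftrightarrow> (\<forall>q. z q = gauge_map e z q)"
proof -
  define lhs where "lhs i j = c i j + Polynomial.monom 1 (d i) * a (i - 1) j -
      (if j < t then Polynomial.monom 1 (d (Suc j)) * a i (Suc j) else 0)" for i j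
  define rhs where "rhs i j = e i j + (\<Sum>k\<in>{1..t}. a i k * e k j) - (\<Sum>k\<le>t. c i k * a k j)" for i j
  have L: "Polynomial.coeff (lhs i j) b = form_coeff z i j b + (if d i \<le> b then conj_coeff z (i - 1) j (b - d i) else 0) -
      (if j < t \<and> d (Suc j) \<le> b then conj_coeff z i (Suc j) (b - d (Suc j)) else 0)"
    if "1 \<le> i" "i \<le> t" "j \<le> t" for i j b
    using that by (auto simp: lhs_def a c coeff_monom_mult)
  have R: "Polynomial.coeff (rhs i j) b = Polynomial.coeff (e i j) b + quad_term e z i j b"
    if "1 \<le> i" "i \<le> t" "j \<le> t" for i j b
  proof -
    have "Polynomial.coeff (\<Sum>k\<in>{1..t}. a i k * e k j) b = (\<Sum>k\<in>{1..t}. \<Sum>l\<le>b. conj_coeff z i k l * Polynomial.coeff (e k j) (b - l))"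
      unfolding Polynomial.coeff_sum Polynomial.coeff_mult
      by (intro sum.cong refl) (use that a in simp)
    moreover have "Polynomial.coeff (\<Sum>k\<le>t. c i k * a k j) b = (\<Sum>k\<le>t. \<Sum>l\<le>b. form_coeff z i k l * conj_coeff z k j (b - l))"
      unfolding Polynomial.coeff_sum Polynomial.coeff_mult
      by (intro sum.cong refl) (use that a c in simp)
    ultimately show ?thesis by (simp add: rhs_def quad_term_def)
  qed
  have iff_Q: "Polynomial.coeff (lhs i j) b = Polynomial.coeff (rhs i j) b \<longleftrightarrow> z (i, j, b) = gauge_map e z (i, j, b)"
    if q: "(i, j, b) \<in> Q" for i j b
  proof -
    have ij: "1 \<le> i" "i \<le> t" "j \<le> t" using q by (auto simp: Q_def)
    show ?thesis unfolding L[OF ij] R[OF ij] lhs_coeff[OF q] gauge_map_def using q by (auto simp: algebra_simps)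
  qed
  have out: "Polynomial.coeff (lhs i j) b = 0 \<and> Polynomial.coeff (rhs i j) b = 0"
    if ij: "1 \<le> i" "i \<le> t" "j \<le> t" and nb: "\<not> bnd i j b" for i j b
  proof
    have "form_coeff z i j b = 0" using nb by (simp add: form_coeff_def S_def Q_def)
    moreover have "\<not> conj_valid (i - 1) j (b - d i)" if "d i \<le> b"
    proof
      assume "conj_valid (i - 1) j (b - d i)"
      moreover have "d i * B + (b - d i) * B = b * B" using that by (simp add: distrib_right[symmetric])
      ultimately show False using nb wL_step[OF ij(1,2)] unfolding conj_valid_def bnd_def by linarith
    qed
    moreover have "\<not> conj_valid i (Suc j) (b - d (Suc j))" if "j < t" "d (Suc j) \<le> b"
    proof
      assume "conj_valid i (Suc j) (b - d (Suc j))"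
      moreover have "d (Suc j) * B + (b - d (Suc j)) * B = b * B" using that by (simp add: distrib_right[symmetric])
      moreover have "d (Suc j) * B + wL j = B + 1 + wL (Suc j)" using wL_step[of "Suc j"] that by simp
      ultimately show False using nb unfolding conj_valid_def bnd_def by linarith
    qed
    ultimately show "Polynomial.coeff (lhs i j) b = 0" unfolding L[OF ij] by (simp add: conj_coeff_def)
    have lb: "l * B + (b - l) * B = b * B" if "l \<le> b" for l using that by (simp add: distrib_right[symmetric])
    have "Polynomial.coeff (e i j) b = 0" using e ij nb unfolding bounded_def by blast
    moreover have s1: "conj_coeff z i k l * Polynomial.coeff (e k j) (b - l) = 0" if "k \<in> {1..t}" "l \<in> {..b}" for k l
    proof (rule ccontr)
      assume *: "conj_coeff z i k l * Polynomial.coeff (e k j) (b - l) \<noteq> 0"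
      then have "bnd k j (b - l)" using e that ij unfolding bounded_def by simp
      moreover have "conj_valid i k l" using * by (auto simp: conj_coeff_def split: if_splits)
      ultimately show False using nb lb[of l] that unfolding conj_valid_def bnd_def by auto
    qed
    moreover have s2: "form_coeff z i k l * conj_coeff z k j (b - l) = 0" if "k \<in> {..t}" "l \<in> {..b}" for k l
    proof (rule ccontr)
      assume *: "form_coeff z i k l * conj_coeff z k j (b - l) \<noteq> 0"
      then have "bnd i k l" by (auto simp: form_coeff_def S_def Q_def split: if_splits)
      moreover have "conj_valid k j (b - l)" using * by (auto simp: conj_coeff_def split: if_splits)
      ultimately show False using nb lb[of l] that unfolding conj_valid_def bnd_def by auto
    qed
    moreover have "(\<Sum>k\<in>{1..t}. \<Sum>l\<le>b. conj_coeff z i k l * Polynomial.coeff (e k j) (b - l)) = 0"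
      by (intro sum.neutral ballI s1)
    moreover have "(\<Sum>k\<le>t. \<Sum>l\<le>b. form_coeff z i k l * conj_coeff z k j (b - l)) = 0"
      by (intro sum.neutral ballI s2)
    ultimately show "Polynomial.coeff (rhs i j) b = 0" unfolding R[OF ij] quad_term_def by simp
  qed
  have "conjugates a e c \<longleftrightarrow> (\<forall>i j. 1 \<le> i \<longrightarrow> i \<le> t \<longrightarrow> j \<le> t \<longrightarrow> lhs i j = rhs i j)"
    unfolding conjugates_iff lhs_def rhs_def ..
  also have "\<dots> \<longleftrightarrow> (\<forall>i j b. (i, j, b) \<in> Q \<longrightarrow> z (i, j, b) = gauge_map e z (i, j, b))"
  proof
    assume *: "\<forall>i j. 1 \<le> i \<longrightarrow> i \<le> t \<longrightarrow> j \<le> t \<longrightarrow> lhs i j = rhs i j"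
    show "\<forall>i j b. (i, j, b) \<in> Q \<longrightarrow> z (i, j, b) = gauge_map e z (i, j, b)"
    proof (intro allI impI)
      fix i j b assume q: "(i, j, b) \<in> Q"
      then have "lhs i j = rhs i j" using * by (auto simp: Q_def)
      then show "z (i, j, b) = gauge_map e z (i, j, b)" using iff_Q[OF q] by simp
    qed
  next
    assume *: "\<forall>i j b. (i, j, b) \<in> Q \<longrightarrow> z (i, j, b) = gauge_map e z (i, j, b)"
    show "\<forall>i j. 1 \<le> i \<longrightarrow> i \<le> t \<longrightarrow> j \<le> t \<longrightarrow> lhs i j = rhs i j"
    proof (intro allI impI poly_eqI)
      fix i j b assume ij: "1 \<le> i" "i \<le> t" "j \<le> t"
      show "Polynomial.coeff (lhs i j) b = Polynomial.coeff (rhs i j) b"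
      proof (cases "bnd i j b")
        case True
        then have "(i, j, b) \<in> Q" using ij by (simp add: Q_def)
        then show ?thesis using iff_Q * by blast
      next
        case False
        then show ?thesis using out[OF ij] by simp
      qed
    qed
  qed
  also have "\<dots> \<longleftrightarrow> (\<forall>q. z q = gauge_map e z q)"
  proof
    assume *: "\<forall>i j b. (i, j, b) \<in> Q \<longrightarrow> z (i, j, b) = gauge_map e z (i, j, b)"
    show "\<forall>q. z q = gauge_map e z q"
    proof
      fix q show "z q = gauge_map e z q"
      proof (cases "q \<in> Q")
        case True
        then show ?thesis using * by (cases q) auto
      next
        case False
        then show ?thesis using z[OF False] by (cases q) (simp add: gauge_map_def)
      qed
    qed
  qed simp
  finally show ?thesis .
qed

lemma coeff_mkpoly_conj: "i \<le> t \<Longrightarrow> Polynomial.coeff (mkpoly (conj_coeff z i j)) b = conj_coeff z i j b"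
proof -
  assume "i \<le> t"
  have "b < B" if "conj_valid i j b"
    by (rule bnd_less_B[OF \<open>i \<le> t\<close>, of j b]) (use that in \<open>simp add: conj_valid_def bnd_def\<close>)
  then show ?thesis by (auto simp: coeff_mkpoly conj_coeff_def)
qed

lemma coeff_mkpoly_form: "i \<le> t \<Longrightarrow> Polynomial.coeff (mkpoly (form_coeff z i j)) b = form_coeff z i j b"
  using bnd_less_B[of i j b] by (auto simp: coeff_mkpoly form_coeff_def S_def Q_def)

theorem canonical_form_exists:
  assumes e: "bounded e"
  shows "canonical (\<lambda>i j. mkpoly (form_coeff (gauge_sol e) i j))"
    "\<exists>a. unipotent a \<and> conjugates a e (\<lambda>i j. mkpoly (form_coeff (gauge_sol e) i j))"
proof -
  show "canonical (\<lambda>i j. mkpoly (form_coeff (gauge_sol e) i j))"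
    by (auto simp: canonical_def coeff_mkpoly_form) (auto simp: form_coeff_def split: if_splits)
  have "conjugates (\<lambda>i j. mkpoly (conj_coeff (gauge_sol e) i j)) e (\<lambda>i j. mkpoly (form_coeff (gauge_sol e) i j))"
  proof (subst conjugates_coeff[OF e, of "gauge_sol e"])
    show "gauge_sol e q = 0" if "q \<notin> Q" for q
      using gauge_sol[OF e, of q] that by (cases q) (simp add: gauge_map_def)
  qed (use gauge_sol[OF e] in \<open>auto simp: coeff_mkpoly_conj coeff_mkpoly_form\<close>)
  moreover have "unipotent (\<lambda>i j. mkpoly (conj_coeff (gauge_sol e) i j))"
    by (auto simp: unipotent_def coeff_mkpoly_conj) (auto simp: conj_coeff_def split: if_splits)
  ultimately show "\<exists>a. unipotent a \<and> conjugates a e (\<lambda>i j. mkpoly (form_coeff (gauge_sol e) i j))" by blast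
qed

theorem canonical_form_unique:
  fixes a e c :: "nat \<Rightarrow> nat \<Rightarrow> 'k::field poly"
  assumes e: "bounded e" and c: "canonical c" and a: "unipotent a" and conj: "conjugates a e c"
    and s: "(i, j, b) \<in> S"
  shows "Polynomial.coeff (c i j) b = gauge_sol e (i, j, b)"
proof -
  define z where "z = (\<lambda>(i, j, b). if (i, j, b) \<notin> Q then 0
    else if (i, j, b) \<in> S then Polynomial.coeff (c i j) b
    else if j < i then - Polynomial.coeff (a i (Suc j)) (b - d (Suc j))
    else Polynomial.coeff (a (i - 1) j) (b - d i))"
  have za: "Polynomial.coeff (a i j) b = conj_coeff z i j b" if "i \<le> t" "j \<le> t" for i j b
  proof (cases "conj_valid i j b")
    case True
    note v = conj_idx_Q[OF True]
    have j: "1 \<le> j" "j \<noteq> i" using True by (auto simp: conj_valid_def)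
    show ?thesis
    proof (cases "j < i")
      case lt: True
      have "z (conj_idx i j b) = - Polynomial.coeff (a i j) b"
        using v lt j less_imp_diff_less[OF lt, of 1] by (simp add: conj_idx_def z_def)
      then show ?thesis using True lt by (simp add: conj_coeff_def)
    next
      case nlt: False
      have "z (conj_idx i j b) = Polynomial.coeff (a i j) b"
        using v nlt j by (simp add: conj_idx_def z_def)
      then show ?thesis using True nlt by (simp add: conj_coeff_def)
    qed
  next
    case False
    then have "Polynomial.coeff (a i j) b = 0" using a that unfolding unipotent_def by blast
    then show ?thesis using False by (simp add: conj_coeff_def)
  qed
  have zc: "Polynomial.coeff (c i j) b = form_coeff z i j b" if "1 \<le> i" "i \<le> t" "j \<le> t" for i j b
  proof (cases "(i, j, b) \<in> S")
    case True
    then show ?thesis by (simp add: form_coeff_def z_def S_def)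
  next
    case False
    then have "Polynomial.coeff (c i j) b = 0" using c that unfolding canonical_def by blast
    then show ?thesis using False by (simp add: form_coeff_def)
  qed
  have "z q = 0" if "q \<notin> Q" for q using that by (cases q) (simp add: z_def)
  then have "\<forall>q. z q = gauge_map e z q" using conjugates_coeff[OF e, of z a c] za zc conj by blast
  then have "z q = gauge_map e z q" for q by (rule spec)
  then have "z = gauge_sol e" by (rule gauge_sol_unique[OF e])
  moreover have "z (i, j, b) = Polynomial.coeff (c i j) b" using s by (simp add: z_def S_def)
  ultimately show ?thesis by simp
qed

end

section \<open>The cell is an affine space\<close>

text \<open>An element of I outside J with the smallest possible leading monomial could be reduced by J.\<close>

lemma ideal_eq_of_lead_mons:
  assumes J: "is_ideal J" and I: "is_ideal I" and sub: "J \<subseteq> I" and lead: "lead_mons I \<subseteq> lead_mons J"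
  shows "J = I"
proof -
  have "\<forall>f\<in>I. is_lead f u \<longrightarrow> f \<in> J" for u
  proof (induction u rule: drl_induct)
    case (1 u)
    show ?case
    proof (intro ballI impI)
      fix f assume f: "f \<in> I" "is_lead f u"
      then have "u \<in> lead_mons J" using lead by (auto simp: lead_mons_def)
      then obtain g where g: "g \<in> J" "is_lead g u" "cf g u = 1" using lead_mons_monic[OF J] by blast
      define h where "h = f - Poly_Mapping.single 0 (cf f u) * g"
      have cfh: "cf h v = cf f v - cf f u * cf g v" for v
        using cf_single_mult_add[of 0 "cf f u" g v] by (simp add: h_def lookup_minus)
      have gJ: "Poly_Mapping.single 0 (cf f u) * g \<in> J" using g J by (simp add: ideal_mult)
      then have hI: "h \<in> I" using f sub I by (auto simp: h_def intro!: ideal_diff)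
      have "h \<in> J"
      proof (cases "h = 0")
        case False
        then obtain w where w: "is_lead h w" using is_lead_ex by blast
        then have "cf h w \<noteq> 0" by (simp add: is_lead_def)
        then have "w \<noteq> u" "cf f w \<noteq> 0 \<or> cf g w \<noteq> 0" using g(3) by (auto simp: cfh)
        then have "drl_less w u" using is_leadD[OF f(2)] is_leadD[OF g(2)] by blast
        then show ?thesis using 1 hI w by blast
      qed (use J in \<open>simp add: ideal_zero\<close>)
      then have "h + Poly_Mapping.single 0 (cf f u) * g \<in> J" using gJ J by (simp add: ideal_add)
      then show "f \<in> J" by (simp add: h_def)
    qed
  qed
  then have "f \<in> J" if "f \<in> I" for f
    using that is_lead_ex[of f] J by (cases "f = 0") (auto simp: ideal_zero)
  then show ?thesis using sub by blast
qed

lemma single_mult_cf: "cf (Poly_Mapping.single 0 c * f) v = c * cf f v"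
  using cf_single_mult_add[of 0 c f v] by simp

context staircase begin

lemma not_M_fst: "v \<notin> M \<Longrightarrow> fst v < t"
  by (rule ccontr) (simp add: M_iff m_0)

definition cell :: "'k::field poly2 set set" where
  "cell = {I. is_ideal I \<and> lead_mons I = M}"

lemma cell_V: "V (monspan M) = cell"
  by (simp add: V_monspan cell_def)

definition gb :: "'k::field poly2 set \<Rightarrow> nat \<Rightarrow> 'k poly2" where
  "gb I i = red I (L i)"

lemma cellD: "I \<in> cell \<Longrightarrow> is_ideal I" "I \<in> cell \<Longrightarrow> lead_mons I = M"
  by (simp_all add: cell_def)

lemma gb_props:
  assumes I: "I \<in> cell" and i: "i \<le> t"
  shows "gb I i \<in> I" "cf (gb I i) (L i) = 1" "is_lead (gb I i) (L i)"
    "v \<in> supp (gb I i) \<Longrightarrow> v = L i \<or> v \<notin> M"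
  using red_props[OF cellD(1)[OF I], of "L i"] L_in_M[OF i] by (auto simp: cellD(2)[OF I] gb_def)

text \<open>Terms outside the initial ideal have x-exponent less than t.\<close>

lemma gb_fst:
  assumes I: "I \<in> cell" and i: "i \<le> t" and v: "v \<in> supp (gb I i)"
  shows "fst v \<le> t" "1 \<le> i \<Longrightarrow> fst v < t" "fst v = t \<Longrightarrow> v = L 0"
proof -
  have v': "v = L i \<or> fst v < t" using gb_props(4)[OF I i v] not_M_fst by blast
  then show "fst v \<le> t" "1 \<le> i \<Longrightarrow> fst v < t" using i by (auto simp: L_def)
  assume t: "fst v = t"
  then have vL: "v = L i" using v' by simp
  then have "i = 0" using t i by (simp add: L_def)
  then show "v = L 0" using vL by simp
qed

lemma gb_lead_family: "I \<in> cell \<Longrightarrow> lead_family (gb I)"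
  by (simp add: lead_family_def gb_props)

lemma gb_coords_cell:
  assumes I: "I \<in> cell"
  shows "gb_coords I (u, v) = (if u \<in> L ` {..t} \<and> v \<noteq> u then cf (red I u) v else 0)"
proof -
  interpret minimal_generators I "L ` {..t}"
  proof
    show "lead_mons I = {u. \<exists>m\<in>L ` {..t}. mon_dvd m u}" unfolding cellD(2)[OF I] M_def by auto
    show "u = v" if "u \<in> L ` {..t}" "v \<in> L ` {..t}" "mon_dvd u v" for u v
      using that L_antichain by auto
  qed (simp_all add: cellD[OF I])
  show ?thesis by (rule gb_coords_eq)
qed

text \<open>The deviation of the matrix of multiplication by x on the reduced Groebner basis from that of
the monomial ideal.\<close>

definition mult_matrix :: "'k::field poly2 set \<Rightarrow> nat \<Rightarrow> nat \<Rightarrow> 'k poly" where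
  "mult_matrix I i = (SOME p. monomial (1, 0) * gb I i = (\<Sum>j\<le>t. ypoly (YM i j + p j) * gb I j))"

lemma mult_matrix_rel:
  fixes I :: "'k::field poly2 set"
  assumes I: "I \<in> cell" and i: "1 \<le> i" "i \<le> t"
  shows "monomial (1, 0) * gb I i = (\<Sum>j\<le>t. ypoly (YM i j + mult_matrix I i j) * gb I j)"
proof -
  have "\<exists>p. monomial (1, 0) * gb I i = (\<Sum>j\<le>t. ypoly (p j) * gb I j)"
  proof (rule expansion_ex[OF cellD[OF I] gb_lead_family[OF I]])
    show "monomial (1, 0) * gb I i \<in> I" using gb_props(1)[OF I i(2)] cellD(1)[OF I] by (simp add: ideal_mult)
    fix v assume "v \<in> supp (monomial (1, 0) * gb I i)"
    then have "v \<in> (+) (1, 0) ` supp (gb I i)" by (rule subsetD[OF supp_single_mult])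
    then show "fst v \<le> t" using gb_fst(2)[OF I i(2)] i(1) by fastforce
  qed (use gb_props(1)[OF I] gb_fst(1)[OF I] in auto)
  then obtain p where p: "monomial (1, 0) * gb I i = (\<Sum>j\<le>t. ypoly (p j) * gb I j)" ..
  have "monomial (1, 0) * gb I i = (\<Sum>j\<le>t. ypoly (YM i j + mult_matrix I i j) * gb I j)"
    unfolding mult_matrix_def
    by (rule someI[where x = "\<lambda>j. p j - YM i j"]) (use p in simp)
  then show ?thesis .
qed

lemma mult_matrix_diff:
  assumes I: "I \<in> cell" and i: "1 \<le> i" "i \<le> t"
  shows "(\<Sum>j\<le>t. ypoly (mult_matrix I i j) * gb I j) = monomial (1, 0) * gb I i - monomial (0, d i) * gb I (i - 1)"
proof -
  have "(\<Sum>j\<le>t. ypoly (YM i j + mult_matrix I i j) * gb I j) =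
      (\<Sum>j\<le>t. (if j = i - 1 then monomial (0, d i) * gb I j else 0) + ypoly (mult_matrix I i j) * gb I j)"
    by (rule sum.cong) (use i in \<open>auto simp: YM_def ypoly_add ypoly_monom distrib_right\<close>)
  also have "\<dots> = monomial (0, d i) * gb I (i - 1) + (\<Sum>j\<le>t. ypoly (mult_matrix I i j) * gb I j)"
    using i by (simp add: sum.distrib sum.delta)
  finally show ?thesis using mult_matrix_rel[OF I i] by simp
qed

lemma L_step: "1 \<le> i \<Longrightarrow> i \<le> t \<Longrightarrow> (0, d i) + L (i - 1) = (1, 0) + L i"
  using m_d[of i] by (auto simp: L_def)

text \<open>The leading terms of x g i and y^(d i) g (i-1) cancel, and expansion_bound applies to the rest.\<close>

lemma bounded_mult_matrix:
  assumes I: "I \<in> cell" shows "bounded (mult_matrix I)"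
  unfolding bounded_def
proof (intro allI impI)
  fix i j b assume i: "1 \<le> i" "i \<le> t" and j: "j \<le> t" and c: "Polynomial.coeff (mult_matrix I i j) b \<noteq> 0"
  show "bnd i j b"
    unfolding bnd_def
  proof (rule expansion_bound[OF gb_lead_family[OF I] _ j, where p = "mult_matrix I i"])
    fix v assume v: "v \<in> supp (\<Sum>j\<le>t. ypoly (mult_matrix I i j) * gb I j)"
    let ?f = "monomial (1, 0) * gb I i" and ?g = "monomial (0, d i) * gb I (i - 1)"
    have i1: "i - 1 \<le> t" using i by simp
    have v': "cf (?f - ?g) v \<noteq> 0" using v by (simp add: mult_matrix_diff[OF I i] in_keys_iff)
    have "cf (?f - ?g) ((1, 0) + L i) = cf ?f ((1, 0) + L i) - cf ?g ((0, d i) + L (i - 1))"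
      unfolding lookup_minus L_step[OF i] ..
    also have "\<dots> = 0" unfolding cf_single_mult_add using gb_props(2)[OF I] i i1 by simp
    finally have vne: "v \<noteq> (1, 0) + L i" using v' by auto
    have "cf ?f v \<noteq> 0 \<or> cf ?g v \<noteq> 0" using v' unfolding lookup_minus by (metis diff_self)
    then consider "v \<in> supp ?f" | "v \<in> supp ?g" unfolding in_keys_iff by blast
    then show "wt v < B + 1 + wL i"
    proof cases
      case 1
      then have "v \<in> (+) (1, 0) ` supp (gb I i)" by (rule subsetD[OF supp_single_mult])
      then obtain w where w: "v = (1, 0) + w" "w \<in> supp (gb I i)" by blast
      then have "wt w < wL i" using lead_wt[OF gb_props(3)[OF I i(2)] i(2)] vne by blast
      then show ?thesis unfolding w(1) wt_add by simp
    next
      case 2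
      then have "v \<in> (+) (0, d i) ` supp (gb I (i - 1))" by (rule subsetD[OF supp_single_mult])
      then obtain w where w: "v = (0, d i) + w" "w \<in> supp (gb I (i - 1))" by blast
      then have "wt w < wL (i - 1)"
        using lead_wt[OF gb_props(3)[OF I i1] i1] vne L_step[OF i] by metis
      then show ?thesis unfolding w(1) wt_add wt_y using wL_step[OF i] by linarith
    qed
  qed (rule c)
qed

abbreviation gbc :: "mon \<times> mon \<Rightarrow> 'k::field poly2 set \<Rightarrow> 'k" where
  "gbc uv I \<equiv> gb_coords I uv"

lemma polyfun_on_gb:
  assumes i: "i \<le> t"
  shows "polyfun_on cell gbc (\<lambda>I. cf (gb I i) v)"
proof (cases "v = L i")
  case True
  then show ?thesis
    using gb_props(2) i by (intro polyfun_on.cong[OF polyfun_on.const[of _ _ 1]]) simp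
next
  case False
  then show ?thesis
    using i by (intro polyfun_on.cong[OF polyfun_on.var[of _ _ "(L i, v)"]]) (simp add: gb_coords_cell gb_def)
qed

lemma polyfun2_gb: "i \<le> t \<Longrightarrow> polyfun2 cell gbc (\<lambda>I. gb I i)"
  unfolding polyfun2_def by (intro allI polyfun_on_gb)

text \<open>Comparing coefficients of x g i - y^(d i) g (i-1) at \<open>y\<^sup>b L j\<close> expresses the entry through the Groebner
basis and entries for larger monomials, since g is monic and the other terms of g j are smaller
than L j. So the induction runs downwards in the monomial.\<close>

lemma polyfun_on_mult_matrix:
  assumes i: "1 \<le> i" "i \<le> t" and j: "j \<le> t"
  shows "polyfun_on cell gbc (\<lambda>I. Polynomial.coeff (mult_matrix I i j :: 'k::field poly) b)"
  using j
proof (induction "B + 1 + wL i - (b * B + wL j)" arbitrary: j b rule: less_induct)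
  case less
  show ?case
  proof (cases "bnd i j b")
    case False
    then have "0 = Polynomial.coeff (mult_matrix I i j) b" if "I \<in> cell" for I :: "'k poly2 set"
      using bounded_mult_matrix[OF that] i less.prems unfolding bounded_def by force
    then show ?thesis by (rule polyfun_on.cong[OF polyfun_on.const])
  next
    case True
    define u where "u = (0, b) + L j"
    have u: "u = (fst u, snd u)" "b \<le> snd u" "(fst u, snd u - b) = L j"
      by (auto simp: u_def L_def)
    define R where "R I j' b' = (if j' = j \<and> b' = b then 0 else
        Polynomial.coeff (mult_matrix I i j') b' * cf (gb I j') (fst u, snd u - b'))" for I :: "'k poly2 set" and j' b'
    have other: "polyfun_on cell gbc (\<lambda>I. R I j' b')" if j': "j' \<in> {..t}" and b': "b' \<in> {..snd u}" for j' b'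
    proof (cases "b' * B + wL j' > b * B + wL j")
      case less': True
      have "polyfun_on cell gbc (\<lambda>I. Polynomial.coeff (mult_matrix I i j' :: 'k poly) b')"
        by (rule less.hyps) (use less' True j' in \<open>auto simp: bnd_def\<close>)
      then have "polyfun_on cell gbc (\<lambda>I. Polynomial.coeff (mult_matrix I i j' :: 'k poly) b' * cf (gb I j') (fst u, snd u - b'))"
        using j' by (intro polyfun_on.mult polyfun_on_gb) auto
      then show ?thesis
        unfolding R_def by (cases "j' = j"; cases "b' = b") (simp_all add: polyfun_on.const)
    next
      case nless: False
      have "0 = R I j' b'" if I: "I \<in> cell" for I
      proof (rule ccontr)
        assume "0 \<noteq> R I j' b'"
        then have ne: "\<not> (j' = j \<and> b' = b)" "(fst u, snd u - b') \<in> supp (gb I j')"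
          by (auto simp: R_def in_keys_iff split: if_splits)
        have uu: "u = (0, b') + (fst u, snd u - b')" using b' by (cases u) auto
        have "(fst u, snd u - b') \<noteq> L j'"
        proof
          assume eq: "(fst u, snd u - b') = L j'"
          then have "(0, b') + L j' = (0, b) + L j" using uu by (simp add: u_def)
          then have "t - j' = t - j" "b' + m j' = b + m j" by (auto simp: L_def)
          moreover from this(1) have "j' = j" using j' less.prems by simp
          ultimately show False using ne(1) by simp
        qed
        moreover have j't: "j' \<le> t" using j' by simp
        ultimately have "wt (fst u, snd u - b') < wL j'"
          using lead_wt[OF gb_props(3)[OF I j't] j't ne(2)] by blast
        moreover have "wt u = b' * B + wt (fst u, snd u - b')" by (subst uu) (simp only: wt_add wt_y)
        moreover have "wt u = b * B + wL j" by (simp only: u_def wt_add wt_y)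
        ultimately show False using nless by linarith
      qed
      then show ?thesis by (rule polyfun_on.cong[OF polyfun_on.const])
    qed
    have eq: "cf (monomial (1, 0) * gb I i - monomial (0, d i) * gb I (i - 1)) u - (\<Sum>j'\<le>t. \<Sum>b'\<le>snd u. R I j' b')
        = Polynomial.coeff (mult_matrix I i j) b" if I: "I \<in> cell" for I
    proof -
      have "cf (monomial (1, 0) * gb I i - monomial (0, d i) * gb I (i - 1)) u =
        (\<Sum>j'\<le>t. \<Sum>b'\<le>snd u. Polynomial.coeff (mult_matrix I i j') b' * cf (gb I j') (fst u, snd u - b'))"
        unfolding mult_matrix_diff[OF I i, symmetric] lookup_sum
        by (rule sum.cong[OF refl], subst u(1), rule cf_ypoly_mult)
      also have "\<dots> = (\<Sum>j'\<le>t. \<Sum>b'\<le>snd u. R I j' b' +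
          (if b' = b then if j' = j then Polynomial.coeff (mult_matrix I i j) b else 0 else 0))"
        by (intro sum.cong refl) (use gb_props(2)[OF I less.prems] u(3) in \<open>auto simp: R_def\<close>)
      also have "\<dots> = (\<Sum>j'\<le>t. \<Sum>b'\<le>snd u. R I j' b') + Polynomial.coeff (mult_matrix I i j) b"
        using u(2) less.prems by (simp add: sum.distrib sum.delta)
      finally show ?thesis by simp
    qed
    have "polyfun_on cell gbc (\<lambda>I. cf (monomial (1, 0) * gb I i - monomial (0, d i) * gb I (i - 1)) u -
        (\<Sum>j'\<le>t. \<Sum>b'\<le>snd u. R I j' b'))"
      by (intro polyfun_on_diff polyfun_on_sum other polyfun2D[OF polyfun2_diff[OF polyfun2_mult polyfun2_mult]]
          polyfun2_const polyfun2_gb) (use i in auto)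
    then show ?thesis by (rule polyfun_on.cong) (rule eq)
  qed
qed

lemma polyfun_on_canonical_coords:
  "polyfun_on cell gbc (\<lambda>I. gauge_sol (mult_matrix I) s :: 'k::field)"
  by (rule polyfun_on_gauge_sol) (simp_all add: bounded_mult_matrix polyfun_on_mult_matrix)

definition cmat :: "(nat \<times> nat \<times> nat \<Rightarrow> 'k::field) \<Rightarrow> nat \<Rightarrow> nat \<Rightarrow> 'k poly" where
  "cmat c i j = mkpoly (form_coeff c i j)"

definition minor_ideal :: "(nat \<times> nat \<times> nat \<Rightarrow> 'k::field) \<Rightarrow> 'k poly2 set" where
  "minor_ideal c = ideal_gen (minor (cmat c) ` {..t})"

lemma canonical_cmat: "canonical (cmat c)"
  by (auto simp: canonical_def cmat_def coeff_mkpoly_form) (auto simp: form_coeff_def split: if_splits)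

lemma bounded_cmat: "bounded (cmat c)"
  using canonical_cmat canonical_bounded by blast

lemma minor_cmat_rel:
  assumes "1 \<le> i" "i \<le> t"
  shows "monomial (1, 0) * minor (cmat c) i = (\<Sum>j\<le>t. ypoly (YM i j + cmat c i j) * minor (cmat c) j)"
  using minor_relation[OF assms, of "cmat c"] rel_entry_relation[OF assms(2)] by blast

lemma minor_family: "lead_family (minor (cmat c))"
  by (simp add: lead_family_def minor_lead(2)[OF bounded_cmat])

lemma minor_ideal_cell: "minor_ideal c \<in> cell"
  unfolding cell_def minor_ideal_def
  using family_ideal[OF minor_family minor_cmat_rel] by (simp add: ideal_gen_ideal)

lemma minor_in_minor_ideal: "i \<le> t \<Longrightarrow> minor (cmat c) i \<in> minor_ideal c"
  unfolding minor_ideal_def using ideal_gen_superset[of "minor (cmat c) ` {..t}"] by auto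

lemma polyfun2_minor_cmat: "polyfun2 (affine_space S) coord (\<lambda>c. minor (cmat c) k)"
proof (rule polyfun2_minor)
  fix i j b
  show "polyfun_on (affine_space S) coord (\<lambda>c :: nat \<times> nat \<times> nat \<Rightarrow> 'a. Polynomial.coeff (cmat c i j) b)"
  proof (cases "b < B \<and> (i, j, b) \<in> S")
    case True
    then show ?thesis using polyfun_on.var[of _ coord "(i, j, b)"] by (simp add: cmat_def coeff_mkpoly form_coeff_def)
  next
    case False
    then have "Polynomial.coeff (cmat c i j) b = 0" for c :: "nat \<times> nat \<times> nat \<Rightarrow> 'a"
      by (auto simp: cmat_def coeff_mkpoly form_coeff_def)
    then show ?thesis by (simp add: polyfun_on.const)
  qed
qed

text \<open>The induction of normal_form_monomial, carried out simultaneously for all c. No division is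
needed because the minors are monic.\<close>

lemma normal_form_polynomial:
  "\<exists>r :: (nat \<times> nat \<times> nat \<Rightarrow> 'k::field) \<Rightarrow> 'k poly2. polyfun2 (affine_space S) coord r \<and>
     (\<forall>c. monomial u - r c \<in> minor_ideal c \<and> supp (r c) \<inter> M = {})"
proof (induction u rule: drl_induct)
  case (1 u)
  show ?case
  proof (cases "u \<in> M")
    case False
    then show ?thesis
      by (intro exI[of _ "\<lambda>_. monomial u"])
        (auto simp: polyfun2_const ideal_zero[OF cellD(1)[OF minor_ideal_cell]])
  next
    case True
    let ?D = "{v. drl_less v u}"
    have "\<forall>v\<in>?D. \<exists>r :: (nat \<times> nat \<times> nat \<Rightarrow> 'k) \<Rightarrow> 'k poly2. polyfun2 (affine_space S) coord r \<and>
        (\<forall>c. monomial v - r c \<in> minor_ideal c \<and> supp (r c) \<inter> M = {})" using 1 by blast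
    from bchoice[OF this] obtain r where r: "\<forall>v\<in>?D. polyfun2 (affine_space S) coord (r v) \<and>
        (\<forall>c :: nat \<times> nat \<times> nat \<Rightarrow> 'k. monomial v - r v c \<in> minor_ideal c \<and> supp (r v c) \<inter> M = {})" ..
    obtain i s where i: "i \<le> t" "u = s + L i" using True by (auto simp: M_def mon_dvd_iff)
    define f where "f c = monomial s * minor (cmat c) i" for c :: "nat \<times> nat \<times> nat \<Rightarrow> 'k"
    have fI: "f c \<in> minor_ideal c" for c
      unfolding f_def by (rule ideal_mult[OF cellD(1)[OF minor_ideal_cell] minor_in_minor_ideal[OF i(1)]])
    have fl: "is_lead (f c) u" for c
      unfolding f_def i(2) by (rule is_lead_single_mult) (simp_all add: minor_lead(2)[OF bounded_cmat i(1)])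
    have f1: "cf (f c) u = 1" for c
      unfolding f_def i(2) cf_single_mult_add by (simp add: minor_lead(1)[OF bounded_cmat i(1)])
    have fP: "polyfun2 (affine_space S) coord f"
      unfolding f_def by (intro polyfun2_mult polyfun2_const polyfun2_minor_cmat)
    define R where "R c = (\<Sum>v\<in>?D. Poly_Mapping.single 0 (- cf (f c) v) * r v c)" for c
    have "polyfun2 (affine_space S) coord R"
      unfolding polyfun2_def
    proof
      fix w
      have "polyfun_on (affine_space S) coord (\<lambda>c. \<Sum>v\<in>?D. - cf (f c) v * cf (r v c) w)"
      proof (rule polyfun_on_sum)
        fix v assume "v \<in> ?D"
        then show "polyfun_on (affine_space S) coord (\<lambda>c. - cf (f c) v * cf (r v c) w)"
          by (intro polyfun_on.mult polyfun_on_uminus polyfun2D[OF fP] polyfun2D[of _ _ "r v"]) (use r in blast)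
      qed
      then show "polyfun_on (affine_space S) coord (\<lambda>c. cf (R c) w)"
        unfolding R_def lookup_sum single_mult_cf .
    qed
    moreover have "monomial u - R c \<in> minor_ideal c" for c
    proof -
      define Sg where "Sg = (\<Sum>v\<in>?D. Poly_Mapping.single v (cf (f c) v))"
      \<comment> \<open>All terms of f c except the leading one lie below u, so that the sum may run over the same
        index set for all c.\<close>
      have "f c = monomial u + Sg"
        unfolding Sg_def
      proof (rule poly_mapping_eqI)
        fix w
        have "cf (\<Sum>v\<in>?D. Poly_Mapping.single v (cf (f c) v)) w = (if drl_less w u then cf (f c) w else 0)"
          using finite_drl_below[of u] by (simp add: lookup_sum lookup_single when_def sum.delta)
        then show "cf (f c) w = cf (monomial u + (\<Sum>v\<in>?D. Poly_Mapping.single v (cf (f c) v))) w"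
          using is_leadD[OF fl[of c], of w] f1[of c] by (auto simp: lookup_add lookup_single when_def)
      qed
      moreover have "(\<Sum>v\<in>?D. Poly_Mapping.single 0 (cf (f c) v) * (monomial v - r v c)) =
          Sg + R c"
        by (simp add: Sg_def R_def right_diff_distrib sum_subtractf sum_negf single_uminus mult_single)
      ultimately have "monomial u - R c = f c - (\<Sum>v\<in>?D. Poly_Mapping.single 0 (cf (f c) v) * (monomial v - r v c))"
        by simp
      also have "\<dots> \<in> minor_ideal c"
        by (rule ideal_diff[OF cellD(1)[OF minor_ideal_cell] fI],
            intro ideal_sum[OF cellD(1)[OF minor_ideal_cell]] ideal_mult[OF cellD(1)[OF minor_ideal_cell]])
          (use r in blast)
      finally show ?thesis .
    qed
    moreover have "supp (R c) \<inter> M = {}" for c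
    proof -
      have "cf (R c) w = 0" if "w \<in> M" for w
        unfolding R_def lookup_sum single_mult_cf
      proof (rule sum.neutral, rule ballI)
        fix v assume "v \<in> ?D"
        then have "w \<notin> supp (r v c)" using r that by blast
        then show "- cf (f c) v * cf (r v c) w = 0" by (simp add: in_keys_iff)
      qed
      then show ?thesis by (auto simp: in_keys_iff)
    qed
    ultimately show ?thesis by blast
  qed
qed

lemma polyfun_on_gb_coords_minor_ideal:
  "polyfun_on (affine_space S) coord (\<lambda>c. gb_coords (minor_ideal c) uv :: 'k::field)"
proof -
  obtain u v where uv: "uv = (u, v)" by (cases uv)
  show ?thesis
  proof (cases "u \<in> L ` {..t} \<and> v \<noteq> u")
    case True
    obtain r where r: "polyfun2 (affine_space S) coord r"
      "\<And>c :: nat \<times> nat \<times> nat \<Rightarrow> 'k. monomial u - r c \<in> minor_ideal c \<and> supp (r c) \<inter> M = {}"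
      using normal_form_polynomial[of u] by blast
    have "u \<in> M" using True L_in_M by auto
    then have ur: "cf (r c) u = 0" for c using r(2)[of c] by (auto simp: in_keys_iff)
    have "gb_coords (minor_ideal c) uv = - cf (r c) v" for c
    proof -
      have "red (minor_ideal c) u = monomial u - r c"
      proof (rule red_eqI[OF cellD(1)[OF minor_ideal_cell]])
        show "monomial u - r c \<in> minor_ideal c" using r by blast
        show "cf (monomial u - r c) u = 1" by (simp add: lookup_minus ur)
        show "supp (monomial u - r c) \<inter> lead_mons (minor_ideal c) \<subseteq> {u}"
          unfolding cellD(2)[OF minor_ideal_cell] using r(2)[of c]
          by (auto simp: in_keys_iff lookup_minus lookup_single when_def split: if_splits)
      qed
      then show ?thesis using True by (auto simp: uv gb_coords_cell[OF minor_ideal_cell] lookup_minus lookup_single when_def)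
    qed
    then show ?thesis using polyfun_on_uminus[OF polyfun2D[OF r(1)]] by simp
  next
    case False
    then have "gb_coords (minor_ideal c) uv = 0" for c :: "nat \<times> nat \<times> nat \<Rightarrow> 'k"
      unfolding uv gb_coords_cell[OF minor_ideal_cell] by argo
    then show ?thesis by (simp add: polyfun_on.const)
  qed
qed

text \<open>Expand x f i in the K[y]-basis g in two ways, through the relations of g and through those of f.\<close>

lemma change_basis:
  fixes f g :: "nat \<Rightarrow> 'k::field poly2"
  assumes g: "lead_family g"
    and rel: "\<And>i. 1 \<le> i \<Longrightarrow> i \<le> t \<Longrightarrow> monomial (1, 0) * g i = (\<Sum>j\<le>t. ypoly (YM i j + e i j) * g j)"
    and f: "\<And>i. i \<le> t \<Longrightarrow> f i = (\<Sum>j\<le>t. ypoly ((if i = j then 1 else 0) + a i j) * g j)"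
    and a0: "\<And>i. 1 \<le> i \<Longrightarrow> i \<le> t \<Longrightarrow> a i 0 = 0"
  shows "(\<forall>i. 1 \<le> i \<longrightarrow> i \<le> t \<longrightarrow> monomial (1, 0) * f i = (\<Sum>k\<le>t. ypoly (YM i k + c i k) * f k))
    \<longleftrightarrow> conjugates a e c"
proof -
  let ?A = "\<lambda>i j. (if i = j then 1 else 0) + a i j"
  have left: "monomial (1, 0) * f i = (\<Sum>j\<le>t. ypoly (\<Sum>k\<in>{1..t}. ?A i k * (YM k j + e k j)) * g j)"
    if i: "1 \<le> i" "i \<le> t" for i
  proof -
    have "monomial (1, 0) * f i = (\<Sum>k\<le>t. ypoly (?A i k) * (monomial (1, 0) * g k))"
      by (simp add: f[OF i(2)] sum_distrib_left mult.left_commute)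
    also have "\<dots> = (\<Sum>k\<in>{1..t}. ypoly (?A i k) * (monomial (1, 0) * g k))"
    proof (rule sum.mono_neutral_right)
      show "\<forall>k\<in>{..t} - {1..t}. ypoly (?A i k) * (monomial (1, 0) * g k) = 0"
      proof
        fix k assume "k \<in> {..t} - {1..t}"
        then have "k = 0" by auto
        then show "ypoly (?A i k) * (monomial (1, 0) * g k) = 0" using a0[OF i] i by simp
      qed
    qed auto
    also have "\<dots> = (\<Sum>k\<in>{1..t}. \<Sum>j\<le>t. ypoly (?A i k * (YM k j + e k j)) * g j)"
    proof (rule sum.cong[OF refl])
      fix k assume "k \<in> {1..t}"
      then have k: "1 \<le> k" "k \<le> t" by auto
      show "ypoly (?A i k) * (monomial (1, 0) * g k) = (\<Sum>j\<le>t. ypoly (?A i k * (YM k j + e k j)) * g j)"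
        unfolding rel[OF k] by (simp only: sum_distrib_left ypoly_mult mult.assoc)
    qed
    also have "\<dots> = (\<Sum>j\<le>t. \<Sum>k\<in>{1..t}. ypoly (?A i k * (YM k j + e k j)) * g j)" by (rule sum.swap)
    also have "\<dots> = (\<Sum>j\<le>t. ypoly (\<Sum>k\<in>{1..t}. ?A i k * (YM k j + e k j)) * g j)"
      by (simp add: ypoly_sum sum_distrib_right)
    finally show ?thesis .
  qed
  have right: "(\<Sum>k\<le>t. ypoly (YM i k + c i k) * f k) =
      (\<Sum>j\<le>t. ypoly (\<Sum>k\<le>t. (YM i k + c i k) * ?A k j) * g j)" for i
  proof -
    have "(\<Sum>k\<le>t. ypoly (YM i k + c i k) * f k) = (\<Sum>k\<le>t. \<Sum>j\<le>t. ypoly ((YM i k + c i k) * ?A k j) * g j)"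
      by (rule sum.cong[OF refl]) (simp add: f sum_distrib_left ypoly_mult mult.assoc)
    also have "\<dots> = (\<Sum>j\<le>t. \<Sum>k\<le>t. ypoly ((YM i k + c i k) * ?A k j) * g j)" by (rule sum.swap)
    also have "\<dots> = (\<Sum>j\<le>t. ypoly (\<Sum>k\<le>t. (YM i k + c i k) * ?A k j) * g j)"
      by (simp add: ypoly_sum sum_distrib_right)
    finally show ?thesis .
  qed
  show ?thesis
  proof
    assume *: "\<forall>i. 1 \<le> i \<longrightarrow> i \<le> t \<longrightarrow> monomial (1, 0) * f i = (\<Sum>k\<le>t. ypoly (YM i k + c i k) * f k)"
    show "conjugates a e c"
      unfolding conjugates_def
    proof (intro allI impI)
      fix i j assume ij: "1 \<le> i" "i \<le> t" "j \<le> t"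
      have rel_i: "monomial (1, 0) * f i = (\<Sum>k\<le>t. ypoly (YM i k + c i k) * f k)" using * ij by blast
      show "(\<Sum>k\<in>{1..t}. ?A i k * (YM k j + e k j)) = (\<Sum>k\<le>t. (YM i k + c i k) * ?A k j)"
        by (rule expansion_unique[OF g rel_i[unfolded left[OF ij(1,2)] right] ij(3)])
    qed
  next
    assume *: "conjugates a e c"
    show "\<forall>i. 1 \<le> i \<longrightarrow> i \<le> t \<longrightarrow> monomial (1, 0) * f i = (\<Sum>k\<le>t. ypoly (YM i k + c i k) * f k)"
    proof (intro allI impI)
      fix i assume i: "1 \<le> i" "i \<le> t"
      show "monomial (1, 0) * f i = (\<Sum>k\<le>t. ypoly (YM i k + c i k) * f k)"
        unfolding left[OF i] right
        by (rule sum.cong[OF refl]) (use * i in \<open>simp add: conjugates_def\<close>)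
    qed
  qed
qed

text \<open>The minors and the reduced Groebner basis g are two bases of the same kind of the same ideal, so
they differ by a unipotent matrix, which conjugates \<open>mult_matrix\<close> into the canonical matrix c; now
apply uniqueness of the canonical form. Column 0 of the unipotent matrix vanishes because
neither the minors nor the g i with i \<ge> 1 contain a multiple of x^t.\<close>

lemma canonical_coords_minor_ideal:
  fixes c :: "nat \<times> nat \<times> nat \<Rightarrow> 'k::field"
  assumes s: "s \<in> S"
  shows "gauge_sol (mult_matrix (minor_ideal c)) s = c s"
proof -
  let ?I = "minor_ideal c"
  note I = minor_ideal_cell[of c]
  note min = minor_lead[OF bounded_cmat[of c]]
  have "\<exists>p. minor (cmat c) i = (\<Sum>j\<le>t. ypoly (p j) * gb ?I j)" if i: "i \<le> t" for i
    by (rule expansion_ex[OF cellD[OF I] gb_lead_family[OF I]])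
      (use gb_props(1)[OF I] gb_fst(1)[OF I] minor_in_minor_ideal[OF i] min(3)[OF i] in \<open>fastforce split: if_splits\<close>)+
  then have "\<forall>i\<in>{..t}. \<exists>p. minor (cmat c) i = (\<Sum>j\<le>t. ypoly (p j) * gb ?I j)" by blast
  from bchoice[OF this] obtain A where A: "\<forall>i\<in>{..t}. minor (cmat c) i = (\<Sum>j\<le>t. ypoly (A i j) * gb ?I j)" ..
  define a where "a i j = A i j - (if i = j then 1 else 0)" for i j
  have f: "minor (cmat c) i = (\<Sum>j\<le>t. ypoly ((if i = j then 1 else 0) + a i j) * gb ?I j)" if "i \<le> t" for i
    using A that by (simp add: a_def)
  have a0: "a i 0 = 0" if i: "1 \<le> i" "i \<le> t" for i
  proof (rule poly_eqI)
    fix b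
    have "cf (ypoly (A i j) * gb ?I j) (t, b) = (if j = 0 then Polynomial.coeff (A i 0) b else 0)" if j: "j \<in> {..t}" for j
    proof -
      have g: "cf (gb ?I j) (t, b') = (if j = 0 \<and> b' = 0 then 1 else 0)" for b'
      proof (cases "(t, b') \<in> supp (gb ?I j)")
        case True
        then have "(t, b') = L 0" "j = 0" using gb_fst(2,3)[OF I, of j "(t, b')"] j by (auto intro: ccontr)
        then show ?thesis using gb_props(2)[OF I, of 0] by (simp add: L_def m_0)
      next
        case False
        then show ?thesis using gb_props(2)[OF I, of 0] by (cases "j = 0"; cases "b' = 0") (auto simp: in_keys_iff L_def m_0)
      qed
      have "cf (ypoly (A i j) * gb ?I j) (t, b) = (\<Sum>l\<le>b. if l = b then (if j = 0 then Polynomial.coeff (A i 0) b else 0) else 0)"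
        unfolding cf_ypoly_mult g by (rule sum.cong) auto
      then show ?thesis by (simp add: sum.delta)
    qed
    then have "cf (minor (cmat c) i) (t, b) = Polynomial.coeff (A i 0) b"
      using A i by (simp add: lookup_sum sum.delta)
    moreover have "(t, b) \<notin> supp (minor (cmat c) i)" using min(3)[of i "(t, b)"] i by auto
    ultimately show "Polynomial.coeff (a i 0) b = Polynomial.coeff 0 b"
      using i by (simp add: a_def in_keys_iff)
  qed
  have "unipotent a"
    unfolding unipotent_def
  proof (intro allI impI)
    fix i j b assume ij: "i \<le> t" "j \<le> t" and c: "Polynomial.coeff (a i j) b \<noteq> 0"
    have diff: "(\<Sum>j\<le>t. ypoly (a i j) * gb ?I j) = minor (cmat c) i - gb ?I i"
    proof -
      have "minor (cmat c) i = (\<Sum>j\<le>t. (if i = j then gb ?I j else 0) + ypoly (a i j) * gb ?I j)"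
        unfolding f[OF ij(1)] by (rule sum.cong) (auto simp: ypoly_add distrib_right)
      also have "\<dots> = gb ?I i + (\<Sum>j\<le>t. ypoly (a i j) * gb ?I j)" using ij by (simp add: sum.distrib)
      finally show ?thesis by simp
    qed
    have low: "b * B + wL j < wL i"
    proof (rule expansion_bound[OF gb_lead_family[OF I] _ ij(2), where p = "a i"])
      fix v assume "v \<in> supp (\<Sum>j\<le>t. ypoly (a i j) * gb ?I j)"
      then have v: "cf (minor (cmat c) i) v \<noteq> cf (gb ?I i) v" by (simp add: diff in_keys_iff lookup_minus)
      then have "v \<noteq> L i" using min(1)[OF ij(1)] gb_props(2)[OF I ij(1)] by auto
      moreover have "v \<in> supp (minor (cmat c) i) \<or> v \<in> supp (gb ?I i)" using v by (auto simp: in_keys_iff)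
      ultimately show "wt v < wL i"
        using lead_wt[OF min(2)[OF ij(1)] ij(1)] lead_wt[OF gb_props(3)[OF I ij(1)] ij(1)] by blast
    qed (rule c)
    moreover have "j \<noteq> 0"
    proof
      assume "j = 0"
      then have "i = 0" using a0[of i] c ij by (cases i) auto
      then show False using low \<open>j = 0\<close> by simp
    qed
    ultimately show "conj_valid i j b" using ij by (auto simp: conj_valid_def)
  qed
  moreover have "conjugates a (mult_matrix ?I) (cmat c)"
    using change_basis[OF gb_lead_family[OF I] mult_matrix_rel[OF I] f a0, of "cmat c"] minor_cmat_rel by blast
  moreover obtain i j b where ijb: "s = (i, j, b)" by (cases s)
  ultimately have "Polynomial.coeff (cmat c i j) b = gauge_sol (mult_matrix ?I) (i, j, b)"
    using canonical_form_unique[OF bounded_mult_matrix[OF I] canonical_cmat] s by blast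
  moreover have "Polynomial.coeff (cmat c i j) b = c (i, j, b)"
  proof -
    have "i \<le> t" using s by (simp add: ijb S_def Q_def)
    then show ?thesis using s by (simp add: cmat_def coeff_mkpoly_form form_coeff_def ijb)
  qed
  ultimately show ?thesis by (simp add: ijb)
qed

text \<open>Bring \<open>mult_matrix\<close> into canonical form. The transformed basis f satisfies the same relations as the
minors and has the same leading terms, so the difference vanishes by kernel_below_zero. Hence I contains the
ideal of the minors, and these two ideals have the same leading monomials.\<close>

lemma cell_is_minor_ideal:
  fixes I :: "'k::field poly2 set"
  assumes I: "I \<in> cell"
  shows "\<exists>c\<in>affine_space S. I = minor_ideal c"
proof -
  let ?e = "mult_matrix I"
  define c where "c s = (if s \<in> S then gauge_sol ?e s else 0)" for s
  have cm: "cmat c = (\<lambda>i j. mkpoly (form_coeff (gauge_sol ?e) i j))"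
    by (intro ext) (auto simp: cmat_def form_coeff_def c_def intro!: arg_cong[of _ _ mkpoly])
  obtain a where a: "unipotent a" "conjugates a ?e (cmat c)"
    using canonical_form_exists(2)[OF bounded_mult_matrix[OF I]] cm by metis
  define f where "f i = (\<Sum>j\<le>t. ypoly ((if i = j then 1 else 0) + a i j) * gb I j)" for i
  have a0: "a i 0 = 0" if "1 \<le> i" "i \<le> t" for i
    by (rule poly_eqI) (use a(1) that in \<open>force simp: unipotent_def conj_valid_def\<close>)
  have rel: "monomial (1, 0) * f i = (\<Sum>k\<le>t. ypoly (YM i k + cmat c i k) * f k)" if "1 \<le> i" "i \<le> t" for i
    using change_basis[OF gb_lead_family[OF I] mult_matrix_rel[OF I] f_def a0, of "cmat c"] a(2) that by blast
  have fI: "f i \<in> I" for i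
    unfolding f_def by (intro ideal_sum ideal_mult cellD(1)[OF I]) (use gb_props(1)[OF I] in auto)
  have fi: "f i = gb I i + (\<Sum>j\<le>t. ypoly (a i j) * gb I j)" if "i \<le> t" for i
  proof -
    have "f i = (\<Sum>j\<le>t. (if i = j then gb I j else 0) + ypoly (a i j) * gb I j)"
      unfolding f_def by (rule sum.cong) (auto simp: ypoly_add distrib_right)
    then show ?thesis using that by (simp add: sum.distrib)
  qed
  have low: "wt v < wL i" if i: "i \<le> t" and v: "v \<in> supp (\<Sum>j\<le>t. ypoly (a i j) * gb I j)" for i v
  proof -
    obtain j where j: "j \<le> t" "v \<in> supp (ypoly (a i j) * gb I j)"
      using v keys_sum[of "\<lambda>j. ypoly (a i j) * gb I j" "{..t}"] by auto
    then obtain w1 w2 where w: "v = w1 + w2" "w1 \<in> supp (ypoly (a i j))" "w2 \<in> supp (gb I j)"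
      using keys_mult[of "ypoly (a i j)" "gb I j"] by blast
    then obtain b where b: "w1 = (0, b)" "Polynomial.coeff (a i j) b \<noteq> 0"
      by (cases w1) (auto simp: in_keys_iff cf_ypoly split: if_splits)
    have "b * B + wL j < wL i" using a(1) i j(1) b(2) unfolding unipotent_def conj_valid_def by blast
    moreover have "wt w2 \<le> wL j" using lead_wt[OF gb_props(3)[OF I j(1)] j(1) w(3)] by (cases "w2 = L j") auto
    moreover have "wt v = b * B + wt w2" by (simp only: w(1) b(1) wt_add wt_y)
    ultimately show ?thesis by linarith
  qed
  have f1: "cf (f i) (L i) = 1" if "i \<le> t" for i
  proof -
    have "L i \<notin> supp (\<Sum>j\<le>t. ypoly (a i j) * gb I j)" using low[OF that, of "L i"] by blast
    then show ?thesis using gb_props(2)[OF I that] by (simp add: fi[OF that] lookup_add in_keys_iff)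
  qed
  have flow: "wt v < wL i" if i: "i \<le> t" and v: "v \<in> supp (f i)" "v \<noteq> L i" for i v
  proof -
    have "v \<in> supp (gb I i) \<or> v \<in> supp (\<Sum>j\<le>t. ypoly (a i j) * gb I j)"
      using v(1) keys_add[of "gb I i" "\<Sum>j\<le>t. ypoly (a i j) * gb I j"] by (auto simp: fi[OF i])
    then show ?thesis using low[OF i] lead_wt[OF gb_props(3)[OF I i] i _ v(2)] by blast
  qed
  have eq: "f i - minor (cmat c) i = 0" if "i \<le> t" for i
  proof (rule kernel_below_zero[OF bounded_cmat _ _ that])
    fix i v assume i: "i \<le> t" and v: "v \<in> supp (f i - minor (cmat c) i)"
    have "cf (f i) v \<noteq> cf (minor (cmat c) i) v" using v by (simp add: in_keys_iff lookup_minus)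
    then have "v \<noteq> L i" "v \<in> supp (f i) \<or> v \<in> supp (minor (cmat c) i)"
      using f1[OF i] minor_lead(1)[OF bounded_cmat[of c] i] by (auto simp: in_keys_iff)
    then show "wt v < wL i" using flow[OF i] lead_wt[OF minor_lead(2)[OF bounded_cmat i] i] by blast
  next
    fix i assume i: "1 \<le> i" "i \<le> t"
    show "monomial (1, 0) * (f i - minor (cmat c) i) =
        (\<Sum>j\<le>t. ypoly (YM i j + cmat c i j) * (f j - minor (cmat c) j))"
      by (simp only: right_diff_distrib sum_subtractf rel[OF i] minor_cmat_rel[OF i])
  qed
  have "minor (cmat c) i \<in> I" if "i \<le> t" for i using eq[OF that] fI[of i] by simp
  then have sub: "minor_ideal c \<subseteq> I"
    unfolding minor_ideal_def by (intro ideal_gen_least cellD(1)[OF I]) auto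
  have "minor_ideal c = I"
    by (rule ideal_eq_of_lead_mons[OF cellD(1)[OF minor_ideal_cell] cellD(1)[OF I] sub])
      (simp add: cellD(2)[OF I] cellD(2)[OF minor_ideal_cell])
  moreover have "c \<in> affine_space S" by (simp add: affine_space_def c_def)
  ultimately show ?thesis by blast
qed

text \<open>The polynomial \<open>F s\<close> computes the coordinate s of the canonical matrix from the Groebner basis
coordinates.\<close>

theorem dim_points_monspan:
  assumes "infinite (UNIV :: 'k::field set)"
  shows "dim_points (monspan M :: 'k poly2 set) = ereal (card S)"
proof -
  let ?T = "gb_coords ` (cell :: 'k poly2 set set)"
  have "\<forall>s. \<exists>f. \<forall>I\<in>cell. gauge_sol (mult_matrix I) s = mpoly_eval f (\<lambda>uv. gb_coords I uv :: 'k)"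
    using polyfun_on_canonical_coords[unfolded polyfun_on_iff_mpoly] by blast
  then obtain F where F: "\<And>s I. I \<in> cell \<Longrightarrow> gauge_sol (mult_matrix I) s = mpoly_eval (F s) (gb_coords I :: _ \<Rightarrow> 'k)"
    by metis
  show ?thesis
    unfolding dim_points_def cell_V
  proof (rule krull_dim_parametrized[where \<Phi> = "\<lambda>c. gb_coords (minor_ideal c)" and \<Psi> = "\<lambda>s. mpoly_eval (F s)", OF assms finite_S])
    show "?T = (\<lambda>c. gb_coords (minor_ideal c)) ` affine_space S"
      using cell_is_minor_ideal minor_ideal_cell by fast
    show "polyfun_on (affine_space S) coord (\<lambda>c. gb_coords (minor_ideal c) i)" for i
      by (rule polyfun_on_gb_coords_minor_ideal)
    show "polyfun_on ?T coord (mpoly_eval (F s))" for s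
      by (auto simp: polyfun_on_iff_mpoly)
    show "mpoly_eval (F s) (gb_coords (minor_ideal c)) = c s" if "s \<in> S" for s c
      using F[OF minor_ideal_cell] canonical_coords_minor_ideal[OF that] by metis
  qed
qed

end

lemma cf_poly_scale: "cf (poly_scale c f) v = c * cf f v"
  by (simp add: poly_scale_def zero_prod_def[symmetric] single_mult_cf)

section \<open>Quotients of spans of monomials\<close>

lemma monomial_eq_iff: "(monomial u :: 'k::field poly2) = monomial v \<longleftrightarrow> u = v"
  by (metis lookup_single_eq lookup_single_not_eq one_neq_zero)

definition restr :: "mon set \<Rightarrow> 'k::field poly2 \<Rightarrow> 'k poly2" where
  "restr A f = (\<Sum>u\<in>supp f. if u \<in> A then Poly_Mapping.single u (cf f u) else 0)"

lemma cf_restr: "cf (restr A f) v = (if v \<in> A then cf f v else 0)"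
proof -
  have "cf (restr A f) v = (\<Sum>u\<in>supp f. if u = v then (if v \<in> A then cf f v else 0) else 0)"
    unfolding restr_def lookup_sum by (rule sum.cong) (auto simp: lookup_single when_def)
  then show ?thesis by (auto simp: sum.delta in_keys_iff)
qed

lemma linear_restr: "Vector_Spaces.linear poly_scale poly_scale (restr A :: 'k::field poly2 \<Rightarrow> 'k poly2)"
  unfolding Vector_Spaces.linear_iff
  by (auto simp: vector_space_poly_scale poly_mapping_eq_iff fun_eq_iff cf_restr lookup_add cf_poly_scale)

lemma monspan_span:
  "(monspan A :: 'k::field poly2 set) = Modules.module.span poly_scale (monomial ` A)"
proof -
  interpret vs: vector_space "poly_scale :: 'k \<Rightarrow> 'k poly2 \<Rightarrow> 'k poly2" by (rule vector_space_poly_scale)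
  show ?thesis
  proof
    show "monspan A \<subseteq> vs.span (monomial ` A)"
    proof
      fix f :: "'k poly2" assume f: "f \<in> monspan A"
      have "Poly_Mapping.single u (cf f u) \<in> vs.span (monomial ` A)" if u: "u \<in> supp f" for u
      proof -
        have "monomial u \<in> vs.span (monomial ` A)" using f u by (auto simp: monspan_def intro: vs.span_base)
        from vs.span_scale[OF this, of "cf f u"] show ?thesis
          by (simp add: poly_scale_def mult_single zero_prod_def[symmetric])
      qed
      then show "f \<in> vs.span (monomial ` A)" by (subst poly2_eq_sum[of f]) (rule vs.span_sum)
    qed
    have "vs.subspace (monspan A)"
    proof (rule vs.subspaceI)
      fix f g :: "'k poly2" and c
      assume f: "f \<in> monspan A"
      show "poly_scale c f \<in> monspan A" using f by (auto simp: monspan_def in_keys_iff cf_poly_scale)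
      assume "g \<in> monspan A"
      then show "f + g \<in> monspan A" using f keys_add[of f g] by (auto simp: monspan_def)
    qed (simp add: monspan_def)
    then show "vs.span (monomial ` A) \<subseteq> monspan A" by (intro vs.span_minimal) auto
  qed
qed

lemma independent_monomials:
  "\<not> Modules.module.dependent poly_scale (monomial ` A :: 'k::field poly2 set)"
proof
  interpret vs: vector_space "poly_scale :: 'k \<Rightarrow> 'k poly2 \<Rightarrow> 'k poly2" by (rule vector_space_poly_scale)
  assume "vs.dependent (monomial ` A)"
  then obtain T and r :: "'k poly2 \<Rightarrow> 'k" where T0: "finite T" "T \<subseteq> monomial ` A" "(\<Sum>v\<in>T. poly_scale (r v) v) = 0"
    and ex: "\<exists>v\<in>T. r v \<noteq> 0"
    unfolding vs.dependent_explicit by (elim exE conjE)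
  from ex obtain v where "v \<in> T" "r v \<noteq> 0" by (elim bexE)
  note T = T0 this
  obtain u where u: "v = monomial u" using T by blast
  have "cf (\<Sum>v\<in>T. poly_scale (r v) v) u = (\<Sum>w\<in>T. if w = v then r v else 0)"
    unfolding lookup_sum cf_poly_scale
  proof (rule sum.cong[OF refl])
    fix w assume "w \<in> T"
    then obtain u' where "w = monomial u'" using T(2) by blast
    then show "r w * cf w u = (if w = v then r v else 0)" by (auto simp: u lookup_single when_def monomial_eq_iff)
  qed
  then show False using T by (simp add: sum.delta)
qed

lemma quot_basis_monomials:
  assumes "A \<subseteq> P"
  shows "quot_basis (monspan P) (monspan A :: 'k::field poly2 set) (monomial ` (P - A))"
  unfolding quot_basis_def
proof (intro conjI)
  interpret vs: vector_space "poly_scale :: 'k \<Rightarrow> 'k poly2 \<Rightarrow> 'k poly2" by (rule vector_space_poly_scale)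
  show "(monomial ` (P - A) :: 'k poly2 set) \<subseteq> monspan P" by auto
  show "vs.span (monomial ` (P - A)) \<inter> monspan A = {0}"
    unfolding monspan_span[symmetric]
  proof (intro equalityI subsetI)
    fix f :: "'k poly2" assume "f \<in> monspan (P - A) \<inter> monspan A"
    then have "supp f = {}" unfolding monspan_def by blast
    then show "f \<in> {0}" by simp
  qed (simp add: monspan_def)
  show "monspan P \<subseteq> vs.span (monomial ` (P - A) \<union> monspan A)"
  proof
    fix f :: "'k poly2" assume f: "f \<in> monspan P"
    have "f = restr (P - A) f + restr A f"
    proof (rule poly_mapping_eqI)
      fix v
      have "cf f v = 0" if "v \<notin> P" using f that by (auto simp: monspan_def in_keys_iff)
      then show "cf f v = cf (restr (P - A) f + restr A f) v"
        using assms by (auto simp: lookup_add cf_restr)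
    qed
    moreover have "restr (P - A) f \<in> vs.span (monomial ` (P - A) \<union> monspan A)"
    proof (rule subsetD[OF vs.span_mono[OF Un_upper1]])
      show "restr (P - A) f \<in> vs.span (monomial ` (P - A))"
        unfolding monspan_span[symmetric] by (auto simp: monspan_def in_keys_iff cf_restr split: if_splits)
    qed
    moreover have "restr A f \<in> vs.span (monomial ` (P - A) \<union> monspan A)"
      by (rule vs.span_base) (auto simp: monspan_def in_keys_iff cf_restr split: if_splits)
    ultimately show "f \<in> vs.span (monomial ` (P - A) \<union> monspan A)"
      using vs.span_add by metis
  qed
qed (rule independent_monomials)

text \<open>Dropping the terms in A is a projection whose kernel on the span of P is the span of A. It maps a
basis of the quotient injectively onto a basis of the span of P - A.\<close>

lemma quot_basis_card:
  fixes E :: "'k::field poly2 set"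
  assumes sub: "A \<subseteq> P" and E: "quot_basis (monspan P) (monspan A) E"
  shows "finite E \<longleftrightarrow> finite (P - A)" "finite (P - A) \<Longrightarrow> card E = card (P - A)"
proof -
  interpret vs: vector_space "poly_scale :: 'k \<Rightarrow> 'k poly2 \<Rightarrow> 'k poly2" by (rule vector_space_poly_scale)
  interpret lin: Vector_Spaces.linear poly_scale poly_scale "restr (P - A) :: 'k poly2 \<Rightarrow> 'k poly2"
    by (rule linear_restr)
  note E = E[unfolded quot_basis_def]
  let ?m = "monomial ` (P - A) :: 'k poly2 set"
  have cm: "card ?m = card (P - A)" "finite ?m \<longleftrightarrow> finite (P - A)"
    by (auto intro!: card_image finite_image_iff simp: inj_on_def monomial_eq_iff)
  have inj: "inj_on (restr (P - A)) (vs.span E)"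
  proof (rule inj_onI)
    fix f g assume fg: "f \<in> vs.span E" "g \<in> vs.span E" "restr (P - A) f = restr (P - A) g"
    have "vs.subspace (monspan P)" unfolding monspan_span by (rule vs.subspace_span)
    then have "vs.span E \<subseteq> monspan P" using E by (intro vs.span_minimal) auto
    moreover have diff: "f - g \<in> vs.span E" using fg by (intro vs.span_diff)
    ultimately have "f - g \<in> monspan P" by blast
    moreover have "cf f v = cf g v" if "v \<in> P - A" for v
      using arg_cong[OF fg(3), of "\<lambda>h. cf h v"] that by (simp add: cf_restr)
    ultimately have "f - g \<in> monspan A"
      unfolding monspan_def by (auto simp: in_keys_iff lookup_minus subset_iff)
    then have "f - g = 0" using diff E by blast
    then show "f = g" by simp
  qed
  have ind: "vs.independent (restr (P - A) ` E)"
    by (rule lin.independent_injective_image[OF _ inj]) (use E in blast)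
  have injE: "inj_on (restr (P - A)) E" using inj vs.span_superset by (rule inj_on_subset)
  have "restr (P - A) f \<in> vs.span ?m" for f
    unfolding monspan_span[symmetric] by (auto simp: monspan_def in_keys_iff cf_restr split: if_splits)
  then have le1: "finite (restr (P - A) ` E) \<and> card (restr (P - A) ` E) \<le> card ?m" if "finite (P - A)"
    using that cm by (intro vs.independent_span_bound[OF _ ind]) auto
  have "?m \<subseteq> vs.span (restr (P - A) ` E)"
  proof
    fix f assume "f \<in> ?m"
    then obtain u where u: "u \<in> P - A" "f = monomial u" by blast
    then have "f \<in> vs.span (E \<union> monspan A)" using E by auto
    then have "restr (P - A) f \<in> vs.span (restr (P - A) ` (E \<union> monspan A))"
      unfolding lin.span_image by blast
    also have "\<dots> \<subseteq> vs.span (insert 0 (restr (P - A) ` E))"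
    proof (rule vs.span_mono)
      have "restr (P - A) g = 0" if "g \<in> monspan A" for g :: "'k poly2"
        by (rule poly_mapping_eqI) (use that in \<open>auto simp: cf_restr monspan_def in_keys_iff\<close>)
      then show "restr (P - A) ` (E \<union> monspan A) \<subseteq> insert 0 (restr (P - A) ` E)" by auto
    qed
    also have "\<dots> = vs.span (restr (P - A) ` E)" by (rule vs.span_insert_0)
    moreover have "restr (P - A) f = f"
      by (rule poly_mapping_eqI) (use u in \<open>auto simp: cf_restr lookup_single when_def\<close>)
    ultimately show "f \<in> vs.span (restr (P - A) ` E)" by auto
  qed
  then have le2: "finite ?m \<and> card ?m \<le> card (restr (P - A) ` E)" if "finite E"
    using that by (intro vs.independent_span_bound[OF _ independent_monomials]) auto
  have fE: "finite (restr (P - A) ` E) \<longleftrightarrow> finite E" using injE by (rule finite_image_iff)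
  show fin: "finite E \<longleftrightarrow> finite (P - A)" using le1 le2 fE cm(2) by blast
  show "card E = card (P - A)" if "finite (P - A)"
    using le1[OF that] le2 fin that card_image[OF injE] cm(1) by (metis le_antisym)
qed

lemma quot_dim_monspan:
  assumes "A \<subseteq> P" "finite (P - A)"
  shows "quot_dim (monspan P) (monspan A :: 'k::field poly2 set) = card (P - A)"
  unfolding quot_dim_def
  by (rule quot_basis_card(2)[OF assms(1) _ assms(2)])
    (rule someI[where P = "quot_basis (monspan P) (monspan A)", OF quot_basis_monomials[OF assms(1)]])

lemma UNIV_monspan: "(UNIV :: 'k::field poly2 set) = monspan UNIV"
  by (auto simp: monspan_def)

lemma hom_comp_monspan: "hom_comp i = monspan {u. int (mon_deg u) = i}"
  by (auto simp: hom_comp_def monspan_def)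

lemma hilbert_monspan:
  assumes "finite {u. u \<notin> N \<and> int (mon_deg u) = i}"
  shows "hilbert (monspan N :: 'k::field poly2 set) i = card {u. u \<notin> N \<and> int (mon_deg u) = i}"
proof -
  let ?P = "{u. int (mon_deg u) = i}"
  have "hom_comp i \<inter> (monspan N :: 'k poly2 set) = monspan (?P \<inter> N)"
    unfolding hom_comp_monspan by (auto simp: monspan_def)
  moreover have "?P - ?P \<inter> N = {u. u \<notin> N \<and> int (mon_deg u) = i}" by auto
  ultimately show ?thesis
    unfolding hilbert_def using quot_dim_monspan[of "?P \<inter> N" ?P] assms
    by (simp add: hom_comp_monspan)
qed

section \<open>The staircase of a lex-segment ideal\<close>

text \<open>In each column a the smallest y-exponent is n a. It is positive for a < t, and then moving one
factor from y to x, which the lex-segment property allows, shows n (a + 1) < n a.\<close>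

lemma lex_segment_staircase:
  fixes I\<^sub>0 :: "'k::field poly2 set"
  assumes mon: "monomial_ideal I\<^sub>0" and lex: "lex_segment I\<^sub>0" and proper: "I\<^sub>0 \<noteq> UNIV"
    and fin: "finite_quot_dim UNIV I\<^sub>0"
  shows "\<exists>t m. staircase t m \<and> 1 \<le> t \<and> I\<^sub>0 = monspan (staircase.M t m)"
proof -
  obtain G where G: "I\<^sub>0 = ideal_gen (monomial ` G)" using mon by (auto simp: monomial_ideal_def)
  define N where "N = {u. \<exists>g\<in>G. mon_dvd g u}"
  have I0: "I\<^sub>0 = monspan N" using G by (simp add: ideal_gen_monomials N_def)
  have up: "v \<in> N" if "u \<in> N" "mon_dvd u v" for u v
    using that mon_dvd_trans unfolding N_def by blast
  have lexN: "v \<in> N" if "u \<in> N" "mon_deg v = mon_deg u" "lex_less u v" for u v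
    using lex that unfolding lex_segment_def I0 by (metis monspan_monomial)
  obtain E where E: "finite E" "quot_basis UNIV I\<^sub>0 E" using fin by (auto simp: finite_quot_dim_def)
  have finN: "finite (- N)"
    using quot_basis_card(1)[of N UNIV E] E by (simp add: I0 UNIV_monspan[symmetric] Compl_eq_Diff_UNIV)
  have "(0, 0) \<notin> N"
  proof
    assume "(0, 0) \<in> N"
    then have "N = UNIV" using up[of "(0, 0)"] by auto
    then show False using proper I0 UNIV_monspan by blast
  qed
  have ex: "\<exists>b. (a, b) \<in> N" for a
  proof (rule ccontr)
    assume "\<nexists>b. (a, b) \<in> N"
    then have "range (\<lambda>b. (a, b)) \<subseteq> - N" by auto
    then have "finite (range (\<lambda>b :: nat. (a, b)))" using finN finite_subset by blast
    then show False by (simp add: finite_image_iff inj_on_def)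
  qed
  have ex': "\<exists>a. (a, 0) \<in> N"
  proof (rule ccontr)
    assume "\<nexists>a. (a, 0) \<in> N"
    then have "range (\<lambda>a. (a, 0 :: nat)) \<subseteq> - N" by auto
    then have "finite (range (\<lambda>a :: nat. (a, 0 :: nat)))" using finN finite_subset by blast
    then show False by (simp add: finite_image_iff inj_on_def)
  qed
  define t where "t = (LEAST a. (a, 0) \<in> N)"
  define n where "n a = (LEAST b. (a, b) \<in> N)" for a
  have tN: "(t, 0) \<in> N" unfolding t_def using LeastI_ex[OF ex'] .
  have tmin: "(a, 0) \<notin> N" if "a < t" for a using not_less_Least that unfolding t_def by blast
  have nN: "(a, n a) \<in> N" for a unfolding n_def using LeastI_ex[OF ex] .
  have nmin: "n a \<le> b" if "(a, b) \<in> N" for a b unfolding n_def using that by (rule Least_le)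
  have N_iff: "(a, b) \<in> N \<longleftrightarrow> n a \<le> b" for a b
    using nmin up[OF nN[of a], of "(a, b)"] by auto
  have t1: "1 \<le> t" using tN \<open>(0, 0) \<notin> N\<close> by (cases t) auto
  define m where "m i = n (t - i)" for i
  have st: "staircase t m"
  proof
    show "m 0 = 0" using nmin[OF tN] by (simp add: m_def)
    fix i assume i: "i < t"
    define a where "a = t - Suc i"
    have a: "t - i = Suc a" "a < t" using i by (auto simp: a_def)
    have pos: "n a > 0" using nN[of a] tmin[OF a(2)] by (cases "n a") auto
    have "(Suc a, n a - 1) \<in> N" by (rule lexN[OF nN[of a]]) (use pos in auto)
    then show "m i < m (Suc i)" using nmin[of "Suc a" "n a - 1"] pos a by (simp add: m_def a_def[symmetric])
  qed
  interpret staircase t m by (rule st)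
  have "M = N"
  proof (intro Set.set_eqI)
    fix u :: mon obtain a b where u: "u = (a, b)" by (cases u)
    show "u \<in> M \<longleftrightarrow> u \<in> N"
    proof (cases "a \<le> t")
      case True
      then show ?thesis by (simp add: M_iff u m_def N_iff)
    next
      case False
      then have "(a, b) \<in> N" using up[OF tN, of "(a, b)"] by simp
      then show ?thesis using False by (simp add: M_iff u m_0)
    qed
  qed
  then show ?thesis using st t1 I0 by blast
qed

context staircase begin

section \<open>The number of coefficients of a canonical matrix\<close>

text \<open>The degree of L i.\<close>

definition D :: "nat \<Rightarrow> nat" where "D i = t - i + m i"

text \<open>For x \<ge> t this is the Hilbert function; for x = t - 1 both are t.\<close>

definition H :: "nat \<Rightarrow> nat" where "H x = card {i \<in> {1..t}. x < D i}"

definition standard_count :: "nat \<Rightarrow> nat" where "standard_count x = card {u. u \<notin> M \<and> mon_deg u = x}"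

lemma D_mono: "i \<le> j \<Longrightarrow> j \<le> t \<Longrightarrow> D i \<le> D j"
  unfolding D_def by (rule deg_mono)

lemma D_0: "D 0 = t" by (simp add: D_def m_0)

lemma D_d: "1 \<le> i \<Longrightarrow> i \<le> t \<Longrightarrow> D i + 1 = D (i - 1) + d i"
  using m_d[of i] by (simp add: D_def)

lemma D_ge: "i \<le> t \<Longrightarrow> t \<le> D i"
  using D_mono[of 0 i] by (simp add: D_0)

lemma wL_D: "wL i = D i * B + (t - i)"
  by (simp add: L_def D_def)

lemma standard_eq: "- M = (\<lambda>(i, b). (t - i, b)) ` (SIGMA i:{1..t}. {..<m i})"
proof (intro Set.set_eqI)
  fix u :: mon obtain a b where u: "u = (a, b)" by (cases u)
  show "u \<in> - M \<longleftrightarrow> u \<in> (\<lambda>(i, b). (t - i, b)) ` (SIGMA i:{1..t}. {..<m i})"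
  proof
    assume "u \<in> - M"
    then have "a < t" "b < m (t - a)" using not_M_fst[of u] by (auto simp: u M_iff)
    then show "u \<in> (\<lambda>(i, b). (t - i, b)) ` (SIGMA i:{1..t}. {..<m i})"
      by (intro image_eqI[of _ _ "(t - a, b)"]) (auto simp: u)
  next
    assume "u \<in> (\<lambda>(i, b). (t - i, b)) ` (SIGMA i:{1..t}. {..<m i})"
    then show "u \<in> - M" by (auto simp: M_iff)
  qed
qed

lemma inj_standard: "inj_on (\<lambda>(i, b). (t - i, b)) (SIGMA i:{1..t}. {..<m i})"
  by (auto simp: inj_on_def)

lemma finite_standard: "finite (- M)"
  unfolding standard_eq by (intro finite_imageI finite_SigmaI) auto

lemma card_standard: "card (- M) = (\<Sum>i\<in>{1..t}. m i)"
  unfolding standard_eq card_image[OF inj_standard] by simp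

lemma standard_count_eq: "standard_count x = card {i \<in> {1..t}. t - i \<le> x \<and> x < D i}"
proof -
  have eq: "{u. u \<notin> M \<and> mon_deg u = x} = (\<lambda>i. (t - i, x - (t - i))) ` {i \<in> {1..t}. t - i \<le> x \<and> x < D i}"
  proof (intro Set.set_eqI iffI)
    fix u assume u: "u \<in> {u. u \<notin> M \<and> mon_deg u = x}"
    then have "u \<in> - M" by simp
    then obtain i b where i: "u = (t - i, b)" "i \<in> {1..t}" "b < m i" unfolding standard_eq by auto
    then show "u \<in> (\<lambda>i. (t - i, x - (t - i))) ` {i \<in> {1..t}. t - i \<le> x \<and> x < D i}"
      using u by (intro image_eqI[of _ _ i]) (auto simp: D_def)
  next
    fix u assume "u \<in> (\<lambda>i. (t - i, x - (t - i))) ` {i \<in> {1..t}. t - i \<le> x \<and> x < D i}"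
    then show "u \<in> {u. u \<notin> M \<and> mon_deg u = x}" by (auto simp: M_iff D_def)
  qed
  have inj: "inj_on (\<lambda>i. (t - i, x - (t - i))) {i \<in> {1..t}. t - i \<le> x \<and> x < D i}"
    by (auto simp: inj_on_def)
  show ?thesis unfolding standard_count_def eq by (rule card_image[OF inj])
qed

lemma standard_count_small: "x < t \<Longrightarrow> standard_count x = x + 1"
proof -
  assume x: "x < t"
  have "{i \<in> {1..t}. t - i \<le> x \<and> x < D i} = {t - x..t}"
    using x D_ge by (force intro: less_le_trans)
  then show ?thesis using x by (simp add: standard_count_eq)
qed

lemma standard_count_large: "t \<le> x + 1 \<Longrightarrow> standard_count x = H x"
proof -
  assume "t \<le> x + 1"
  then have "{i \<in> {1..t}. t - i \<le> x \<and> x < D i} = {i \<in> {1..t}. x < D i}" by auto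
  then show ?thesis by (simp add: standard_count_eq H_def)
qed

lemma H_diff: "int (H x) - int (H (Suc x)) = int (card {i \<in> {1..t}. D i = Suc x})"
proof -
  have "{i \<in> {1..t}. x < D i} = {i \<in> {1..t}. Suc x < D i} \<union> {i \<in> {1..t}. D i = Suc x}" by auto
  then have "H x = H (Suc x) + card {i \<in> {1..t}. D i = Suc x}"
    unfolding H_def by (simp add: card_Un_disjoint disjoint_iff)
  then show ?thesis by simp
qed

lemma H_zero: "D t \<le> x \<Longrightarrow> H x = 0"
proof -
  assume x: "D t \<le> x"
  have "D i \<le> x" if "i \<in> {1..t}" for i using D_mono[of i t] that x by simp
  then have "{i \<in> {1..t}. x < D i} = {}" by (auto simp: not_less)
  then show ?thesis unfolding H_def by simp
qed

text \<open>On and above the diagonal the x-exponent decides in favour of the bound, below it against it.\<close>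

lemma bnd_upper: "1 \<le> i \<Longrightarrow> i \<le> j \<Longrightarrow> j \<le> t \<Longrightarrow> bnd i j b \<longleftrightarrow> b + D j \<le> D i + 1"
proof -
  assume ij: "1 \<le> i" "i \<le> j" "j \<le> t"
  have small: "t - j \<le> t - i" "t - i + 1 < B" using ij by (auto simp: B_def)
  have "bnd i j b \<longleftrightarrow> (b + D j) * B + (t - j) < (D i + 1) * B + (t - i + 1)"
    unfolding bnd_def wL_D by (auto simp: algebra_simps)
  also have "\<dots> \<longleftrightarrow> b + D j \<le> D i + 1"
  proof
    assume *: "(b + D j) * B + (t - j) < (D i + 1) * B + (t - i + 1)"
    show "b + D j \<le> D i + 1"
    proof (rule ccontr)
      assume "\<not> b + D j \<le> D i + 1"
      then have "(D i + 2) * B \<le> (b + D j) * B" by (intro mult_le_mono1) simp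
      then show False using * small by (simp add: algebra_simps)
    qed
  next
    assume "b + D j \<le> D i + 1"
    then have "(b + D j) * B \<le> (D i + 1) * B" by (rule mult_le_mono1)
    then show "(b + D j) * B + (t - j) < (D i + 1) * B + (t - i + 1)" using small by linarith
  qed
  finally show ?thesis .
qed

lemma bnd_lower: "j < i \<Longrightarrow> i \<le> t \<Longrightarrow> b < d (Suc j) \<Longrightarrow> bnd i j b"
proof -
  assume ij: "j < i" "i \<le> t" "b < d (Suc j)"
  have "b + D j \<le> D (Suc j)" using D_d[of "Suc j"] ij by simp
  also have "\<dots> \<le> D i" using ij by (intro D_mono) auto
  finally have "(b + D j) * B \<le> D i * B" by (rule mult_le_mono1)
  moreover have "t - j < B" by (simp add: B_def)
  ultimately show ?thesis unfolding bnd_def wL_D by (simp add: algebra_simps)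
qed

text \<open>The degrees D increase weakly, so the bound leaves room for two coefficients if D j = D i, for
one if D j = D i + 1, and for none beyond. The restriction to degree less than d i removes one of the two exactly
if d i = 1, that is D (i - 1) = D i.\<close>

lemma card_upper:
  assumes i: "1 \<le> i" "i \<le> j" "j \<le> t"
  shows "int (card {b. (i, j, b) \<in> S}) =
    1 - of_bool (D i + 1 < D j) + of_bool (D j = D i \<and> D (i - 1) < D i)"
proof -
  have Dij: "D i \<le> D j" using i by (intro D_mono) auto
  have di: "1 \<le> d i" using d_pos[of i] i by simp
  have "{b. (i, j, b) \<in> S} = {b. b < d i \<and> b + D j \<le> D i + 1}"
    using i bnd_upper[OF i] by (auto simp: S_def Q_def canon_def)
  also have "\<dots> = {..<min (d i) (D i + 2 - D j)}" by auto
  finally have "card {b. (i, j, b) \<in> S} = min (d i) (D i + 2 - D j)" by simp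
  moreover have "D (i - 1) < D i \<longleftrightarrow> 2 \<le> d i" using D_d[of i] i by linarith
  ultimately show ?thesis using Dij di by (auto simp: of_bool_def min_def)
qed

lemma card_lower:
  assumes "j < i" "i \<le> t" shows "card {b. (i, j, b) \<in> S} = d (Suc j)"
proof -
  have "{b. (i, j, b) \<in> S} = {..<d (Suc j)}"
    using assms bnd_lower by (auto simp: S_def Q_def canon_def)
  then show ?thesis by simp
qed

lemma sum_d: "i \<le> t \<Longrightarrow> (\<Sum>j<i. d (Suc j)) = m i"
proof (induction i)
  case (Suc i)
  then show ?case using m_d[of "Suc i"] by simp
qed (simp add: m_0)

lemma card_S_sum: "card S = (\<Sum>i\<in>{1..t}. \<Sum>j\<le>t. card {b. (i, j, b) \<in> S})"
proof -
  have fin: "finite {b. (i, j, b) \<in> S}" for i j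
    by (rule finite_subset[of _ "(\<lambda>(i, j, b). b) ` S"]) (force simp: finite_S)+
  have "S = (SIGMA i:{1..t}. SIGMA j:{..t}. {b. (i, j, b) \<in> S})"
    by (auto simp: S_def Q_def)
  then have "card S = card (SIGMA i:{1..t}. SIGMA j:{..t}. {b. (i, j, b) \<in> S})" by simp
  also have "\<dots> = (\<Sum>i\<in>{1..t}. \<Sum>j\<le>t. card {b. (i, j, b) \<in> S})"
    using fin by (simp add: card_SigmaI)
  finally show ?thesis .
qed

text \<open>Every j with D j > t = D 0 has exactly one i \<le> j at which the value D j is reached for the
first time.\<close>

lemma sum_jumps:
  "(\<Sum>i\<in>{1..t}. \<Sum>j\<in>{i..t}. of_bool (D j = D i \<and> D (i - 1) < D i)) = int (H t)"
proof -
  have one: "(\<Sum>i\<in>{1..t}. of_bool (i \<le> j \<and> D j = D i \<and> D (i - 1) < D i)) = (of_bool (t < D j) :: int)"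
    if j: "j \<in> {1..t}" for j
  proof (cases "t < D j")
    case True
    define i0 where "i0 = (LEAST i. D i = D j)"
    have Di0: "D i0 = D j" unfolding i0_def by (rule LeastI) simp
    have le: "i0 \<le> i" if "D i = D j" for i unfolding i0_def using that by (rule Least_le)
    have i0: "i0 \<noteq> 0" using Di0 True by (auto simp: D_0 intro: ccontr)
    have i0j: "i0 \<le> j" using le by simp
    have pre: "D (i0 - 1) < D i0"
    proof -
      have "D (i0 - 1) \<le> D i0" using i0j j by (intro D_mono) auto
      moreover have "D (i0 - 1) \<noteq> D i0" using le[of "i0 - 1"] Di0 i0 by auto
      ultimately show ?thesis by simp
    qed
    have uniq: "i = i0" if "i \<in> {1..t}" "D j = D i" "D (i - 1) < D i" for i
    proof (rule ccontr)
      assume "i \<noteq> i0"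
      then have "i0 \<le> i - 1" using le[of i] that by auto
      then have "D i0 \<le> D (i - 1)" using that by (intro D_mono) auto
      then show False using that Di0 by simp
    qed
    have "(\<Sum>i\<in>{1..t}. of_bool (i \<le> j \<and> D j = D i \<and> D (i - 1) < D i)) = (\<Sum>i\<in>{1..t}. if i = i0 then 1 else 0 :: int)"
    proof (rule sum.cong[OF refl])
      fix i assume i: "i \<in> {1..t}"
      show "of_bool (i \<le> j \<and> D j = D i \<and> D (i - 1) < D i) = (if i = i0 then 1 else 0 :: int)"
      proof (cases "i = i0")
        case False
        then show ?thesis using uniq[OF i] by (simp only: of_bool_def if_False) metis
      qed (use Di0 i0j pre in simp)
    qed
    then show ?thesis using True i0 i0j j by (simp add: sum.delta)
  next
    case False
    have "\<not> (i \<le> j \<and> D j = D i \<and> D (i - 1) < D i)" if "i \<in> {1..t}" for i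
    proof -
      have "i - 1 \<le> t" using that by auto
      then have "t \<le> D (i - 1)" by (rule D_ge)
      then show ?thesis using False by linarith
    qed
    then have "(\<Sum>i\<in>{1..t}. of_bool (i \<le> j \<and> D j = D i \<and> D (i - 1) < D i)) = (\<Sum>i\<in>{1..t}. 0 :: int)"
      by (intro sum.cong) auto
    then show ?thesis using False by simp
  qed
  have "(\<Sum>i\<in>{1..t}. \<Sum>j\<in>{i..t}. of_bool (D j = D i \<and> D (i - 1) < D i)) =
      (\<Sum>i\<in>{1..t}. \<Sum>j\<in>{1..t}. of_bool (i \<le> j \<and> D j = D i \<and> D (i - 1) < D i) :: int)"
  proof (rule sum.cong[OF refl])
    fix i assume "i \<in> {1..t}"
    then show "(\<Sum>j\<in>{i..t}. of_bool (D j = D i \<and> D (i - 1) < D i)) =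
      (\<Sum>j\<in>{1..t}. of_bool (i \<le> j \<and> D j = D i \<and> D (i - 1) < D i) :: int)"
      by (intro sum.mono_neutral_cong_left) auto
  qed
  also have "\<dots> = (\<Sum>j\<in>{1..t}. of_bool (t < D j))"
    by (subst sum.swap) (rule sum.cong[OF refl one])
  also have "\<dots> = int (H t)" by (simp add: H_def sum.If_cases of_bool_def Int_def)
  finally show ?thesis .
qed

lemma sum_gaps:
  assumes i: "i \<in> {1..t}"
  shows "(\<Sum>j\<in>{i..t}. of_bool (D i + 1 < D j)) = int (H (D i + 1))"
proof -
  have "(\<Sum>j\<in>{i..t}. of_bool (D i + 1 < D j)) = (\<Sum>j\<in>{1..t}. of_bool (D i + 1 < D j) :: int)"
  proof (rule sum.mono_neutral_left)
    show "\<forall>j\<in>{1..t} - {i..t}. of_bool (D i + 1 < D j) = (0 :: int)"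
    proof
      fix j assume "j \<in> {1..t} - {i..t}"
      then have "D j \<le> D i" using i by (intro D_mono) auto
      then show "of_bool (D i + 1 < D j) = (0 :: int)" by simp
    qed
  qed (use i in auto)
  also have "\<dots> = int (H (D i + 1))" by (simp add: H_def sum.If_cases of_bool_def Int_def)
  finally show ?thesis .
qed

lemma card_S: "int (card S) = (\<Sum>i\<in>{1..t}. int (m i)) + (\<Sum>i\<in>{1..t}. int (t + 1 - i)) + int (H t)
    - (\<Sum>i\<in>{1..t}. int (H (D i + 1)))"
proof -
  have row: "int (\<Sum>j\<le>t. card {b. (i, j, b) \<in> S}) = int (m i) + int (t + 1 - i) - int (H (D i + 1))
      + (\<Sum>j\<in>{i..t}. of_bool (D j = D i \<and> D (i - 1) < D i))" if i: "i \<in> {1..t}" for i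
  proof -
    have "{..t} = {..<i} \<union> {i..t}" "{..<i} \<inter> {i..t} = {}" using i by auto
    then have "(\<Sum>j\<le>t. card {b. (i, j, b) \<in> S}) = (\<Sum>j<i. card {b. (i, j, b) \<in> S}) + (\<Sum>j\<in>{i..t}. card {b. (i, j, b) \<in> S})"
      by (simp add: sum.union_disjoint)
    moreover have "(\<Sum>j<i. card {b. (i, j, b) \<in> S}) = m i"
      using i by (simp add: card_lower sum_d)
    moreover have "int (\<Sum>j\<in>{i..t}. card {b. (i, j, b) \<in> S}) =
        (\<Sum>j\<in>{i..t}. 1 - of_bool (D i + 1 < D j) + of_bool (D j = D i \<and> D (i - 1) < D i))"
      unfolding of_nat_sum by (rule sum.cong[OF refl], rule card_upper) (use i in auto)
    moreover have "\<dots> = int (t + 1 - i) - int (H (D i + 1)) + (\<Sum>j\<in>{i..t}. of_bool (D j = D i \<and> D (i - 1) < D i))"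
      unfolding sum.distrib sum_subtractf sum_gaps[OF i] using i by simp
    ultimately show ?thesis by simp
  qed
  have "int (card S) = (\<Sum>i\<in>{1..t}. int (\<Sum>j\<le>t. card {b. (i, j, b) \<in> S}))"
    unfolding card_S_sum by simp
  also have "\<dots> = (\<Sum>i\<in>{1..t}. int (m i) + int (t + 1 - i) - int (H (D i + 1))
      + (\<Sum>j\<in>{i..t}. of_bool (D j = D i \<and> D (i - 1) < D i)))"
    by (rule sum.cong[OF refl row])
  finally show ?thesis unfolding sum.distrib sum_subtractf sum_jumps by simp
qed

text \<open>Up to degree t the difference h (x - 1) - h (x - 2) is 1. Beyond, it is minus the number of i with
D i = x - 1, so the sum over x becomes a sum over i.\<close>

lemma sum_hilbert:
  assumes t: "1 \<le> t" and h: "\<And>x. h (int x) = int (standard_count x)" and hneg: "h (- 1) = 0"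
  shows "1 + (\<Sum>i | i \<ge> 1 \<and> h i \<noteq> 0. h i * (h (i - 1) - h (i - 2))) =
    (\<Sum>i\<in>{1..t}. int (t + 1 - i)) + int (H t) - (\<Sum>i\<in>{1..t}. int (H (D i + 1)))"
proof -
  \<comment> \<open>The Hilbert function vanishes from degree D t on.\<close>
  define K where "K = D t + 1"
  have tK: "t \<le> K" using D_ge[of t] by (simp add: K_def)
  let ?f = "\<lambda>i. h i * (h (i - 1) - h (i - 2))"
  have zero: "h (int x) = 0" if "K < x" for x
    using H_zero[of x] standard_count_large[of x] that tK by (simp add: h K_def)
  have "(\<Sum>i | i \<ge> 1 \<and> h i \<noteq> 0. ?f i) = (\<Sum>i\<in>int ` {1..K}. ?f i)"
  proof (rule sum.mono_neutral_left)
    show "{i. i \<ge> 1 \<and> h i \<noteq> 0} \<subseteq> int ` {1..K}"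
    proof
      fix i assume "i \<in> {i. i \<ge> 1 \<and> h i \<noteq> 0}"
      then have "i = int (nat i)" "1 \<le> nat i" "\<not> K < nat i" using zero[of "nat i"] by auto
      then show "i \<in> int ` {1..K}" by (intro image_eqI[of _ _ "nat i"]) auto
    qed
  qed auto
  also have "\<dots> = (\<Sum>x\<in>{1..K}. ?f (int x))" by (simp add: sum.reindex)
  also have "{1..K} = {1..t} \<union> {Suc t..K}" using tK t by auto
  also have "(\<Sum>x\<in>{1..t} \<union> {Suc t..K}. ?f (int x)) = (\<Sum>x\<in>{1..t}. ?f (int x)) + (\<Sum>x\<in>{Suc t..K}. ?f (int x))"
    by (rule sum.union_disjoint) auto
  also have "(\<Sum>x\<in>{1..t}. ?f (int x)) = (\<Sum>x\<in>{1..t}. int (standard_count x))"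
  proof (rule sum.cong[OF refl])
    fix x assume "x \<in> {1..t}"
    then have x: "1 \<le> x" "x - 1 < t" "x - 2 < t" by auto
    have 1: "h (int x - 1) = int x"
      using h[of "x - 1"] standard_count_small[OF x(2)] x by (simp add: of_nat_diff)
    have 2: "h (int x - 2) = int x - 1"
    proof (cases "x = 1")
      case False
      then show ?thesis using h[of "x - 2"] standard_count_small[OF x(3)] x(1) by (simp add: of_nat_diff)
    qed (use hneg in simp)
    show "?f (int x) = int (standard_count x)" by (simp add: 1 2 h)
  qed
  also have "(\<Sum>x\<in>{1..t}. int (standard_count x)) = (\<Sum>i\<in>{1..t}. int (t + 1 - i)) - 1 + int (H t)"
  proof -
    obtain s where s: "t = Suc s" using t by (cases t) auto
    have "(\<Sum>x\<in>{1..s}. int (standard_count x)) = (\<Sum>x\<in>{1..s}. int x + 1)"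
      by (rule sum.cong) (use standard_count_small s in auto)
    moreover have "(\<Sum>x\<in>{1..s}. int x + 1) + 1 = (\<Sum>x\<in>{1..Suc s}. int x)"
      by (induction s) auto
    moreover have "(\<Sum>x\<in>{1..Suc s}. int x) = (\<Sum>i\<in>{1..t}. int (t + 1 - i))"
      unfolding s by (rule sum.reindex_bij_witness[of _ "\<lambda>i. Suc s + 1 - i" "\<lambda>i. Suc s + 1 - i"]) auto
    moreover have "(\<Sum>x\<in>{1..t}. int (standard_count x)) = (\<Sum>x\<in>{1..s}. int (standard_count x)) + int (standard_count t)"
      unfolding s by simp
    moreover have "standard_count t = H t" by (rule standard_count_large) simp
    ultimately show ?thesis by simp
  qed
  also have "(\<Sum>x\<in>{Suc t..K}. ?f (int x)) = - (\<Sum>i\<in>{1..t}. int (H (D i + 1)))"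
  proof -
    have "?f (int x) = - (\<Sum>i\<in>{1..t}. if x = D i + 1 then int (H (D i + 1)) else 0)" if x: "x \<in> {Suc t..K}" for x
    proof -
      have hx: "h (int x) = int (H x)" using standard_count_large[of x] x by (simp add: h)
      have h1: "h (int x - 1) = int (H (x - 1))"
        using h[of "x - 1"] standard_count_large[of "x - 1"] x by (simp add: of_nat_diff)
      have h2: "h (int x - 2) = int (H (x - 2))"
      proof -
        have "t \<le> x - 2 + 1" "2 \<le> x" using x t by auto
        then show ?thesis using h[of "x - 2"] standard_count_large[of "x - 2"] by (simp add: of_nat_diff)
      qed
      have "int (H (x - 2)) - int (H (x - 1)) = int (card {i \<in> {1..t}. D i = x - 1})"
        using H_diff[of "x - 2"] x t by (simp add: Suc_diff_Suc numeral_2_eq_2)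
      also have "\<dots> = (\<Sum>i\<in>{1..t}. if x = D i + 1 then 1 else 0)"
      proof -
        have "{i \<in> {1..t}. D i = x - 1} = {i \<in> {1..t}. x = D i + 1}" using x by auto
        then show ?thesis by (simp add: sum.If_cases Int_def)
      qed
      finally have "?f (int x) = - (\<Sum>i\<in>{1..t}. int (H x) * (if x = D i + 1 then 1 else 0))"
        unfolding hx h1 h2 sum_distrib_left[symmetric]
        by (metis minus_diff_eq mult_minus_right)
      also have "\<dots> = - (\<Sum>i\<in>{1..t}. if x = D i + 1 then int (H (D i + 1)) else 0)"
        by (intro arg_cong[of _ _ uminus] sum.cong) auto
      finally show ?thesis .
    qed
    then have "(\<Sum>x\<in>{Suc t..K}. ?f (int x)) = - (\<Sum>x\<in>{Suc t..K}. \<Sum>i\<in>{1..t}. if x = D i + 1 then int (H (D i + 1)) else 0)"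
      unfolding sum_negf[symmetric] by (intro sum.cong) auto
    also have "(\<Sum>x\<in>{Suc t..K}. \<Sum>i\<in>{1..t}. if x = D i + 1 then int (H (D i + 1)) else 0) =
        (\<Sum>i\<in>{1..t}. \<Sum>x\<in>{Suc t..K}. if x = D i + 1 then int (H (D i + 1)) else 0)"
      by (rule sum.swap)
    also have "\<dots> = (\<Sum>i\<in>{1..t}. int (H (D i + 1)))"
    proof (rule sum.cong[OF refl])
      fix i assume i: "i \<in> {1..t}"
      have "D i + 1 \<in> {Suc t..K}" using D_ge[of i] D_mono[of i t] i by (simp add: K_def)
      then show "(\<Sum>x\<in>{Suc t..K}. if x = D i + 1 then int (H (D i + 1)) else 0) = int (H (D i + 1))"
        by (simp add: sum.delta)
    qed
    finally show ?thesis .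
  qed
  finally show ?thesis by simp
qed

end

section \<open>The dimension of the cell\<close>

lemma extend_ac_monspan:
  assumes "up_closed N"
  shows "extend_ac (monspan N :: 'k::field poly2 set) = monspan N"
proof -
  have "up_closed N \<Longrightarrow> {u. \<exists>m\<in>N. mon_dvd m u} = N"
    by (auto simp: up_closed_def mon_dvd_iff simp del: split_paired_Ex) (metis add_0)
  then have gen: "(ideal_gen (monomial ` N) :: 'k alg_closure poly2 set) = monspan N"
    using assms by (simp add: ideal_gen_monomials)
  have "Poly_Mapping.map to_ac ` (monspan N :: 'k poly2 set) \<subseteq> monspan N"
    by (auto simp: monspan_def in_keys_iff Poly_Mapping.map.rep_eq)
  then have "extend_ac (monspan N :: 'k poly2 set) \<subseteq> monspan N"
    unfolding extend_ac_def by (intro ideal_gen_least monspan_ideal assms)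
  moreover have "(monomial ` N :: 'k alg_closure poly2 set) \<subseteq> Poly_Mapping.map to_ac ` (monspan N :: 'k poly2 set)"
  proof
    fix f :: "'k alg_closure poly2" assume "f \<in> monomial ` N"
    then obtain u where u: "u \<in> N" "f = monomial u" by blast
    have "Poly_Mapping.map to_ac (monomial u :: 'k poly2) = monomial u" by simp
    then show "f \<in> Poly_Mapping.map to_ac ` (monspan N :: 'k poly2 set)" using u by (metis image_eqI monspan_monomial)
  qed
  then have "monspan N \<subseteq> extend_ac (monspan N :: 'k poly2 set)"
    unfolding gen[symmetric] extend_ac_def
    by (intro ideal_gen_least ideal_gen_ideal) (use ideal_gen_superset in blast)
  ultimately show ?thesis by blast
qed

text \<open>Over a finite field the polynomial 1 + \<Prod>(x - a) has no zero.\<close>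

lemma infinite_alg_closed_field: "infinite (UNIV :: 'a::alg_closed_field set)"
proof
  assume fin: "finite (UNIV :: 'a set)"
  define p :: "'a poly" where "p = (\<Prod>a\<in>UNIV. [:- a, 1:]) + 1"
  have "Polynomial.degree (\<Prod>a\<in>(UNIV :: 'a set). [:- a, 1:]) = card (UNIV :: 'a set)"
    by (subst degree_prod_eq_sum_degree) auto
  moreover have "card (UNIV :: 'a set) > 0" using fin by (simp add: card_gt_0_iff)
  ultimately have "Polynomial.degree p > 0" unfolding p_def by (subst degree_add_eq_left) auto
  then obtain x where "poly p x = 0" using alg_closed_imp_poly_has_root by blast
  moreover have "poly (\<Prod>a\<in>UNIV. [:- a, 1:]) x = 0"
    unfolding poly_prod using fin by (intro prod_zero) auto
  ultimately show False by (simp add: p_def)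
qed

theorem proposition4p1:
  fixes I\<^sub>0 :: "'k::field poly2 set"
  assumes "monomial_ideal I\<^sub>0" and "lex_segment I\<^sub>0" and "I\<^sub>0 \<noteq> UNIV"
    and "finite_quot_dim UNIV I\<^sub>0"
  shows "let h = (\<lambda>i. int (hilbert I\<^sub>0 i));
             d = int (quot_dim UNIV I\<^sub>0) + 1 +
                 (\<Sum>i | i \<ge> 1 \<and> h i \<noteq> 0. h i * (h (i - 1) - h (i - 2)))
         in dim_variety I\<^sub>0 = ereal (real_of_int d) \<and>
            (infinite (UNIV :: 'k set) \<longrightarrow> dim_points I\<^sub>0 = ereal (real_of_int d))"
proof -
  obtain t m where "staircase t m" and t: "1 \<le> t" and I0: "I\<^sub>0 = monspan (staircase.M t m)"
    using lex_segment_staircase[OF assms] by blast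
  then interpret staircase t m by simp
  have up: "up_closed M" unfolding up_closed_def M_def using mon_dvd_trans[OF _ mon_dvd_add] by blast
  define h where "h = (\<lambda>i. int (hilbert I\<^sub>0 i))"
  define d where "d = int (quot_dim UNIV I\<^sub>0) + 1 + (\<Sum>i | i \<ge> 1 \<and> h i \<noteq> 0. h i * (h (i - 1) - h (i - 2)))"
  have fin: "finite {u. u \<notin> M \<and> int (mon_deg u) = i}" for i
    by (rule finite_subset[OF _ finite_standard]) auto
  have hx: "h (int x) = int (standard_count x)" for x
    using hilbert_monspan[OF fin, of "int x", where 'k = 'k] by (simp add: h_def I0 standard_count_def)
  have hneg: "h (- 1) = 0"
    using hilbert_monspan[OF fin, of "- 1", where 'k = 'k] by (simp add: h_def I0)
  have "quot_dim UNIV I\<^sub>0 = card (- M)"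
    using quot_dim_monspan[of M UNIV, where 'k = 'k] finite_standard
    by (simp add: I0 UNIV_monspan[symmetric] Compl_eq_Diff_UNIV)
  then have dS: "d = int (card S)"
    using card_S sum_hilbert[OF t hx hneg] by (simp add: d_def card_standard)
  have "dim_variety I\<^sub>0 = ereal (real_of_int d)"
    unfolding dim_variety_def I0 extend_ac_monspan[OF up] dim_points_monspan[OF infinite_alg_closed_field]
    by (simp add: dS)
  moreover have "dim_points I\<^sub>0 = ereal (real_of_int d)" if "infinite (UNIV :: 'k set)"
    unfolding I0 dim_points_monspan[OF that] by (simp add: dS)
  ultimately show ?thesis unfolding h_def d_def Let_def by blast
qed

end
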